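(* Let $n\geq 3$ and let $a=a_1+ia_2\in\mathbb{C}^{n}$ be such that $a_1,a_2\in\mathbb{R}^{n}$ are linearly independent. Let $\phi:\mathbf{SL}_n(\mathbb{R})/\mathbf{SO}(n)\to\mathbb{C}$ be the complex-valued eigenfunction defined by $$\phi(x\cdot\mathbf{SO}(n))=\operatorname{trace}(aa^txx^t).$$ Then the inverse image $\phi^{-1}(\{0\})$ is a complete minimal submanifold of $\mathbf{SL}_n(\mathbb{R})/\mathbf{SO}(n)$ of codimension two.
   Context: $\mathbf{SL}_n(\mathbb{R})$ is the group of real $n\times n$ matrices of determinant $1$, and $\mathbf{SO}(n)=\{x\in\mathbf{SL}_n(\mathbb{R}) : xx^t=I_n\}$. Vectors are column vectors and $a^t$ is the transpose (no conjugation). Metric: $\mathbf{GL}_n(\mathbb{C})$ carries the left-invariant Riemannian metric induced by the inner product $g(Z,W)=\operatorname{Re}\operatorname{trace}(ZW^* )$ on its Lie algebra $\mathbb{C}^{n\times n}$, where $W^*$ is the conjugate transpose. $\mathbf{SL}_n(\mathbb{R})$ carries the induced left-invariant metric, and $\mathbf{SL}_n(\mathbb{R})/\mathbf{SO}(n)$ carries the Riemannian metric for which the natural projection $\mathbf{SL}_n(\mathbb{R})\to\mathbf{SL}_n(\mathbb{R})/\mathbf{SO}(n)$ is a Riemannian submersion; it is a non-compact Riemannian symmetric space. Eigenfunction: on a Riemannian manifold $(M,g)$, with $g$ extended complex bilinearly to the complexified tangent bundle, let $\tau(\phi)=\operatorname{div}(\nabla\phi)$ be the Laplace-Beltrami operator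 and $\kappa(\phi,\psi)=g(\nabla\phi,\nabla\psi)$ the conformality operator. A function $\phi:M\to\mathbb{C}$ is an eigenfunction if there are $\lambda,\mu\in\mathbb{C}$ with $\tau(\phi)=\lambda\phi$ and $\kappa(\phi,\phi)=\mu\phi^2$. *)

theory Defs
  imports "HOL-Analysis.Analysis"
begin

section \<open>Smooth maps between Euclidean spaces\<close>

primrec Ck_on :: "nat \<Rightarrow> 'a::real_normed_vector set \<Rightarrow> ('a \<Rightarrow> 'b::real_normed_vector) \<Rightarrow> bool" where
  "Ck_on 0 S f \<longleftrightarrow> continuous_on S f"
| "Ck_on (Suc k) S f \<longleftrightarrow>
     (\<forall>x\<in>S. f differentiable (at x)) \<and> (\<forall>v. Ck_on k S (\<lambda>x. frechet_derivative f (at x) v))"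

text \<open>Meant for open \<open>S\<close>, in finite dimension.\<close>
definition smooth_on :: "'a::real_normed_vector set \<Rightarrow> ('a \<Rightarrow> 'b::real_normed_vector) \<Rightarrow> bool" where
  "smooth_on S f \<longleftrightarrow> (\<forall>k. Ck_on k S f)"

text \<open>Smoothness on a subset that need not be open: local smooth extendability.\<close>
definition smooth_on_subset :: "'a::real_normed_vector set \<Rightarrow> ('a \<Rightarrow> 'b::real_normed_vector) \<Rightarrow> bool" where
  "smooth_on_subset S f \<longleftrightarrow>
     (\<forall>x\<in>S. \<exists>W F. open W \<and> x \<in> W \<and> smooth_on W F \<and> (\<forall>y\<in>W \<inter> S. F y = f y))"


section \<open>Riemannian manifolds\<close>

text \<open>A chart is a pair \<open>(U, c)\<close> of a domain and a coordinate map into the model space \<open>'e\<close>, so the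
  manifold has dimension \<open>DIM('e)\<close>. The metric is given by its coordinate expressions:
  \<open>metric M (U, c) y u v\<close> is the value at the point with coordinates \<open>y\<close>, on the tangent vectors with
  components \<open>u\<close> and \<open>v\<close> in that chart.\<close>

type_synonym ('p, 'e) chart = "'p set \<times> ('p \<Rightarrow> 'e)"

type_synonym 'e local_metric = "'e \<Rightarrow> 'e \<Rightarrow> 'e \<Rightarrow> real"

record ('p, 'e) riemannian =
  points :: "'p set"
  charts :: "('p, 'e) chart set"
  metric :: "('p, 'e) chart \<Rightarrow> 'e local_metric"

definition manifold_topology :: "('p, 'e::euclidean_space) riemannian \<Rightarrow> 'p topology" where
  "manifold_topology M =
     topology (\<lambda>W. W \<subseteq> points M \<and> (\<forall>(U, c)\<in>charts M. open (c ` (U \<inter> W))))"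

definition smooth_manifold :: "('p, 'e::euclidean_space) riemannian \<Rightarrow> bool" where
  "smooth_manifold M \<longleftrightarrow>
     (\<Union>(U, c)\<in>charts M. U) = points M \<and>
     (\<forall>(U, c)\<in>charts M. inj_on c U \<and> open (c ` U)) \<and>
     (\<forall>(U, c)\<in>charts M. \<forall>(V, d)\<in>charts M.
        open (c ` (U \<inter> V)) \<and> smooth_on (c ` (U \<inter> V)) (d \<circ> inv_into U c)) \<and>
     Hausdorff_space (manifold_topology M) \<and>
     second_countable (manifold_topology M)"

definition riemannian_manifold :: "('p, 'e::euclidean_space) riemannian \<Rightarrow> bool" where
  "riemannian_manifold M \<longleftrightarrow>
     smooth_manifold M \<and>
     (\<forall>(U, c)\<in>charts M.
        (\<forall>y\<in>c ` U.
           bilinear (metric M (U, c) y) \<and>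
           (\<forall>u v. metric M (U, c) y u v = metric M (U, c) y v u) \<and>
           (\<forall>u. u \<noteq> 0 \<longrightarrow> metric M (U, c) y u u > 0)) \<and>
        (\<forall>u v. smooth_on (c ` U) (\<lambda>y. metric M (U, c) y u v))) \<and>
     (\<forall>(U, c)\<in>charts M. \<forall>(V, d)\<in>charts M. \<forall>y\<in>c ` (U \<inter> V). \<forall>u v.
        metric M (U, c) y u v =
          (let F = d \<circ> inv_into U c; F' = frechet_derivative F (at y)
           in metric M (V, d) (F y) (F' u) (F' v)))"


subsection \<open>Levi-Civita connection, gradient and divergence in a chart\<close>

text \<open>\<open>christoffel g y u v\<close> is \<open>\<nabla>\<^sub>u v\<close> at \<open>y\<close> for the vector fields with constant components \<open>u\<close> and \<open>v\<close>;
  for such fields the Lie brackets in the Koszul formula vanish.\<close>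
definition christoffel :: "'e::euclidean_space local_metric \<Rightarrow> 'e \<Rightarrow> 'e \<Rightarrow> 'e \<Rightarrow> 'e" where
  "christoffel g y u v =
     (THE w. \<forall>z. 2 * g y w z =
        frechet_derivative (\<lambda>x. g x v z) (at y) u +
        frechet_derivative (\<lambda>x. g x u z) (at y) v -
        frechet_derivative (\<lambda>x. g x u v) (at y) z)"

definition covariant_derivative ::
    "'e::euclidean_space local_metric \<Rightarrow> 'e \<Rightarrow> 'e \<Rightarrow> ('e \<Rightarrow> 'e) \<Rightarrow> 'e" where
  "covariant_derivative g y u X = frechet_derivative X (at y) u + christoffel g y u (X y)"

definition gradient :: "'e::euclidean_space local_metric \<Rightarrow> ('e \<Rightarrow> real) \<Rightarrow> 'e \<Rightarrow> 'e" where
  "gradient g f y = (THE w. \<forall>z. g y w z = frechet_derivative f (at y) z)"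

text \<open>The trace of the endomorphism \<open>u \<mapsto> \<nabla>\<^sub>u X\<close>; it can be taken with respect to any basis.\<close>
definition divergence :: "'e::euclidean_space local_metric \<Rightarrow> ('e \<Rightarrow> 'e) \<Rightarrow> 'e \<Rightarrow> real" where
  "divergence g X y = (\<Sum>b\<in>Basis. covariant_derivative g y b X \<bullet> b)"


subsection \<open>Eigenfunctions\<close>

text \<open>For complex-valued functions, \<open>\<tau>\<close> is extended complex linearly and \<open>\<kappa>\<close> complex bilinearly.\<close>

definition laplace_beltrami :: "'e::euclidean_space local_metric \<Rightarrow> ('e \<Rightarrow> complex) \<Rightarrow> 'e \<Rightarrow> complex" where
  "laplace_beltrami g f y =
     Complex (divergence g (gradient g (\<lambda>x. Re (f x))) y)
             (divergence g (gradient g (\<lambda>x. Im (f x))) y)"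

definition conformality ::
    "'e::euclidean_space local_metric \<Rightarrow> ('e \<Rightarrow> complex) \<Rightarrow> ('e \<Rightarrow> complex) \<Rightarrow> 'e \<Rightarrow> complex" where
  "conformality g f h y =
     (let f1 = gradient g (\<lambda>x. Re (f x)) y; f2 = gradient g (\<lambda>x. Im (f x)) y;
          h1 = gradient g (\<lambda>x. Re (h x)) y; h2 = gradient g (\<lambda>x. Im (h x)) y
      in Complex (g y f1 h1 - g y f2 h2) (g y f1 h2 + g y f2 h1))"

definition eigenfunction :: "('p, 'e::euclidean_space) riemannian \<Rightarrow> ('p \<Rightarrow> complex) \<Rightarrow> bool" where
  "eigenfunction M \<phi> \<longleftrightarrow>
     riemannian_manifold M \<and>
     (\<forall>(U, c)\<in>charts M. smooth_on (c ` U) (\<phi> \<circ> inv_into U c)) \<and>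
     (\<exists>l m. \<forall>(U, c)\<in>charts M. \<forall>p\<in>U.
        laplace_beltrami (metric M (U, c)) (\<phi> \<circ> inv_into U c) (c p) = l * \<phi> p \<and>
        conformality (metric M (U, c)) (\<phi> \<circ> inv_into U c) (\<phi> \<circ> inv_into U c) (c p) = m * (\<phi> p)\<^sup>2)"


subsection \<open>Minimal submanifolds\<close>

text \<open>\<open>(U, c)\<close> maps \<open>N \<inter> U\<close> onto \<open>L \<inter> c ` U\<close>, where \<open>L\<close> is a linear subspace of codimension \<open>k\<close>. The
  tangent spaces of \<open>N\<close> are then represented by \<open>L\<close> in this chart.\<close>
definition slice_chart ::
    "'p set \<Rightarrow> nat \<Rightarrow> ('p, 'e::euclidean_space) chart \<Rightarrow> 'e set \<Rightarrow> bool" where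
  "slice_chart N k = (\<lambda>(U, c) L.
     subspace L \<and> dim L + k = DIM('e) \<and> (\<forall>p\<in>U. p \<in> N \<longleftrightarrow> c p \<in> L))"

definition submanifold :: "('p, 'e::euclidean_space) riemannian \<Rightarrow> 'p set \<Rightarrow> nat \<Rightarrow> bool" where
  "submanifold M N k \<longleftrightarrow>
     riemannian_manifold M \<and> N \<subseteq> points M \<and>
     (\<forall>p\<in>N. \<exists>(U, c)\<in>charts M. p \<in> U \<and> (\<exists>L. slice_chart N k (U, c) L))"

definition normal_part :: "'e::euclidean_space local_metric \<Rightarrow> 'e set \<Rightarrow> 'e \<Rightarrow> 'e \<Rightarrow> 'e" where
  "normal_part g L y w = (THE \<nu>. w - \<nu> \<in> L \<and> (\<forall>v\<in>L. g y \<nu> v = 0))"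

text \<open>In a slice chart, the vector field with constant components \<open>v \<in> L\<close> is tangent to \<open>N\<close> along \<open>N\<close>,
  so it is an admissible extension of \<open>v\<close> in \<open>II(u, v) = (\<nabla>\<^sub>u V)\<^sup>\<bottom>\<close>; the value does not depend on the
  extension.\<close>
definition second_fundamental_form ::
    "'e::euclidean_space local_metric \<Rightarrow> 'e set \<Rightarrow> 'e \<Rightarrow> 'e \<Rightarrow> 'e \<Rightarrow> 'e" where
  "second_fundamental_form g L y u v = normal_part g L y (covariant_derivative g y u (\<lambda>_. v))"

definition orthonormal_basis :: "'e::euclidean_space local_metric \<Rightarrow> 'e set \<Rightarrow> 'e \<Rightarrow> 'e set \<Rightarrow> bool" where
  "orthonormal_basis g L y E \<longleftrightarrow>
     finite E \<and> span E = L \<and> (\<forall>u\<in>E. \<forall>v\<in>E. g y u v = (if u = v then 1 else 0))"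

text \<open>Vanishing mean curvature: the trace of the second fundamental form, taken over an orthonormal
  basis of the tangent space, is zero.\<close>
definition minimal_submanifold :: "('p, 'e::euclidean_space) riemannian \<Rightarrow> 'p set \<Rightarrow> nat \<Rightarrow> bool" where
  "minimal_submanifold M N k \<longleftrightarrow>
     submanifold M N k \<and>
     (\<forall>(U, c)\<in>charts M. \<forall>L. slice_chart N k (U, c) L \<longrightarrow>
        (\<forall>p\<in>N \<inter> U. \<forall>E. orthonormal_basis (metric M (U, c)) L (c p) E \<longrightarrow>
           (\<Sum>e\<in>E. second_fundamental_form (metric M (U, c)) L (c p) e e) = 0))"


subsection \<open>Completeness\<close>

definition piecewise_C1_curve :: "('p, 'e::euclidean_space) riemannian \<Rightarrow> (real \<Rightarrow> 'p) \<Rightarrow> bool" where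
  "piecewise_C1_curve M \<gamma> \<longleftrightarrow>
     (\<forall>t\<in>{0..1}. \<exists>(U, c)\<in>charts M. \<exists>\<delta>>0.
        \<gamma> ` ({0..1} \<inter> {t - \<delta>..t + \<delta>}) \<subseteq> U \<and>
        (c \<circ> \<gamma>) piecewise_C1_differentiable_on ({0..1} \<inter> {t - \<delta>..t + \<delta>}))"

definition chart_at :: "('p, 'e::euclidean_space) riemannian \<Rightarrow> 'p \<Rightarrow> ('p, 'e) chart" where
  "chart_at M p = (SOME \<kappa>. \<kappa> \<in> charts M \<and> p \<in> fst \<kappa>)"

definition speed :: "('p, 'e::euclidean_space) riemannian \<Rightarrow> (real \<Rightarrow> 'p) \<Rightarrow> real \<Rightarrow> real" where
  "speed M \<gamma> t =
     (let \<kappa> = chart_at M (\<gamma> t); v = vector_derivative (snd \<kappa> \<circ> \<gamma>) (at t)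
      in sqrt (metric M \<kappa> (snd \<kappa> (\<gamma> t)) v v))"

text \<open>The integral is taken in \<open>[0, \<infinity>]\<close> because the derivative of a curve that is piecewise \<open>C\<^sup>1\<close> in the
  library's sense may be unbounded near the exceptional points.\<close>
definition curve_length :: "('p, 'e::euclidean_space) riemannian \<Rightarrow> (real \<Rightarrow> 'p) \<Rightarrow> ennreal" where
  "curve_length M \<gamma> = (\<integral>\<^sup>+t\<in>{0..1}. ennreal (speed M \<gamma> t) \<partial>lborel)"

text \<open>The Riemannian distance of the metric induced on \<open>N\<close>: only curves inside \<open>N\<close> are admitted. It is
  infinite between different components.\<close>
definition induced_dist :: "('p, 'e::euclidean_space) riemannian \<Rightarrow> 'p set \<Rightarrow> 'p \<Rightarrow> 'p \<Rightarrow> ennreal" where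
  "induced_dist M N p q =
     Inf {curve_length M \<gamma> | \<gamma>. piecewise_C1_curve M \<gamma> \<and> \<gamma> ` {0..1} \<subseteq> N \<and> \<gamma> 0 = p \<and> \<gamma> 1 = q}"

definition complete_submanifold :: "('p, 'e::euclidean_space) riemannian \<Rightarrow> 'p set \<Rightarrow> bool" where
  "complete_submanifold M N \<longleftrightarrow>
     (\<forall>X. (\<forall>i::nat. X i \<in> N) \<and>
          (\<forall>\<epsilon>>0. \<exists>K. \<forall>i\<ge>K. \<forall>j\<ge>K. induced_dist M N (X i) (X j) < \<epsilon>) \<longrightarrow>
          (\<exists>p\<in>N. (\<lambda>i. induced_dist M N (X i) p) \<longlonglongrightarrow> 0))"


section \<open>The symmetric space \<open>SL\<^sub>n(\<real>) / SO(n)\<close>\<close>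

definition SL :: "(real^'n^'n) set" where
  "SL = {x. det x = 1}"

definition SO :: "(real^'n^'n) set" where
  "SO = {x \<in> SL. x ** transpose x = mat 1}"

definition coset :: "real^'n^'n \<Rightarrow> (real^'n^'n) set" where
  "coset x = (\<lambda>k. x ** k) ` SO"

text \<open>The tangent space of \<open>SL\<close> at \<open>x\<close> is the left translate of the Lie algebra of trace-free matrices.\<close>
definition tangent_SL :: "real^'n^'n \<Rightarrow> (real^'n^'n) set" where
  "tangent_SL x = {x ** Z | Z. trace Z = 0}"

text \<open>The left-invariant metric; on real matrices \<open>Re (trace (Z W\<^sup>*))\<close> is \<open>trace (Z W\<^sup>t)\<close>.\<close>
definition metric_SL :: "real^'n^'n \<Rightarrow> real^'n^'n \<Rightarrow> real^'n^'n \<Rightarrow> real" where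
  "metric_SL x V W = trace ((matrix_inv x ** V) ** transpose (matrix_inv x ** W))"

text \<open>\<open>D\<close> represents the differential of \<open>f\<close> restricted to \<open>SL\<close>: only its values on \<open>tangent_SL x\<close> are
  determined by \<open>f\<close>.\<close>
definition differential_SL ::
    "(real^'n^'n \<Rightarrow> 'e::euclidean_space) \<Rightarrow> real^'n^'n \<Rightarrow> (real^'n^'n \<Rightarrow> 'e) \<Rightarrow> bool" where
  "differential_SL f x D \<longleftrightarrow> (f has_derivative D) (at x within SL)"

text \<open>The maximal atlas of the unique smooth structure of dimension \<open>DIM('e)\<close> (with the quotient
  topology) for which the projection \<open>coset\<close> is a smooth submersion.\<close>
definition quotient_charts :: "((real^'n^'n) set, 'e::euclidean_space) chart set" where
  "quotient_charts = {(U, c).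
     U \<subseteq> coset ` SL \<and>
     openin (top_of_set SL) {x \<in> SL. coset x \<in> U} \<and>
     inj_on c U \<and> open (c ` U) \<and>
     smooth_on_subset {x \<in> SL. coset x \<in> U} (c \<circ> coset) \<and>
     (\<forall>x\<in>SL. coset x \<in> U \<longrightarrow>
        (\<exists>D. differential_SL (c \<circ> coset) x D \<and> D ` tangent_SL x = UNIV))}"

text \<open>The orthogonal complement of the kernel of the differential \<open>D\<close> at \<open>x\<close>.\<close>
definition horizontal :: "real^'n^'n \<Rightarrow> (real^'n^'n \<Rightarrow> 'e::euclidean_space) \<Rightarrow> (real^'n^'n) set" where
  "horizontal x D =
     {V \<in> tangent_SL x. \<forall>K\<in>tangent_SL x. D K = 0 \<longrightarrow> metric_SL x V K = 0}"

text \<open>The metric making \<open>coset\<close> a Riemannian submersion: \<open>u\<close> and \<open>v\<close> have the inner product of their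
  horizontal lifts \<open>V\<close> and \<open>W\<close> to any point \<open>x\<close> of the fibre.\<close>
definition quotient_metric ::
    "((real^'n^'n) set, 'e::euclidean_space) chart \<Rightarrow> 'e local_metric" where
  "quotient_metric = (\<lambda>(U, c) y u v. THE r. \<exists>x\<in>SL. \<exists>D. \<exists>V\<in>horizontal x D. \<exists>W\<in>horizontal x D.
     coset x \<in> U \<and> c (coset x) = y \<and> differential_SL (c \<circ> coset) x D \<and>
     D V = u \<and> D W = v \<and> r = metric_SL x V W)"

definition SL_mod_SO :: "((real^'n^'n) set, 'e::euclidean_space) riemannian" where
  "SL_mod_SO = \<lparr>points = coset ` SL, charts = quotient_charts, metric = quotient_metric\<rparr>"

end

(*
The coset x SO(n) is identified with the positive definite matrix P = x x^t of determinant 1. A chart c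
becomes a parametrisation p of this hypersurface in the space of matrices, the metric becomes
trace (P^-1 A P^-1 B) / 4, and phi becomes the restriction of the linear function a^t P a. Computations
in an arbitrary chart are transported by the differential of p: the gradient of trace (S P) is
4 (P S P - trace (S P) / n P), the Levi-Civita connection is the second derivative of p corrected by
- (A P^-1 B + B P^-1 A) / 2, and the Hessian of trace (S P) is A |-> 2 (A S P + P S A) - 4/n trace (S A) P.
Minimality follows as for every eigenfunction with regular value 0: on the zero set the Laplacian
vanishes and so do the contributions of the two gradient directions to its trace, hence the mean
curvature vector is tangent. In the coordinate P / trace P the zero set is given by linear equations,
which yields slice charts. Completeness holds because ln (trace P) and P / trace P are Lipschitz
functions on the symmetric space.
*)

theory Submission
  imports Defs
begin

section \<open>Smooth maps\<close>

text \<open>\<open>quotient_charts\<close> is a maximal atlas, described only through smoothness of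
  \<open>c \<circ> coset\<close> on SL, and minimality quantifies over every slice chart in it. An
  arbitrary chart is therefore brought under control by smooth local sections of the projection,
  built from a matrix square root near the identity, together with the inverse function theorem. The
  quarter in the metric arises because the differential of x x^t sends x Z, with Z symmetric, to 2 x
  Z x^t. The gradient contributions vanish because a a^t has rank one: the conformality is then a
  multiple of phi^2, whose derivative vanishes wherever phi does. Concretely, at a zero a1 and a2
  are P-orthogonal of equal P-length and the cubic traces cancel. The same relation makes the
  gradients of the real and the imaginary part orthogonal of equal nonzero length, which gives
  regularity and codimension two. Completeness takes estimates in both directions: lower bounds on
  lengths produce a limit matrix, and segments in a slice chart bound the induced distance to it
  from above.\<close>

lemma Ck_on_cong_imp:
  assumes "open S" "\<And>x. x \<in> S \<Longrightarrow> f x = g x" "Ck_on k S f"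
  shows "Ck_on k S g"
  using assms(2,3)
proof (induction k arbitrary: f g)
  case 0
  then show ?case by (simp cong: continuous_on_cong)
next
  case (Suc k)
  have d: "(g has_derivative frechet_derivative f (at x)) (at x)" if "x \<in> S" for x
  proof (rule has_derivative_transform_within_open[OF _ assms(1) that])
    show "(f has_derivative frechet_derivative f (at x)) (at x)"
      using Suc.prems(2) that by (simp add: frechet_derivative_works[symmetric])
  qed (use Suc.prems(1) in auto)
  then have e: "frechet_derivative g (at x) = frechet_derivative f (at x)" if "x \<in> S" for x
    using that frechet_derivative_at by metis
  have "Ck_on k S (\<lambda>x. frechet_derivative g (at x) v)" for v
    by (rule Suc.IH[of "\<lambda>x. frechet_derivative f (at x) v"]) (use Suc.prems e in auto)
  then show ?case
    using d by (auto simp: differentiable_def)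
qed

lemma Ck_on_SucD:
  assumes "Ck_on (Suc k) S f"
  shows "Ck_on k S f"
  using assms
proof (induction k arbitrary: f)
  case 0
  then show ?case
    by (auto intro!: continuous_at_imp_continuous_on differentiable_imp_continuous_within)
next
  case (Suc k)
  then show ?case by (metis Ck_on.simps(2))
qed

lemma Ck_on_subset:
  assumes "Ck_on k S f" "T \<subseteq> S"
  shows "Ck_on k T f"
  using assms by (induction k arbitrary: f) (auto intro: continuous_on_subset)

lemma Ck_on_local:
  assumes "\<And>x. x \<in> S \<Longrightarrow> \<exists>T. open T \<and> x \<in> T \<and> Ck_on k T f"
  shows "Ck_on k S f"
  using assms
proof (induction k arbitrary: f)
  case 0
  then show ?case
    by (metis Ck_on.simps(1) continuous_at_imp_continuous_on continuous_on_eq_continuous_at)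
next
  case (Suc k)
  have "f differentiable (at x)" if "x \<in> S" for x
    using Suc.prems[OF that] by auto
  moreover have "Ck_on k S (\<lambda>x. frechet_derivative f (at x) v)" for v
    by (rule Suc.IH) (use Suc.prems in fastforce)
  ultimately show ?case by simp
qed

text \<open>Each induction on the order differentiates by an explicit formula; uniqueness of
  derivatives lets that formula stand in for \<open>frechet_derivative\<close>, and openness of S
  makes agreement on S enough.\<close>

lemma Ck_on_SucI:
  assumes "open S" "\<And>x. x \<in> S \<Longrightarrow> (f has_derivative f' x) (at x)"
    "\<And>v. Ck_on k S (\<lambda>x. f' x v)"
  shows "Ck_on (Suc k) S f"
proof -
  have "frechet_derivative f (at x) = f' x" if "x \<in> S" for x
    using frechet_derivative_at assms(2)[OF that] by metis
  then have "Ck_on k S (\<lambda>x. frechet_derivative f (at x) v)" for v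
    by (intro Ck_on_cong_imp[OF assms(1) _ assms(3)[of v]]) auto
  then show ?thesis using assms(2) by (auto simp: differentiable_def)
qed

lemma Ck_on_has_derivative:
  assumes "Ck_on (Suc k) S f" "x \<in> S"
  shows "(f has_derivative frechet_derivative f (at x)) (at x)"
  using assms by (simp add: frechet_derivative_works[symmetric])

lemma Ck_on_const [simp]: "Ck_on k S (\<lambda>x. c)"
  by (induction k arbitrary: c) auto

lemma Ck_on_bounded_linear:
  assumes "bounded_linear L"
  shows "Ck_on k S L"
proof (cases k)
  case 0
  then show ?thesis using assms by (simp add: linear_continuous_on)
next
  case (Suc j)
  have "frechet_derivative L (at x) = L" for x
    using bounded_linear_imp_has_derivative[OF assms] frechet_derivative_at by metis
  then show ?thesis
    using bounded_linear_imp_differentiable[OF assms] by (simp add: Suc)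
qed

lemma Ck_on_bounded_linear_compose:
  assumes "bounded_linear L" "open S" "Ck_on k S f"
  shows "Ck_on k S (\<lambda>x. L (f x))"
  using assms(3)
proof (induction k arbitrary: f)
  case 0
  then show ?case
    using continuous_on_compose2[OF linear_continuous_on[OF assms(1), of UNIV]] by simp
next
  case (Suc k)
  show ?case
  proof (rule Ck_on_SucI[OF assms(2)])
    show "((\<lambda>x. L (f x)) has_derivative (\<lambda>v. L (frechet_derivative f (at x) v))) (at x)"
      if "x \<in> S" for x
      by (rule bounded_linear.has_derivative[OF assms(1) Ck_on_has_derivative[OF Suc.prems that]])
    show "Ck_on k S (\<lambda>x. L (frechet_derivative f (at x) v))" for v
      by (rule Suc.IH) (use Suc.prems in auto)
  qed
qed

lemma Ck_on_add:
  assumes "open S" "Ck_on k S f" "Ck_on k S g"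
  shows "Ck_on k S (\<lambda>x. f x + g x)"
  using assms(2,3)
proof (induction k arbitrary: f g)
  case 0
  then show ?case by (simp add: continuous_on_add)
next
  case (Suc k)
  show ?case
  proof (rule Ck_on_SucI[OF assms(1)])
    show "((\<lambda>x. f x + g x) has_derivative
        (\<lambda>v. frechet_derivative f (at x) v + frechet_derivative g (at x) v)) (at x)"
      if "x \<in> S" for x
      using Ck_on_has_derivative that Suc.prems by (intro has_derivative_add) blast+
    show "Ck_on k S (\<lambda>x. frechet_derivative f (at x) v + frechet_derivative g (at x) v)" for v
      by (rule Suc.IH) (use Suc.prems in auto)
  qed
qed

text \<open>The induction varies both functions, because the product rule returns products of one
  original with one derivative; \<open>Ck_on_SucD\<close> lowers the order of the undifferentiated
  factor.\<close>

lemma Ck_on_bilinear: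
  assumes "bounded_bilinear B" "open S" "Ck_on k S f" "Ck_on k S g"
  shows "Ck_on k S (\<lambda>x. B (f x) (g x))"
  using assms(3,4)
proof (induction k arbitrary: f g)
  case 0
  then show ?case
    using bounded_bilinear.continuous_on[OF assms(1)] by simp
next
  case (Suc k)
  show ?case
  proof (rule Ck_on_SucI[OF assms(2)])
    show "((\<lambda>x. B (f x) (g x)) has_derivative
        (\<lambda>v. B (f x) (frechet_derivative g (at x) v) + B (frechet_derivative f (at x) v) (g x))) (at x)"
      if "x \<in> S" for x
      by (rule bounded_bilinear.FDERIV[OF assms(1)]) (use Ck_on_has_derivative that Suc.prems in blast)+
    show "Ck_on k S (\<lambda>x. B (f x) (frechet_derivative g (at x) v) + B (frechet_derivative f (at x) v) (g x))" for v
      by (intro Ck_on_add[OF assms(2)] Suc.IH Ck_on_SucD[OF Suc.prems(1)] Ck_on_SucD[OF Suc.prems(2)])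
        (use Suc.prems in auto)
  qed
qed

lemma Ck_on_sum:
  assumes "open S" "\<And>i. i \<in> I \<Longrightarrow> Ck_on k S (f i)"
  shows "Ck_on k S (\<lambda>x. \<Sum>i\<in>I. f i x)"
  using assms(2) by (induction I rule: infinite_finite_induct) (auto intro!: Ck_on_add[OF assms(1)])

lemma Ck_on_prod:
  fixes f :: "'i \<Rightarrow> 'a::real_normed_vector \<Rightarrow> real"
  assumes "open S" "\<And>i. i \<in> I \<Longrightarrow> Ck_on k S (f i)"
  shows "Ck_on k S (\<lambda>x. \<Prod>i\<in>I. f i x)"
  using assms(2)
  by (induction I rule: infinite_finite_induct)
    (auto intro!: Ck_on_bilinear[OF bounded_bilinear_mult assms(1)])

lemma Ck_on_compose:
  fixes f :: "'a::real_normed_vector \<Rightarrow> 'b::euclidean_space" and g :: "'b \<Rightarrow> 'c::real_normed_vector"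
  assumes "open S" "open T" "f ` S \<subseteq> T" "Ck_on k S f" "Ck_on k T g"
  shows "Ck_on k S (\<lambda>x. g (f x))"
  using assms(4,5)
proof (induction k arbitrary: g)
  case 0
  then show ?case using assms(3) continuous_on_compose2[of T g S f] by simp
next
  case (Suc k)
  have g': "(g has_derivative frechet_derivative g (at (f x))) (at (f x))" if "x \<in> S" for x
    using Ck_on_has_derivative[OF Suc.prems(2)] assms(3) that by blast
  have f': "(f has_derivative frechet_derivative f (at x)) (at x)" if "x \<in> S" for x
    using Ck_on_has_derivative[OF Suc.prems(1)] that by blast
  \<comment> \<open>In the chain rule the direction fed to the derivative of g depends on x, while
    \<open>Ck_on\<close> speaks of fixed directions. Expansion in the finite basis separates the two
    dependences, and the induction hypothesis applies to each term.\<close>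
  have eq: "frechet_derivative g (at (f x)) v =
      (\<Sum>b\<in>Basis. (v \<bullet> b) *\<^sub>R frechet_derivative g (at (f x)) b)" if "x \<in> S" for x v
  proof -
    interpret bounded_linear "frechet_derivative g (at (f x))"
      using g'[OF that] by (rule has_derivative_bounded_linear)
    have "frechet_derivative g (at (f x)) v =
        frechet_derivative g (at (f x)) (\<Sum>b\<in>Basis. (v \<bullet> b) *\<^sub>R b)"
      by (simp add: euclidean_representation)
    then show ?thesis by (simp add: sum scaleR)
  qed
  show ?case
  proof (rule Ck_on_SucI[OF assms(1)])
    show "((\<lambda>x. g (f x)) has_derivative
        (\<lambda>v. frechet_derivative g (at (f x)) (frechet_derivative f (at x) v))) (at x)" if "x \<in> S" for x
      using has_derivative_compose[OF f'[OF that] g'[OF that]] by simp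
    show "Ck_on k S (\<lambda>x. frechet_derivative g (at (f x)) (frechet_derivative f (at x) v))" for v
    proof (rule Ck_on_cong_imp[OF assms(1)])
      show "(\<Sum>b\<in>Basis. (frechet_derivative f (at x) v \<bullet> b) *\<^sub>R frechet_derivative g (at (f x)) b) =
         frechet_derivative g (at (f x)) (frechet_derivative f (at x) v)" if "x \<in> S" for x
        by (rule eq[OF that, symmetric])
      show "Ck_on k S (\<lambda>x. \<Sum>b\<in>Basis. (frechet_derivative f (at x) v \<bullet> b) *\<^sub>R frechet_derivative g (at (f x)) b)"
        by (intro Ck_on_sum Ck_on_bilinear[OF bounded_bilinear_scaleR] assms(1)
             Ck_on_bounded_linear_compose[OF bounded_linear_inner_left] Suc.IH Ck_on_SucD[OF Suc.prems(1)])
          (use Suc.prems in auto)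
    qed
  qed
qed

text \<open>The induction runs over all exponents at once, since differentiation changes a into a -
  1.\<close>

lemma Ck_on_powr: "Ck_on k {0<..} (\<lambda>x::real. x powr a)"
proof (induction k arbitrary: a)
  case 0
  show ?case by (auto intro!: continuous_intros)
next
  case (Suc k)
  show ?case
  proof (rule Ck_on_SucI[OF open_greaterThan])
    show "((\<lambda>x::real. x powr a) has_derivative (\<lambda>h. h * (a * x powr (a - 1)))) (at x)"
      if "x \<in> {0<..}" for x
      using has_real_derivative_powr[of x a] that
      by (simp add: has_field_derivative_def mult_commute_abs)
    show "Ck_on k {0<..} (\<lambda>x::real. v * (a * x powr (a - 1)))" for v
      by (intro Ck_on_bounded_linear_compose[OF bounded_linear_mult_right] Suc.IH open_greaterThan)
  qed
qed

lemma smooth_on_cong_imp: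
  assumes "open S" "\<And>x. x \<in> S \<Longrightarrow> f x = g x" "smooth_on S f"
  shows "smooth_on S g"
  using assms Ck_on_cong_imp unfolding smooth_on_def by metis

lemma smooth_on_subset: "smooth_on S f \<Longrightarrow> T \<subseteq> S \<Longrightarrow> smooth_on T f"
  using Ck_on_subset unfolding smooth_on_def by blast

lemma smooth_on_local:
  assumes "\<And>x. x \<in> S \<Longrightarrow> \<exists>T. open T \<and> x \<in> T \<and> smooth_on T f"
  shows "smooth_on S f"
  using assms Ck_on_local unfolding smooth_on_def by metis

lemma smooth_on_const [simp]: "smooth_on S (\<lambda>x. c)"
  by (simp add: smooth_on_def)

lemma smooth_on_bounded_linear: "bounded_linear L \<Longrightarrow> smooth_on S L"
  by (simp add: smooth_on_def Ck_on_bounded_linear)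

lemma smooth_on_ident [simp]: "smooth_on S (\<lambda>x. x)"
  by (intro smooth_on_bounded_linear bounded_linear_ident)

lemma smooth_on_bounded_linear_compose:
  "bounded_linear L \<Longrightarrow> open S \<Longrightarrow> smooth_on S f \<Longrightarrow> smooth_on S (\<lambda>x. L (f x))"
  by (simp add: smooth_on_def Ck_on_bounded_linear_compose)

lemma smooth_on_add:
  "open S \<Longrightarrow> smooth_on S f \<Longrightarrow> smooth_on S g \<Longrightarrow> smooth_on S (\<lambda>x. f x + g x)"
  by (simp add: smooth_on_def Ck_on_add)

lemma smooth_on_diff:
  "open S \<Longrightarrow> smooth_on S f \<Longrightarrow> smooth_on S g \<Longrightarrow> smooth_on S (\<lambda>x. f x - g x)"
  using smooth_on_add[of S f "\<lambda>x. - g x"]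
    smooth_on_bounded_linear_compose[OF bounded_linear_minus[OF bounded_linear_ident], of S g]
  by simp

lemma smooth_on_bilinear:
  "bounded_bilinear B \<Longrightarrow> open S \<Longrightarrow> smooth_on S f \<Longrightarrow> smooth_on S g \<Longrightarrow>
    smooth_on S (\<lambda>x. B (f x) (g x))"
  by (simp add: smooth_on_def Ck_on_bilinear)

lemma smooth_on_sum:
  "open S \<Longrightarrow> (\<And>i. i \<in> I \<Longrightarrow> smooth_on S (f i)) \<Longrightarrow> smooth_on S (\<lambda>x. \<Sum>i\<in>I. f i x)"
  by (simp add: smooth_on_def Ck_on_sum)

lemma smooth_on_prod:
  fixes f :: "'i \<Rightarrow> 'a::real_normed_vector \<Rightarrow> real"
  shows "open S \<Longrightarrow> (\<And>i. i \<in> I \<Longrightarrow> smooth_on S (f i)) \<Longrightarrow> smooth_on S (\<lambda>x. \<Prod>i\<in>I. f i x)"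
  by (simp add: smooth_on_def Ck_on_prod)

lemma smooth_on_compose:
  fixes f :: "'a::real_normed_vector \<Rightarrow> 'b::euclidean_space"
  shows "open S \<Longrightarrow> open T \<Longrightarrow> f ` S \<subseteq> T \<Longrightarrow> smooth_on S f \<Longrightarrow> smooth_on T g \<Longrightarrow>
    smooth_on S (\<lambda>x. g (f x))"
  by (simp add: smooth_on_def Ck_on_compose)

lemma smooth_on_powr:
  fixes f :: "'a::real_normed_vector \<Rightarrow> real"
  assumes "open S" "smooth_on S f" "\<And>x. x \<in> S \<Longrightarrow> 0 < f x"
  shows "smooth_on S (\<lambda>x. f x powr a)"
  using smooth_on_compose[OF assms(1) open_greaterThan[of 0] _ assms(2)] assms(3) Ck_on_powr
  by (auto simp: smooth_on_def image_subset_iff)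

lemma smooth_on_has_derivative:
  assumes "smooth_on S f" "x \<in> S"
  shows "(f has_derivative frechet_derivative f (at x)) (at x)"
  using Ck_on_has_derivative[of 0 S f x] assms unfolding smooth_on_def by blast

lemma smooth_on_linear_derivative:
  "smooth_on S f \<Longrightarrow> x \<in> S \<Longrightarrow> linear (frechet_derivative f (at x))"
  using smooth_on_has_derivative has_derivative_linear by blast

lemma smooth_on_frechet_derivative:
  assumes "smooth_on S f"
  shows "smooth_on S (\<lambda>x. frechet_derivative f (at x) v)"
  using assms unfolding smooth_on_def by (metis Ck_on.simps(2))

lemma smooth_on_continuous_on: "smooth_on S f \<Longrightarrow> continuous_on S f"
  unfolding smooth_on_def by (metis Ck_on.simps(1))

text \<open>The mean value theorem is applied twice, first along u to the difference in direction v,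
  then along v to the derivative along u. The second difference is symmetric in u and v, so
  exchanging their roles expresses the same number through the other mixed derivative.\<close>

lemma second_difference_mean_value:
  fixes f :: "'a::real_normed_vector \<Rightarrow> real"
  assumes "smooth_on S f" "s > 0"
    and S: "\<And>\<xi> \<eta>. 0 \<le> \<xi> \<Longrightarrow> \<xi> \<le> s \<Longrightarrow> 0 \<le> \<eta> \<Longrightarrow> \<eta> \<le> s \<Longrightarrow> x + \<xi> *\<^sub>R u + \<eta> *\<^sub>R v \<in> S"
  obtains \<xi> \<eta> where "0 < \<xi>" "\<xi> < s" "0 < \<eta>" "\<eta> < s"
    "f (x + s *\<^sub>R u + s *\<^sub>R v) - f (x + s *\<^sub>R u) - f (x + s *\<^sub>R v) + f x =
      s * s * frechet_derivative (\<lambda>y. frechet_derivative f (at y) u) (at (x + \<xi> *\<^sub>R u + \<eta> *\<^sub>R v)) v"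
proof -
  have chain: "((\<lambda>t. g (w + t *\<^sub>R z)) has_real_derivative frechet_derivative g (at (w + t *\<^sub>R z)) z) (at t)"
    if "smooth_on S g" "w + t *\<^sub>R z \<in> S" for g :: "'a \<Rightarrow> real" and w z t
  proof -
    have "((\<lambda>t. w + t *\<^sub>R z) has_derivative (\<lambda>h. h *\<^sub>R z)) (at t)"
      by (auto intro!: derivative_eq_intros)
    from has_derivative_compose[OF this smooth_on_has_derivative[OF that]]
    show ?thesis
      using linear_scale[OF smooth_on_linear_derivative[OF that]]
      by (simp add: has_field_derivative_def mult_commute_abs)
  qed
  define F where "F = (\<lambda>t. f (x + s *\<^sub>R v + t *\<^sub>R u) - f (x + t *\<^sub>R u))"
  have "(F has_real_derivative (frechet_derivative f (at (x + s *\<^sub>R v + t *\<^sub>R u)) u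
      - frechet_derivative f (at (x + t *\<^sub>R u)) u)) (at t)" if "0 \<le> t" "t \<le> s" for t
  proof -
    have "x + s *\<^sub>R v + t *\<^sub>R u \<in> S" "x + t *\<^sub>R u \<in> S"
      using S[of t s] S[of t 0] that assms(2) by (simp_all add: add_ac)
    then show ?thesis
      unfolding F_def by (intro DERIV_diff chain assms(1))
  qed
  then have "\<exists>\<xi>>0. \<xi> < s \<and> F s - F 0 = (s - 0) *
      (frechet_derivative f (at (x + s *\<^sub>R v + \<xi> *\<^sub>R u)) u - frechet_derivative f (at (x + \<xi> *\<^sub>R u)) u)"
    by (rule MVT2[OF assms(2)])
  then obtain \<xi> where \<xi>: "0 < \<xi>" "\<xi> < s" "F s - F 0 = (s - 0) *
      (frechet_derivative f (at (x + s *\<^sub>R v + \<xi> *\<^sub>R u)) u - frechet_derivative f (at (x + \<xi> *\<^sub>R u)) u)"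
    by blast
  define H where "H = (\<lambda>t. frechet_derivative f (at (x + \<xi> *\<^sub>R u + t *\<^sub>R v)) u)"
  have "(H has_real_derivative frechet_derivative (\<lambda>y. frechet_derivative f (at y) u)
      (at (x + \<xi> *\<^sub>R u + t *\<^sub>R v)) v) (at t)" if "0 \<le> t" "t \<le> s" for t
    unfolding H_def
    using S[of \<xi> t] \<xi>(1,2) that by (intro chain smooth_on_frechet_derivative[OF assms(1)]) simp_all
  then have "\<exists>\<eta>>0. \<eta> < s \<and> H s - H 0 = (s - 0) *
      frechet_derivative (\<lambda>y. frechet_derivative f (at y) u) (at (x + \<xi> *\<^sub>R u + \<eta> *\<^sub>R v)) v"
    by (rule MVT2[OF assms(2)])
  then obtain \<eta> where \<eta>: "0 < \<eta>" "\<eta> < s" "H s - H 0 = (s - 0) *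
      frechet_derivative (\<lambda>y. frechet_derivative f (at y) u) (at (x + \<xi> *\<^sub>R u + \<eta> *\<^sub>R v)) v"
    by blast
  have "F s - F 0 = s * (H s - H 0)"
    using \<xi>(3) by (simp add: H_def add_ac)
  also have "\<dots> = s * s * frechet_derivative (\<lambda>y. frechet_derivative f (at y) u) (at (x + \<xi> *\<^sub>R u + \<eta> *\<^sub>R v)) v"
    unfolding \<eta>(3) by simp
  also have "F s - F 0 =
      f (x + s *\<^sub>R u + s *\<^sub>R v) - f (x + s *\<^sub>R u) - f (x + s *\<^sub>R v) + f x"
    by (simp add: F_def add_ac)
  finally show ?thesis
    by (rule that[OF \<xi>(1,2) \<eta>(1,2)])
qed

text \<open>If the mixed derivatives differed at x, continuity would keep each within half the gap
  of its value near x; yet both equal the same second difference, divided by s * s, at suitable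
  points near x.\<close>

lemma second_derivative_symmetric_real:
  fixes f :: "'a::real_normed_vector \<Rightarrow> real"
  assumes "open S" "smooth_on S f" "x \<in> S"
  shows "frechet_derivative (\<lambda>y. frechet_derivative f (at y) u) (at x) v =
    frechet_derivative (\<lambda>y. frechet_derivative f (at y) v) (at x) u"
proof (rule ccontr)
  define D where "D = (\<lambda>u v y. frechet_derivative (\<lambda>y. frechet_derivative f (at y) u) (at y) v)"
  assume "\<not> ?thesis"
  then have ne: "D u v x \<noteq> D v u x" by (simp add: D_def)
  define e where "e = \<bar>D u v x - D v u x\<bar> / 2"
  have "e > 0" using ne by (simp add: e_def)
  have cont: "isCont (D u v) x" for u v
    using smooth_on_continuous_on[OF smooth_on_frechet_derivative[OF smooth_on_frechet_derivative[OF assms(2)]]]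
      assms(1,3) continuous_on_eq_continuous_at unfolding D_def by metis
  obtain d1 where d1: "d1 > 0" "\<And>y. dist y x < d1 \<Longrightarrow> dist (D u v y) (D u v x) < e"
    using cont[of u v] \<open>e > 0\<close> unfolding continuous_at_eps_delta by (metis dist_commute)
  obtain d2 where d2: "d2 > 0" "\<And>y. dist y x < d2 \<Longrightarrow> dist (D v u y) (D v u x) < e"
    using cont[of v u] \<open>e > 0\<close> unfolding continuous_at_eps_delta by (metis dist_commute)
  obtain d3 where d3: "d3 > 0" "\<And>y. dist y x < d3 \<Longrightarrow> y \<in> S"
    using assms(1,3) unfolding open_dist by blast
  define d where "d = min d1 (min d2 d3)"
  \<comment> \<open>Keeps the parallelogram spanned by s u and s v inside the ball of radius d
    around x; the summand 1 keeps the denominator positive when u and v vanish.\<close>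
  define s where "s = d / (2 * (norm u + norm v + 1))"
  have "d > 0" using d1 d2 d3 by (simp add: d_def)
  then have "s > 0" by (auto simp: s_def intro!: divide_pos_pos add_nonneg_pos)
  have near: "dist (x + \<xi> *\<^sub>R a + \<eta> *\<^sub>R b) x < d"
    if "0 \<le> \<xi>" "\<xi> \<le> s" "0 \<le> \<eta>" "\<eta> \<le> s" "{a, b} = {u, v}" for \<xi> \<eta> a b
  proof -
    have "norm (\<xi> *\<^sub>R a + \<eta> *\<^sub>R b) \<le> \<xi> * norm a + \<eta> * norm b"
      using norm_triangle_ineq[of "\<xi> *\<^sub>R a" "\<eta> *\<^sub>R b"] that by simp
    also have "\<dots> \<le> s * norm a + s * norm b"
      using that by (intro add_mono mult_right_mono) auto
    also have "\<dots> \<le> s * (norm u + norm v)"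
      using that(5) \<open>s > 0\<close> by (auto simp: doubleton_eq_iff algebra_simps)
    also have "\<dots> < s * (2 * (norm u + norm v + 1))"
      using \<open>s > 0\<close> by (intro mult_strict_left_mono) (auto simp: add_nonneg_pos)
    also have "\<dots> = d"
    proof -
      have "norm u + norm v + 1 > 0"
        by (intro add_nonneg_pos) auto
      then have "2 * (norm u + norm v + 1) \<noteq> 0" by simp
      then show ?thesis unfolding s_def by (rule nonzero_eq_divide_eq[THEN iffD1, OF _ refl])
    qed
    finally show ?thesis by (simp add: dist_norm add.assoc)
  qed
  have inS: "x + \<xi> *\<^sub>R u + \<eta> *\<^sub>R v \<in> S" "x + \<xi> *\<^sub>R v + \<eta> *\<^sub>R u \<in> S"
    if "0 \<le> \<xi>" "\<xi> \<le> s" "0 \<le> \<eta>" "\<eta> \<le> s" for \<xi> \<eta>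
    using near[OF that, of u v] near[OF that, of v u] d3(2) by (auto simp: d_def)
  obtain \<xi> \<eta> where 1: "0 < \<xi>" "\<xi> < s" "0 < \<eta>" "\<eta> < s"
    "f (x + s *\<^sub>R u + s *\<^sub>R v) - f (x + s *\<^sub>R u) - f (x + s *\<^sub>R v) + f x =
      s * s * D u v (x + \<xi> *\<^sub>R u + \<eta> *\<^sub>R v)"
    unfolding D_def by (rule second_difference_mean_value[OF assms(2) \<open>s > 0\<close> inS(1)])
  obtain \<xi>' \<eta>' where 2: "0 < \<xi>'" "\<xi>' < s" "0 < \<eta>'" "\<eta>' < s"
    "f (x + s *\<^sub>R v + s *\<^sub>R u) - f (x + s *\<^sub>R v) - f (x + s *\<^sub>R u) + f x =
      s * s * D v u (x + \<xi>' *\<^sub>R v + \<eta>' *\<^sub>R u)"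
    unfolding D_def by (rule second_difference_mean_value[OF assms(2) \<open>s > 0\<close> inS(2)])
  have "s * s * D u v (x + \<xi> *\<^sub>R u + \<eta> *\<^sub>R v) = s * s * D v u (x + \<xi>' *\<^sub>R v + \<eta>' *\<^sub>R u)"
  proof -
    have "f (x + s *\<^sub>R u + s *\<^sub>R v) - f (x + s *\<^sub>R u) - f (x + s *\<^sub>R v) + f x =
        f (x + s *\<^sub>R v + s *\<^sub>R u) - f (x + s *\<^sub>R v) - f (x + s *\<^sub>R u) + f x"
      by (simp add: add_ac)
    then show ?thesis by (simp only: 1(5) 2(5))
  qed
  then have "D u v (x + \<xi> *\<^sub>R u + \<eta> *\<^sub>R v) = D v u (x + \<xi>' *\<^sub>R v + \<eta>' *\<^sub>R u)"
    using \<open>s > 0\<close> by simp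
  moreover have "dist (D u v (x + \<xi> *\<^sub>R u + \<eta> *\<^sub>R v)) (D u v x) < e"
    using near[of \<xi> \<eta> u v] 1(1-4) by (intro d1(2)) (simp add: d_def)
  moreover have "dist (D v u (x + \<xi>' *\<^sub>R v + \<eta>' *\<^sub>R u)) (D v u x) < e"
    using near[of \<xi>' \<eta>' v u] 2(1-4) by (intro d2(2)) (simp add: d_def insert_commute)
  ultimately show False unfolding e_def dist_real_def by argo
qed

lemma frechet_derivative_inner_left:
  assumes "f differentiable (at x)"
  shows "frechet_derivative (\<lambda>y. f y \<bullet> b) (at x) = (\<lambda>v. frechet_derivative f (at x) v \<bullet> b)"
  using assms by (intro frechet_derivative_at[symmetric] has_derivative_inner_left)
    (simp add: frechet_derivative_works)

lemma second_derivative_symmetric: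
  fixes f :: "'a::real_normed_vector \<Rightarrow> 'b::euclidean_space"
  assumes "open S" "smooth_on S f" "x \<in> S"
  shows "frechet_derivative (\<lambda>y. frechet_derivative f (at y) u) (at x) v =
    frechet_derivative (\<lambda>y. frechet_derivative f (at y) v) (at x) u"
proof (rule euclidean_eqI)
  fix b :: 'b
  have eq: "frechet_derivative (\<lambda>y. frechet_derivative f (at y) u) (at x) v \<bullet> b =
      frechet_derivative (\<lambda>y. frechet_derivative (\<lambda>z. f z \<bullet> b) (at y) u) (at x) v" for u v
  proof -
    have d: "(\<lambda>y. frechet_derivative f (at y) u \<bullet> b) differentiable (at x)"
      using smooth_on_has_derivative[OF smooth_on_frechet_derivative[OF assms(2)] assms(3)]
      by (metis differentiable_def has_derivative_inner_left)
    have "frechet_derivative (\<lambda>y. frechet_derivative f (at y) u) (at x) v \<bullet> b =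
        frechet_derivative (\<lambda>y. frechet_derivative f (at y) u \<bullet> b) (at x) v"
      using smooth_on_has_derivative[OF smooth_on_frechet_derivative[OF assms(2)] assms(3)]
      by (subst frechet_derivative_inner_left) (auto simp: differentiable_def)
    also have "\<dots> = frechet_derivative (\<lambda>y. frechet_derivative (\<lambda>z. f z \<bullet> b) (at y) u) (at x) v"
    proof -
      have "frechet_derivative f (at y) u \<bullet> b = frechet_derivative (\<lambda>z. f z \<bullet> b) (at y) u"
        if "y \<in> S" for y
        using smooth_on_has_derivative[OF assms(2) that]
        by (subst frechet_derivative_inner_left) (auto simp: differentiable_def)
      then show ?thesis
        using frechet_derivative_transform_within_open[OF d assms(1,3)] by metis
    qed
    finally show ?thesis .
  qed
  show "frechet_derivative (\<lambda>y. frechet_derivative f (at y) u) (at x) v \<bullet> b =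
      frechet_derivative (\<lambda>y. frechet_derivative f (at y) v) (at x) u \<bullet> b"
    unfolding eq
    by (intro second_derivative_symmetric_real[OF assms(1) _ assms(3)]
        smooth_on_bounded_linear_compose[OF bounded_linear_inner_left] assms)
qed

section \<open>Smooth inverses\<close>

text \<open>A product rule in which the vector factor is merely continuous, at the price that the
  scalar factor vanishes at x. It is made for inverses of linear maps, where the vector factor
  contains the inverse itself, so far known only to be continuous.\<close>

lemma has_derivative_scaleR_vanishing:
  fixes g :: "'a::real_normed_vector \<Rightarrow> 'b::real_normed_vector"
  assumes "\<phi> x = 0" "(\<phi> has_derivative \<phi>') (at x)" "isCont g x"
  shows "((\<lambda>y. \<phi> y *\<^sub>R g y) has_derivative (\<lambda>h. \<phi>' h *\<^sub>R g x)) (at x)"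
proof -
  have bl: "bounded_linear \<phi>'" using assms(2) by (rule has_derivative_bounded_linear)
  then obtain K where K: "\<And>h. norm (\<phi>' h) \<le> norm h * K"
    using bounded_linear.pos_bounded by blast
  have 1: "((\<lambda>y. norm (\<phi> y - \<phi> x - \<phi>' (y - x)) / norm (y - x)) \<longlongrightarrow> 0) (at x)"
    using assms(2) by (simp add: has_derivative_iff_norm)
  have g: "(g \<longlongrightarrow> g x) (at x)" using assms(3) by (simp add: isCont_def)
  have "((\<lambda>y. norm (\<phi> y - \<phi> x - \<phi>' (y - x)) / norm (y - x) * norm (g y) + K * norm (g y - g x)) \<longlongrightarrow>
      0 * norm (g x) + K * norm (g x - g x)) (at x)"
    by (intro tendsto_intros 1 g)
  then have lim: "((\<lambda>y. norm (\<phi> y - \<phi> x - \<phi>' (y - x)) / norm (y - x) * norm (g y) + K * norm (g y - g x)) \<longlongrightarrow> 0) (at x)"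
    by simp
  have "((\<lambda>y. norm (\<phi> y *\<^sub>R g y - \<phi> x *\<^sub>R g x - \<phi>' (y - x) *\<^sub>R g x) / norm (y - x)) \<longlongrightarrow> 0) (at x)"
  proof (rule Lim_null_comparison[OF eventuallyI lim])
    fix y
    have "\<phi> y *\<^sub>R g y - \<phi> x *\<^sub>R g x - \<phi>' (y - x) *\<^sub>R g x =
        (\<phi> y - \<phi> x - \<phi>' (y - x)) *\<^sub>R g y + \<phi>' (y - x) *\<^sub>R (g y - g x)"
      by (simp add: assms(1) algebra_simps)
    then have "norm (\<phi> y *\<^sub>R g y - \<phi> x *\<^sub>R g x - \<phi>' (y - x) *\<^sub>R g x) \<le>
        norm (\<phi> y - \<phi> x - \<phi>' (y - x)) * norm (g y) + norm (\<phi>' (y - x)) * norm (g y - g x)"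
      using norm_triangle_ineq[of "(\<phi> y - \<phi> x - \<phi>' (y - x)) *\<^sub>R g y" "\<phi>' (y - x) *\<^sub>R (g y - g x)"]
      by simp
    also have "\<dots> \<le> norm (\<phi> y - \<phi> x - \<phi>' (y - x)) * norm (g y) + (norm (y - x) * K) * norm (g y - g x)"
      by (intro add_left_mono mult_right_mono K) auto
    finally show "norm (norm (\<phi> y *\<^sub>R g y - \<phi> x *\<^sub>R g x - \<phi>' (y - x) *\<^sub>R g x) / norm (y - x)) \<le>
        norm (\<phi> y - \<phi> x - \<phi>' (y - x)) / norm (y - x) * norm (g y) + K * norm (g y - g x)"
      by (cases "y = x") (simp_all add: assms(1) field_simps)
  qed
  moreover have "bounded_linear (\<lambda>h. \<phi>' h *\<^sub>R g x)"
    by (rule bounded_linear_compose[OF bounded_linear_scaleR_left bl])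
  ultimately show ?thesis by (simp add: has_derivative_iff_norm)
qed

lemma linear_right_inverse:
  fixes A :: "'b::euclidean_space \<Rightarrow> 'b"
  assumes "linear A" "\<And>v. A (B v) = v"
  shows "linear B" and "B (A v) = v"
proof -
  have "inj A"
    using linear_surjective_imp_injective[OF assms(1)] assms(2) by (metis surjI)
  then show *: "B (A v) = v" for v using assms(2) injD by metis
  show "linear B"
  proof (rule linearI)
    show "B (u + v) = B u + B v" for u v
      using *[of "B u + B v"] linear_add[OF assms(1), of "B u" "B v"] assms(2) by simp
    show "B (c *\<^sub>R v) = c *\<^sub>R B v" for c v
      using *[of "c *\<^sub>R B v"] linear_scale[OF assms(1), of c "B v"] assms(2) by simp
  qed
qed

text \<open>\<open>A x0\<close> is bounded below by some m, and near x0 the operators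
  \<open>A x\<close> differ from it by less than m/2, hence are bounded below by m/2. The difference
  w of the two preimages satisfies A x w = (A x0 - A x) (B x0 v), which tends to 0.\<close>

lemma continuous_linear_inverse:
  fixes A :: "'a::real_normed_vector \<Rightarrow> 'b::euclidean_space \<Rightarrow> 'b"
  assumes "open S" "x0 \<in> S" and lin: "\<And>x. x \<in> S \<Longrightarrow> linear (A x)"
    and inv: "\<And>x v. x \<in> S \<Longrightarrow> A x (B x v) = v" and cont: "\<And>u. isCont (\<lambda>x. A x u) x0"
  shows "isCont (\<lambda>x. B x v) x0"
proof -
  have "inj (A x0)"
    using linear_surjective_imp_injective[OF lin[OF assms(2)]] inv[OF assms(2)] by (metis surjI)
  then obtain m where m: "m > 0" "\<And>u. m * norm u \<le> norm (A x0 u)"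
    using linear_inj_bounded_below_pos[OF lin[OF assms(2)]] by blast
  define s where "s = (\<lambda>x. \<Sum>b\<in>Basis. norm (A x b - A x0 b))"
  have "(s \<longlongrightarrow> (\<Sum>b\<in>Basis. norm (A x0 b - A x0 b))) (at x0)"
    unfolding s_def using cont by (intro tendsto_intros) (auto simp: isCont_def)
  then have "(s \<longlongrightarrow> 0) (at x0)" by simp
  then have s: "\<forall>\<^sub>F x in at x0. s x < m / 2" using m(1) order_tendstoD(2) half_gt_zero by blast
  have diff: "norm (A x u - A x0 u) \<le> norm u * s x" if "x \<in> S" for x u
  proof -
    have lin': "linear (\<lambda>u. A x u - A x0 u)"
      using lin that assms(2) by (intro linear_compose_sub) auto
    have "A x u - A x0 u = (\<Sum>b\<in>Basis. (u \<bullet> b) *\<^sub>R (A x b - A x0 b))"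
      using linear_sum[OF lin', of "\<lambda>b. (u \<bullet> b) *\<^sub>R b" Basis] linear_scale[OF lin']
      by (simp add: euclidean_representation)
    then have "norm (A x u - A x0 u) \<le> (\<Sum>b\<in>Basis. norm ((u \<bullet> b) *\<^sub>R (A x b - A x0 b)))"
      by (simp only: norm_sum)
    also have "\<dots> \<le> (\<Sum>b\<in>Basis. norm u * norm (A x b - A x0 b))"
      by (intro sum_mono) (auto intro!: mult_right_mono Basis_le_norm)
    finally show ?thesis by (simp add: s_def sum_distrib_left)
  qed
  have ev: "\<forall>\<^sub>F x in at x0. x \<in> S"
    using assms(1,2) by (simp add: eventually_at_in_open')
  have "((\<lambda>x. norm (A x0 (B x0 v) - A x (B x0 v)) * (2 / m)) \<longlongrightarrow> norm (A x0 (B x0 v) - A x0 (B x0 v)) * (2 / m)) (at x0)"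
    using cont by (intro tendsto_intros) (auto simp: isCont_def)
  then have lim: "((\<lambda>x. norm (A x0 (B x0 v) - A x (B x0 v)) * (2 / m)) \<longlongrightarrow> 0) (at x0)"
    by simp
  have "((\<lambda>x. B x v - B x0 v) \<longlongrightarrow> 0) (at x0)"
  proof (rule Lim_null_comparison[OF _ lim])
    show "\<forall>\<^sub>F x in at x0. norm (B x v - B x0 v) \<le> norm (A x0 (B x0 v) - A x (B x0 v)) * (2 / m)"
      using s ev
    proof eventually_elim
      case (elim x)
      define w where "w = B x v - B x0 v"
      have "A x w = v - A x (B x0 v)"
        using linear_diff[OF lin[OF elim(2)]] inv[OF elim(2)] by (simp add: w_def)
      also have "\<dots> = A x0 (B x0 v) - A x (B x0 v)"
        using inv[OF assms(2)] by simp
      finally have eq: "norm (A x w) = norm (A x0 (B x0 v) - A x (B x0 v))" by simp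
      have "m * norm w \<le> norm (A x0 w)" by (rule m(2))
      also have "\<dots> \<le> norm (A x w) + norm (A x w - A x0 w)"
        by (metis norm_triangle_sub norm_minus_commute)
      also have "norm (A x w - A x0 w) \<le> norm w * (m / 2)"
        using diff[OF elim(2), of w] elim(1) mult_left_mono[of "s x" "m/2" "norm w"] by simp
      finally have "m * norm w / 2 \<le> norm (A x w)" by (simp add: field_simps)
      then have "norm w \<le> norm (A x w) * (2 / m)" using m(1) by (simp add: field_simps)
      then show ?case unfolding eq unfolding w_def .
    qed
  qed
  then show ?thesis by (simp add: isCont_def LIM_zero_iff)
qed

text \<open>The formula is the coordinate form of -B A' B v. It follows from B x v = w - B x ((A x -
  A x0) w) with w = B x0 v: the coefficients of the inner vector vanish at x0, so
  \<open>has_derivative_scaleR_vanishing\<close> applies.\<close>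

lemma has_derivative_linear_inverse:
  fixes A :: "'a::real_normed_vector \<Rightarrow> 'b::euclidean_space \<Rightarrow> 'b"
  assumes S: "open S" "x0 \<in> S" and lin: "\<And>x. x \<in> S \<Longrightarrow> linear (A x)"
    and inv: "\<And>x v. x \<in> S \<Longrightarrow> A x (B x v) = v"
    and der: "\<And>u. ((\<lambda>x. A x u) has_derivative A' u) (at x0)"
  shows "((\<lambda>x. B x v) has_derivative
    (\<lambda>h. - (\<Sum>c\<in>Basis. (\<Sum>b\<in>Basis. (B x0 v \<bullet> b) * (A' b h \<bullet> c)) *\<^sub>R B x0 c))) (at x0)"
proof -
  define w where "w = B x0 v"
  define \<phi> where "\<phi> = (\<lambda>c x. \<Sum>b\<in>Basis. (w \<bullet> b) * ((A x b - A x0 b) \<bullet> c))"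
  have cont: "isCont (\<lambda>x. B x c) x0" for c
    by (rule continuous_linear_inverse[OF S lin inv]) (use der has_derivative_continuous in blast)+
  have B: "B x v = w - (\<Sum>c\<in>Basis. \<phi> c x *\<^sub>R B x c)" if "x \<in> S" for x
  proof -
    have lin': "linear (\<lambda>u. A x u - A x0 u)"
      using lin that S by (intro linear_compose_sub) auto
    have "A x w - A x0 w = (\<Sum>b\<in>Basis. (w \<bullet> b) *\<^sub>R (A x b - A x0 b))"
      using linear_sum[OF lin', of "\<lambda>b. (w \<bullet> b) *\<^sub>R b" Basis] linear_scale[OF lin']
      by (simp add: euclidean_representation)
    then have \<phi>: "\<phi> c x = (A x w - A x0 w) \<bullet> c" for c
      by (simp add: \<phi>_def inner_sum_left)
    have linB: "linear (B x)" using linear_right_inverse(1)[OF lin[OF that] inv[OF that]] .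
    have "(\<Sum>c\<in>Basis. \<phi> c x *\<^sub>R B x c) = B x (\<Sum>c\<in>Basis. \<phi> c x *\<^sub>R c)"
      using linear_sum[OF linB, of "\<lambda>c. \<phi> c x *\<^sub>R c" Basis] linear_scale[OF linB] by simp
    also have "(\<Sum>c\<in>Basis. \<phi> c x *\<^sub>R c) = A x w - v"
      using inv[OF S(2)] by (simp add: \<phi> euclidean_representation w_def)
    also have "B x (A x w - v) = w - B x v"
      using linear_diff[OF linB] linear_right_inverse(2)[OF lin[OF that] inv[OF that]] by simp
    finally show ?thesis by simp
  qed
  have "(\<phi> c has_derivative (\<lambda>h. \<Sum>b\<in>Basis. (w \<bullet> b) * (A' b h \<bullet> c))) (at x0)" for c
    unfolding \<phi>_def by (auto intro!: derivative_eq_intros der)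
  then have "((\<lambda>x. w - (\<Sum>c\<in>Basis. \<phi> c x *\<^sub>R B x c)) has_derivative
     (\<lambda>h. 0 - (\<Sum>c\<in>Basis. (\<Sum>b\<in>Basis. (w \<bullet> b) * (A' b h \<bullet> c)) *\<^sub>R B x0 c))) (at x0)"
    by (intro has_derivative_diff has_derivative_const has_derivative_sum
        has_derivative_scaleR_vanishing cont) (auto simp: \<phi>_def)
  then have "((\<lambda>x. w - (\<Sum>c\<in>Basis. \<phi> c x *\<^sub>R B x c)) has_derivative
     (\<lambda>h. - (\<Sum>c\<in>Basis. (\<Sum>b\<in>Basis. (B x0 v \<bullet> b) * (A' b h \<bullet> c)) *\<^sub>R B x0 c))) (at x0)"
    by (simp add: w_def)
  then show ?thesis
    by (rule has_derivative_transform_within_open[OF _ S]) (simp add: B)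
qed

text \<open>The derivative of the inverse is built from the inverse and the derivative of A, so each
  order of smoothness of A passes on to B.\<close>

lemma Ck_on_linear_inverse:
  fixes A :: "'a::real_normed_vector \<Rightarrow> 'b::euclidean_space \<Rightarrow> 'b"
  assumes S: "open S" and lin: "\<And>x. x \<in> S \<Longrightarrow> linear (A x)"
    and inv: "\<And>x v. x \<in> S \<Longrightarrow> A x (B x v) = v"
    and A: "\<And>u. Ck_on k S (\<lambda>x. A x u)"
  shows "Ck_on k S (\<lambda>x. B x v)"
  using A
proof (induction k arbitrary: v)
  case 0
  then have "isCont (\<lambda>x. A x u) x0" if "x0 \<in> S" for x0 u
    using that S by (simp add: continuous_on_eq_continuous_at)
  then show ?case
    by (auto intro!: continuous_at_imp_continuous_on continuous_linear_inverse[OF S _ lin inv])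
next
  case (Suc k)
  have IH: "Ck_on k S (\<lambda>x. B x v)" for v
    by (rule Suc.IH[OF Ck_on_SucD[OF Suc.prems]])
  show ?case
  proof (rule Ck_on_SucI[OF S])
    show "((\<lambda>x. B x v) has_derivative
      (\<lambda>h. - (\<Sum>c\<in>Basis. (\<Sum>b\<in>Basis. (B x v \<bullet> b) * (frechet_derivative (\<lambda>x. A x b) (at x) h \<bullet> c)) *\<^sub>R B x c))) (at x)"
      if "x \<in> S" for x
      by (rule has_derivative_linear_inverse[OF S that lin inv])
        (use Ck_on_has_derivative[OF Suc.prems that] in auto)
    show "Ck_on k S (\<lambda>x. - (\<Sum>c\<in>Basis. (\<Sum>b\<in>Basis. (B x v \<bullet> b) * (frechet_derivative (\<lambda>x. A x b) (at x) h \<bullet> c)) *\<^sub>R B x c))"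
      for h
      by (intro Ck_on_bounded_linear_compose[OF bounded_linear_minus[OF bounded_linear_ident] S]
          Ck_on_sum[OF S] Ck_on_bilinear[OF bounded_bilinear_scaleR S] IH
          Ck_on_bilinear[OF bounded_bilinear_mult S] Ck_on_bounded_linear_compose[OF bounded_linear_inner_left S])
        (use Suc.prems in auto)
  qed
qed

lemma smooth_on_linear_inverse:
  fixes A :: "'a::real_normed_vector \<Rightarrow> 'b::euclidean_space \<Rightarrow> 'b"
  assumes "open S" "\<And>x. x \<in> S \<Longrightarrow> linear (A x)" "\<And>x v. x \<in> S \<Longrightarrow> A x (B x v) = v"
    "\<And>u. smooth_on S (\<lambda>x. A x u)"
  shows "smooth_on S (\<lambda>x. B x v)"
  unfolding smooth_on_def
  by (intro allI Ck_on_linear_inverse[OF assms(1-3)]) (use assms(4) in \<open>auto simp: smooth_on_def\<close>)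

text \<open>Openness of the image is invariance of domain. Smoothness of g is a bootstrap: its
  derivative inverts the derivative of h at g y, so if g has class k then so has its derivative, and
  g has class k + 1.\<close>

lemma smooth_on_inverse_function:
  fixes h :: "'a::euclidean_space \<Rightarrow> 'a"
  assumes S: "open S" and h: "smooth_on S h" and g: "\<And>x. x \<in> S \<Longrightarrow> g (h x) = x"
    and surj: "\<And>x. x \<in> S \<Longrightarrow> surj (frechet_derivative h (at x))"
  shows "open (h ` S)" "smooth_on (h ` S) g"
proof -
  have "inj_on h S" using g by (metis inj_onI)
  then show op: "open (h ` S)"
    using invariance_of_domain smooth_on_continuous_on[OF h] S by blast
  define A where "A = (\<lambda>y. frechet_derivative h (at (g y)))"
  define B where "B = (\<lambda>y v. SOME w. A y w = v)"
  have lin: "linear (A y)" if "y \<in> h ` S" for y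
    using that g smooth_on_linear_derivative[OF h] by (auto simp: A_def)
  have inv: "A y (B y v) = v" if "y \<in> h ` S" for y v
  proof -
    have "\<exists>w. A y w = v" using surj g that unfolding A_def by (auto simp: surj_def) metis
    then show ?thesis unfolding B_def by (rule someI_ex)
  qed
  have der: "(g has_derivative B y) (at y)" if y: "y \<in> h ` S" for y
  proof -
    obtain x where x: "x \<in> S" "y = h x" using y by blast
    have "(g has_derivative B y) (at (h x))"
    proof (rule has_derivative_inverse_strong[OF S x(1) smooth_on_continuous_on[OF h] g])
      show "(h has_derivative A y) (at x)"
        using smooth_on_has_derivative[OF h x(1)] g[OF x(1)] by (simp add: A_def x)
      show "A y \<circ> B y = id" using inv[OF y] by (auto simp: fun_eq_iff)
    qed
    then show ?thesis using x by simp
  qed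
  have "Ck_on k (h ` S) g" for k
  proof (induction k)
    case 0
    show ?case
      using der has_derivative_continuous
      by (metis Ck_on.simps(1) continuous_at_imp_continuous_on)
  next
    case (Suc k)
    have A: "Ck_on k (h ` S) (\<lambda>y. A y u)" for u
      unfolding A_def
      using Ck_on_compose[OF op S _ Suc.IH] smooth_on_frechet_derivative[OF h, of u] g
      by (auto simp: smooth_on_def image_subset_iff)
    have "Ck_on k (h ` S) (\<lambda>y. B y v)" for v
      by (rule Ck_on_linear_inverse[OF op lin inv]) (auto intro: A)
    then show ?case using Ck_on_SucI[OF op, of g B] der by blast
  qed
  then show "smooth_on (h ` S) g" by (simp add: smooth_on_def)
qed

section \<open>Matrix calculus\<close>

lemma bounded_bilinear_matrix_mult:
  "bounded_bilinear ((**) :: real^'n^'m \<Rightarrow> real^'k^'n \<Rightarrow> real^'k^'m)"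
  by (auto simp: bilinear_conv_bounded_bilinear[symmetric] bilinear_def linear_iff vec_eq_iff
      matrix_matrix_mult_def sum.distrib algebra_simps sum_distrib_left)

interpretation mm: bounded_bilinear "(**) :: real^'n^'m \<Rightarrow> real^'k^'n \<Rightarrow> real^'k^'m"
  by (rule bounded_bilinear_matrix_mult)

lemma linear_transpose: "linear (transpose :: real^'n^'m \<Rightarrow> real^'m^'n)"
  by (auto simp: linear_iff vec_eq_iff transpose_def)

lemma bounded_linear_transpose: "bounded_linear (transpose :: real^'n^'m \<Rightarrow> real^'m^'n)"
  using linear_transpose linear_conv_bounded_linear by blast

lemmas transpose_add = linear_add[OF linear_transpose]
  and transpose_diff = linear_diff[OF linear_transpose]
  and transpose_zero [simp] = linear_0[OF linear_transpose]

lemma linear_trace: "linear (trace :: real^'n^'n \<Rightarrow> real)"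
  by (auto simp: linear_iff trace_def sum.distrib sum_distrib_left)

lemma bounded_linear_trace: "bounded_linear (trace :: real^'n^'n \<Rightarrow> real)"
  using linear_trace linear_conv_bounded_linear by blast

lemmas trace_scaleR = linear_scale[OF linear_trace]
  and trace_minus [simp] = linear_neg[OF linear_trace]
  and trace_zero [simp] = linear_0[OF linear_trace]

lemma trace_transpose: "trace (transpose A) = trace A"
  by (simp add: trace_def transpose_def)

lemma trace_mult_transpose: "trace (A ** transpose B) = A \<bullet> (B :: real^'n^'n)"
  by (simp add: trace_def matrix_matrix_mult_def transpose_def inner_vec_def)

lemma norm_transpose: "norm (transpose A) = norm (A :: real^'n^'n)"
  by (metis norm_eq_sqrt_inner trace_mul_sym trace_mult_transpose transpose_transpose)

lemma matrix_inv:
  fixes A :: "real^'n^'n"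
  assumes "det A \<noteq> 0"
  shows "A ** matrix_inv A = mat 1" "matrix_inv A ** A = mat 1"
proof -
  have "\<exists>B. A ** B = mat 1 \<and> B ** A = mat 1"
    using assms by (simp add: invertible_det_nz[symmetric] invertible_def)
  then have "A ** matrix_inv A = mat 1 \<and> matrix_inv A ** A = mat 1"
    unfolding matrix_inv_def by (rule someI_ex)
  then show "A ** matrix_inv A = mat 1" "matrix_inv A ** A = mat 1" by auto
qed

lemma matrix_inv_unique:
  fixes A :: "real^'n^'n"
  assumes "A ** B = mat 1"
  shows "matrix_inv A = B"
proof -
  have "det A * det B = 1" using assms by (metis det_I det_mul)
  then have "det A \<noteq> 0" by auto
  then have "matrix_inv A = matrix_inv A ** (A ** B)" using assms by simp
  also have "\<dots> = B" using matrix_inv(2)[OF \<open>det A \<noteq> 0\<close>] by (simp add: matrix_mul_assoc)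
  finally show ?thesis .
qed

lemma smooth_on_det: "smooth_on UNIV (det :: real^'n^'n \<Rightarrow> real)"
proof -
  have "bounded_linear (\<lambda>A :: real^'n^'n. A $ i $ j)" for i j
    by (intro bounded_linear_compose[OF bounded_linear_vec_nth bounded_linear_vec_nth])
  then have "smooth_on UNIV (\<lambda>A :: real^'n^'n. of_int (sign p) * (\<Prod>i\<in>UNIV. A $ i $ p i))" for p
    by (intro smooth_on_bounded_linear_compose[OF bounded_linear_mult_right] smooth_on_prod
        smooth_on_bounded_linear open_UNIV)
  then have "smooth_on UNIV (\<lambda>A :: real^'n^'n. \<Sum>p | p permutes UNIV. of_int (sign p) * (\<Prod>i\<in>UNIV. A $ i $ p i))"
    by (intro smooth_on_sum open_UNIV)
  then show ?thesis by (simp add: det_def[abs_def])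
qed

text \<open>In the Leibniz sum a permutation other than the identity moves at least two indices.
  After one factor has been differentiated, an off-diagonal zero of the identity matrix remains, so
  only the diagonal product contributes.\<close>

lemma has_derivative_det_mat_1: "(det has_derivative trace) (at (mat 1 :: real^'n^'n))"
proof -
  have nth: "((\<lambda>A :: real^'n^'n. A $ i $ j) has_derivative (\<lambda>H. H $ i $ j)) (at (mat 1))" for i j
    by (intro bounded_linear_imp_has_derivative bounded_linear_compose[OF bounded_linear_vec_nth bounded_linear_vec_nth])
  define d where "d = (\<lambda>(H :: real^'n^'n) p. of_int (sign p) *
      (\<Sum>i\<in>UNIV. H $ i $ p i * (\<Prod>j\<in>UNIV - {i}. (mat 1 :: real^'n^'n) $ j $ p j)))"
  have "((\<lambda>A :: real^'n^'n. \<Sum>p | p permutes UNIV. of_int (sign p) * (\<Prod>i\<in>UNIV. A $ i $ p i))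
      has_derivative (\<lambda>H. \<Sum>p | p permutes UNIV. d H p)) (at (mat 1))"
    unfolding d_def by (intro has_derivative_sum has_derivative_mult_right has_derivative_prod nth)
  moreover have "(\<Sum>p | p permutes UNIV. d H p) = trace H" for H
  proof -
    have "d H p = 0" if p: "p permutes UNIV" "p \<noteq> id" for p
    proof -
      have "(\<Prod>j\<in>UNIV - {i}. (mat 1 :: real^'n^'n) $ j $ p j) = 0" for i
      proof -
        have "\<exists>j. j \<noteq> i \<and> p j \<noteq> j"
        proof (rule ccontr)
          assume "\<not> ?thesis"
          then have *: "\<And>j. j \<noteq> i \<Longrightarrow> p j = j" by blast
          then have "p i = i" using permutes_inj[OF p(1)] by (metis injD)
          then show False using * p(2) by (metis eq_id_iff)
        qed
        then obtain j where j: "j \<noteq> i" "p j \<noteq> j" by blast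
        show ?thesis
          by (rule prod_zero[OF _ bexI[of _ j]]) (use j in \<open>auto simp: mat_def\<close>)
      qed
      then show ?thesis unfolding d_def by (simp only: mult_zero_right sum.neutral_const)
    qed
    then have "(\<Sum>p | p permutes UNIV. d H p) = (\<Sum>p\<in>{id}. d H p)"
      by (intro sum.mono_neutral_right) (auto simp: permutes_id finite_permutations)
    also have "\<dots> = trace H" by (simp add: d_def trace_def mat_def sign_id)
    finally show ?thesis .
  qed
  ultimately show ?thesis by (simp add: det_def[abs_def])
qed

text \<open>Jacobi's formula, transported from the identity by the factorisation det X = det A * det
  (A^-1 X).\<close>

lemma has_derivative_det:
  fixes A :: "real^'n^'n"
  assumes "det A \<noteq> 0"
  shows "(det has_derivative (\<lambda>H. det A * trace (matrix_inv A ** H))) (at A)"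
proof -
  have "((\<lambda>X. matrix_inv A ** X) has_derivative (\<lambda>H. matrix_inv A ** H)) (at A)"
    by (intro bounded_linear_imp_has_derivative mm.bounded_linear_right)
  moreover have "(det has_derivative trace) (at (matrix_inv A ** A))"
    using has_derivative_det_mat_1 matrix_inv[OF assms] by simp
  ultimately have "((\<lambda>X. det A * det (matrix_inv A ** X)) has_derivative
      (\<lambda>H. det A * trace (matrix_inv A ** H))) (at A)"
    using has_derivative_mult_right[OF has_derivative_compose] by blast
  moreover have "det A * det (matrix_inv A ** X) = det X" for X
    using matrix_inv(1)[OF assms] by (metis det_mul matrix_mul_assoc matrix_mul_lid)
  ultimately show ?thesis by simp
qed

text \<open>This is \<open>smooth_on_linear_inverse\<close> for left multiplication by
  \<open>f x\<close>, evaluated at the identity matrix.\<close>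

lemma smooth_on_matrix_inv:
  fixes f :: "'a::real_normed_vector \<Rightarrow> real^'n^'n"
  assumes "open S" "smooth_on S f" "\<And>x. x \<in> S \<Longrightarrow> det (f x) \<noteq> 0"
  shows "smooth_on S (\<lambda>x. matrix_inv (f x))"
proof -
  have "smooth_on S (\<lambda>x. matrix_inv (f x) ** mat 1)"
  proof (rule smooth_on_linear_inverse[where A = "\<lambda>x u. f x ** u" and B = "\<lambda>x v. matrix_inv (f x) ** v"])
    show "linear ((**) (f x))" for x
      using mm.bounded_linear_right bounded_linear.linear by blast
    show "f x ** (matrix_inv (f x) ** v) = v" if "x \<in> S" for x and v :: "real^'n^'n"
      using matrix_inv(1)[OF assms(3)[OF that]] by (simp add: matrix_mul_assoc)
    show "smooth_on S (\<lambda>x. f x ** u)" for u :: "real^'n^'n"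
      by (rule smooth_on_bounded_linear_compose[OF mm.bounded_linear_left assms(1,2)])
  qed (rule assms(1))
  then show ?thesis by simp
qed

text \<open>Squaring has derivative 2 id at the identity, so it is invertible nearby. Roots of
  symmetric matrices are symmetric because the ball B is stable under transposition, an isometry,
  and the root in B is unique. The root supplies local sections of the projection from SL.\<close>

lemma local_matrix_sqrt:
  obtains R and G :: "real^'n^'n \<Rightarrow> real^'n^'n" where
    "open R" "mat 1 \<in> R" "smooth_on R G" "G (mat 1) = mat 1"
    "\<And>A. A \<in> R \<Longrightarrow> G A ** G A = A"
    "\<And>A. A \<in> R \<Longrightarrow> transpose A = A \<Longrightarrow> transpose (G A) = G A"
proof -
  define I where "I = (mat 1 :: real^'n^'n)"
  define sq where "sq = (\<lambda>X :: real^'n^'n. X ** X)"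
  define sq' where "sq' = (\<lambda>(X :: real^'n^'n) (H :: real^'n^'n). X ** H + H ** X)"
  obtain K where K: "K > 0" "\<And>(X :: real^'n^'n) (Y :: real^'n^'n). norm (X ** Y) \<le> norm X * norm Y * K"
    using mm.pos_bounded by blast
  have der: "(sq has_derivative sq' X) (at X)" for X
    unfolding sq_def sq'_def
    by (rule mm.FDERIV[OF has_derivative_ident has_derivative_ident])
  have sub: "sq' X v - sq' I v = (X - I) ** v + v ** (X - I)" for X v :: "real^'n^'n"
    by (simp add: sq'_def mm.diff_left mm.diff_right)
  have bound: "norm (sq' X v - sq' I v) \<le> (2 * K * norm (X - I)) * norm v" for X v :: "real^'n^'n"
    unfolding sub
    using norm_triangle_ineq[of "(X - I) ** v" "v ** (X - I)"] K(2)[of "X - I" v] K(2)[of v "X - I"]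
    by (simp add: algebra_simps)
  have I: "sq' I v = 2 *\<^sub>R v" for v by (simp add: sq'_def I_def scaleR_2)
  have "bounded_linear (\<lambda>v :: real^'n^'n. (1/2) *\<^sub>R v)" by (rule bounded_linear_scaleR_right)
  moreover have "(\<lambda>v. (1/2) *\<^sub>R v) \<circ> sq' I = id" by (auto simp: I)
  moreover have "\<exists>d>0. \<forall>X. dist I X < d \<longrightarrow> onorm (\<lambda>v. sq' X v - sq' I v) < e" if "e > 0" for e
  proof (intro exI[of _ "e / (2 * K)"] conjI allI impI)
    fix X assume "dist I X < e / (2 * K)"
    then have "2 * K * norm (X - I) < e"
      using K(1) by (simp add: dist_norm norm_minus_commute field_simps)
    moreover have "onorm (\<lambda>v. sq' X v - sq' I v) \<le> 2 * K * norm (X - I)"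
      by (rule onorm_le) (rule bound)
    ultimately show "onorm (\<lambda>v. sq' X v - sq' I v) < e" by linarith
  qed (use that K in auto)
  ultimately obtain r where r: "r > 0" "inj_on sq (ball I r)"
    using has_derivative_locally_injective[of I UNIV "\<lambda>v. (1/2) *\<^sub>R v" sq' sq] der by auto
  \<comment> \<open>Radius r makes squaring injective; within 1 / K its derivative differs from 2 id
    by an operator of norm below 2 and is therefore injective.\<close>
  define B where "B = ball I (min r (1 / K))"
  define G where "G = inv_into B sq"
  have inj: "inj_on sq B" using r(2) by (rule inj_on_subset) (auto simp: B_def)
  have G: "G (sq X) = X" if "X \<in> B" for X
    using inv_into_f_f[OF inj that] by (simp add: G_def)
  have surj: "surj (frechet_derivative sq (at X))" if "X \<in> B" for X
  proof -
    have "linear (sq' X)" using der has_derivative_linear by blast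
    moreover have "inj (sq' X)"
    proof (subst linear_injective_0[OF \<open>linear (sq' X)\<close>], intro allI impI, rule ccontr)
      fix v assume v: "sq' X v = 0" "v \<noteq> 0"
      have "norm (X - I) < 1 / K" using that by (simp add: B_def dist_norm norm_minus_commute)
      then have "2 * K * norm (X - I) < 2" using K(1) by (simp add: field_simps)
      then have "(2 * K * norm (X - I)) * norm v < 2 * norm v" using v(2) by simp
      then show False using bound[of X v] v(1) by (simp add: I)
    qed
    ultimately have "surj (sq' X)" by (rule linear_injective_imp_surjective) simp
    then show ?thesis using frechet_derivative_at[OF der] by metis
  qed
  have sm: "smooth_on B sq"
    unfolding sq_def by (intro smooth_on_bilinear[OF bounded_bilinear_matrix_mult]) (auto simp: B_def)
  note GS = smooth_on_inverse_function[OF _ sm G surj]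
  have IB: "I \<in> B" using r(1) K(1) by (simp add: B_def)
  show ?thesis
  proof (rule that)
    show "open (sq ` B)" "smooth_on (sq ` B) G" using GS by (auto simp: B_def)
    have "sq I = mat 1" by (simp add: sq_def I_def)
    then show "mat 1 \<in> sq ` B" "G (mat 1) = mat 1"
      using IB G[OF IB] by (metis imageI) (metis G IB I_def \<open>sq I = mat 1\<close>)
    show "G A ** G A = A" if "A \<in> sq ` B" for A
      using that G by (auto simp: sq_def)
    show "transpose (G A) = G A" if "A \<in> sq ` B" "transpose A = A" for A
    proof -
      obtain X where X: "X \<in> B" "A = sq X" using \<open>A \<in> sq ` B\<close> by blast
      have "norm (transpose X - I) = norm (X - I)"
        by (metis I_def norm_transpose transpose_diff transpose_mat)
      then have "transpose X \<in> B"
        using X(1) by (simp add: B_def dist_norm norm_minus_commute)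
      moreover have "sq (transpose X) = sq X"
        using that(2) X(2) by (simp add: sq_def matrix_transpose_mul)
      ultimately show ?thesis using G X by metis
    qed
  qed
qed

section \<open>Dimensions of the symmetric and the trace-free symmetric matrices\<close>

definition symmetric_matrices :: "(real^'n^'n) set" where
  "symmetric_matrices = {A. transpose A = A}"

definition sym0 :: "(real^'n^'n) set" where
  "sym0 = {A. transpose A = A \<and> trace A = 0}"

lemma subspace_symmetric_matrices: "subspace symmetric_matrices"
  by (simp add: symmetric_matrices_def subspace_def transpose_add transpose_scalar)

lemma subspace_sym0: "subspace sym0"
  by (simp add: sym0_def subspace_def transpose_add transpose_scalar trace_add trace_scaleR)

lemma dim_symmetric_matrices:
  "dim (symmetric_matrices :: (real^'n^'n) set) = CARD('n) * (CARD('n) + 1) div 2"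
proof -
  \<comment> \<open>Indexing by the set {i, j} identifies the entries (i, j) and (j, i) without an
    order on the index type; singletons give the diagonal units.\<close>
  define E where "E = (\<lambda>s :: 'n set. (\<chi> i j. if {i, j} = s then 1 else 0) :: real^'n^'n)"
  define T where "T = {s :: 'n set. card s = 1} \<union> {s. card s = 2}"
  have T: "s \<in> T \<longleftrightarrow> (\<exists>i j. s = {i, j})" for s
    unfolding T_def by (auto simp: card_1_singleton_iff card_2_iff)
  have fin: "finite T" by simp
  have orth: "E s \<bullet> E t = 0" if "s \<noteq> t" for s t
    unfolding E_def inner_vec_def using that by (auto intro!: sum.neutral split: if_splits)
  have nz: "E s \<noteq> 0" if s: "s \<in> T" for s
  proof -
    obtain i j where "s = {i, j}" using T s by blast
    then have "E s $ i $ j = 1" by (simp add: E_def)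
    then show ?thesis by auto
  qed
  have inj: "inj_on E T"
    by (rule inj_onI) (metis inner_eq_zero_iff nz orth)
  have "pairwise orthogonal (E ` T)"
    by (rule pairwiseI) (auto simp: orthogonal_def intro!: orth)
  then have ind: "independent (E ` T)"
    by (rule pairwise_orthogonal_independent) (use nz in auto)
  have "symmetric_matrices \<subseteq> span (E ` T)"
  proof
    fix A :: "real^'n^'n" assume "A \<in> symmetric_matrices"
    then have sym: "A $ i $ j = A $ j $ i" for i j
      by (simp add: symmetric_matrices_def transpose_def vec_eq_iff)
    \<comment> \<open>The coefficient is read off at either ordering of the pair; symmetry of A
      makes the choice irrelevant.\<close>
    define c where "c = (\<lambda>s. SOME r. \<exists>i j. s = {i, j} \<and> r = A $ i $ j)"
    have c: "c {i, j} = A $ i $ j" for i j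
    proof -
      have "\<exists>r. \<exists>k l. {i, j} = {k, l} \<and> r = A $ k $ l" by blast
      then have "\<exists>k l. {i, j} = {k, l} \<and> c {i, j} = A $ k $ l"
        unfolding c_def by (rule someI_ex)
      then show ?thesis using sym by (auto simp: doubleton_eq_iff)
    qed
    have "A = (\<Sum>s\<in>T. c s *\<^sub>R E s)"
    proof (simp add: vec_eq_iff, intro allI)
      fix i j
      have "(\<Sum>s\<in>T. c s * E s $ i $ j) = (\<Sum>s\<in>{{i, j}}. c s * E s $ i $ j)"
        by (intro sum.mono_neutral_right fin) (use T in \<open>auto simp: E_def\<close>)
      then show "A $ i $ j = (\<Sum>s\<in>T. c s * E s $ i $ j)"
        by (simp add: c E_def)
    qed
    also have "\<dots> \<in> span (E ` T)"
      by (intro span_sum span_scale span_base imageI)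
    finally show "A \<in> span (E ` T)" .
  qed
  moreover have "E ` T \<subseteq> symmetric_matrices"
    by (auto simp: symmetric_matrices_def E_def transpose_def vec_eq_iff insert_commute)
  ultimately have "dim (symmetric_matrices :: (real^'n^'n) set) = card (E ` T)"
    using span_subspace[OF _ _ subspace_symmetric_matrices, of "E ` T"]
    by (intro dim_eq_card[OF _ ind]) (simp add: span_eq_iff[THEN iffD2, OF subspace_symmetric_matrices])
  also have "\<dots> = card T" using inj by (rule card_image)
  also have "\<dots> = card {s :: 'n set. card s = 1} + card {s :: 'n set. card s = 2}"
    unfolding T_def by (intro card_Un_disjoint) auto
  also have "\<dots> = (CARD('n) choose 1) + (CARD('n) choose 2)"
    using n_subsets[of "UNIV :: 'n set" 1] n_subsets[of "UNIV :: 'n set" 2] by simp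
  also have "\<dots> = CARD('n) + CARD('n) * (CARD('n) - 1) div 2"
    by (simp add: choose_two)
  also have "\<dots> = CARD('n) * (CARD('n) + 1) div 2"
    by (cases "CARD('n)") (auto simp: algebra_simps)
  finally show ?thesis .
qed

text \<open>The trace is the inner product with the identity, so \<open>sym0\<close> is the
  orthogonal complement of a line inside the symmetric matrices.\<close>

lemma dim_sym0:
  "dim (sym0 :: (real^'n^'n) set) = CARD('n) * (CARD('n) + 1) div 2 - 1"
proof -
  let ?I = "mat 1 :: real^'n^'n"
  have I: "A \<bullet> ?I = trace A" for A
    using trace_mult_transpose[of A ?I] by simp
  have "sym0 = {A \<in> symmetric_matrices. \<forall>x\<in>span {?I}. orthogonal x A}"
    using I by (auto simp: sym0_def symmetric_matrices_def span_singleton orthogonal_def inner_commute)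
  moreover have "?I \<noteq> 0"
    using trace_I[where 'n='n and 'a=real] by auto
  then have "dim (span {?I}) = 1" by (simp add: dim_insert)
  moreover have "span {?I} \<subseteq> symmetric_matrices"
    by (rule span_minimal[OF _ subspace_symmetric_matrices]) (simp add: symmetric_matrices_def)
  ultimately have "dim (sym0 :: (real^'n^'n) set) + 1 = dim (symmetric_matrices :: (real^'n^'n) set)"
    using dim_subspace_orthogonal_to_vectors[of "span {?I}" symmetric_matrices]
      subspace_symmetric_matrices by simp
  then show ?thesis by (simp add: dim_symmetric_matrices)
qed

section \<open>Positive definite matrices of determinant one\<close>

definition gram :: "real^'n^'n \<Rightarrow> real^'n^'n" where
  "gram x = x ** transpose x"

text \<open>Encoded as an image so that each element comes with a factor x in SL; congruence by x
  then pulls statements at P back to the identity.\<close>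

definition Pos1 :: "(real^'n^'n) set" where
  "Pos1 = gram ` SL"

definition cpos :: "(real^'n^'n) set \<Rightarrow> real^'n^'n" where
  "cpos q = gram (SOME x. x \<in> SL \<and> coset x = q)"

text \<open>The trace condition is the differential of det = 1 at P, by Jacobi's formula.\<close>

definition tangent :: "real^'n^'n \<Rightarrow> (real^'n^'n) set" where
  "tangent P = {A. transpose A = A \<and> trace (matrix_inv P ** A) = 0}"

text \<open>The affine-invariant metric on positive definite matrices, scaled by a quarter to
  compensate for the doubling of symmetric Z by the differential of \<open>gram\<close>.\<close>

definition trace_form :: "real^'n^'n \<Rightarrow> real^'n^'n \<Rightarrow> real^'n^'n \<Rightarrow> real" where
  "trace_form P A B = trace ((matrix_inv P ** A) ** (matrix_inv P ** B)) / 4"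

lemma transpose_gram [simp]: "transpose (gram x) = gram x"
  by (simp add: gram_def matrix_transpose_mul)

lemma det_gram: "det (gram x) = (det x)\<^sup>2"
  by (simp add: gram_def det_mul power2_eq_square)

lemma trace_gram: "trace (gram x) = (norm x)\<^sup>2" for x :: "real^'n^'n"
  by (simp add: gram_def trace_mult_transpose power2_norm_eq_inner)

lemma SL_det_nonzero: "x \<in> SL \<Longrightarrow> det x \<noteq> 0"
  by (simp add: SL_def)

lemma SL_trace_gram_pos: "x \<in> SL \<Longrightarrow> 0 < trace (gram x)" for x :: "real^'n^'n"
proof -
  assume "x \<in> SL"
  then have "x \<noteq> 0" using SL_det_nonzero[of x] det_0 by (metis mat_0)
  then show ?thesis by (simp add: trace_gram)
qed

lemma SL_matrix_inv:
  assumes "x \<in> SL"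
  shows "x ** matrix_inv x = mat 1" "matrix_inv x ** x = mat 1"
    "transpose (matrix_inv x) ** transpose x = mat 1" "transpose x ** transpose (matrix_inv x) = mat 1"
  using matrix_inv[OF SL_det_nonzero[OF assms]] by (auto simp: matrix_transpose_mul[symmetric])

lemma matrix_inv_gram:
  assumes "x \<in> SL"
  shows "matrix_inv (gram x) = transpose (matrix_inv x) ** matrix_inv x"
proof (rule matrix_inv_unique)
  have "gram x ** (transpose (matrix_inv x) ** matrix_inv x) =
      x ** (transpose x ** transpose (matrix_inv x)) ** matrix_inv x"
    by (simp add: gram_def matrix_mul_assoc)
  then show "gram x ** (transpose (matrix_inv x) ** matrix_inv x) = mat 1"
    using SL_matrix_inv[OF assms] by simp
qed

text \<open>Congruence by x carries the tangent space at the identity, \<open>sym0\<close>, onto the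
  one at \<open>gram x\<close>. Dimension, positivity and norm estimates at a general point are all
  obtained through this description.\<close>

lemma tangent_gram_iff:
  assumes "x \<in> SL"
  shows "A \<in> tangent (gram x) \<longleftrightarrow> (\<exists>Z\<in>sym0. A = x ** Z ** transpose x)"
proof
  assume A: "A \<in> tangent (gram x)"
  define Z where "Z = matrix_inv x ** A ** transpose (matrix_inv x)"
  have "x ** Z ** transpose x = (x ** matrix_inv x) ** A ** (transpose (matrix_inv x) ** transpose x)"
    by (simp add: Z_def matrix_mul_assoc)
  then have "A = x ** Z ** transpose x" using SL_matrix_inv[OF assms] by simp
  moreover have "transpose Z = Z"
    using A by (simp add: Z_def tangent_def matrix_transpose_mul matrix_mul_assoc)
  moreover have "trace Z = trace (transpose (matrix_inv x) ** (matrix_inv x ** A))"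
    unfolding Z_def by (rule trace_mul_sym)
  then have "trace Z = 0"
    using A by (simp add: tangent_def matrix_inv_gram[OF assms] matrix_mul_assoc)
  ultimately show "\<exists>Z\<in>sym0. A = x ** Z ** transpose x" by (auto simp: sym0_def)
next
  assume "\<exists>Z\<in>sym0. A = x ** Z ** transpose x"
  then obtain Z where Z: "transpose Z = Z" "trace Z = 0" "A = x ** Z ** transpose x"
    by (auto simp: sym0_def)
  have "matrix_inv (gram x) ** A = transpose (matrix_inv x) ** ((matrix_inv x ** x) ** Z ** transpose x)"
    by (simp add: Z(3) matrix_inv_gram[OF assms] matrix_mul_assoc)
  also have "\<dots> = transpose (matrix_inv x) ** (Z ** transpose x)"
    using SL_matrix_inv[OF assms] by simp
  also have "trace \<dots> = trace (Z ** (transpose x ** transpose (matrix_inv x)))"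
    by (subst trace_mul_sym) (simp add: matrix_mul_assoc)
  also have "\<dots> = 0" using SL_matrix_inv[OF assms] Z(2) by simp
  finally show "A \<in> tangent (gram x)"
    using Z by (simp add: tangent_def matrix_transpose_mul matrix_mul_assoc)
qed

lemma trace_form_gram:
  assumes "x \<in> SL"
  shows "trace_form (gram x) (x ** Z ** transpose x) (x ** W ** transpose x) = trace (Z ** W) / 4"
proof -
  have *: "matrix_inv (gram x) ** (x ** Z ** transpose x) =
      transpose (matrix_inv x) ** (Z ** transpose x)" for Z
  proof -
    have "matrix_inv (gram x) ** (x ** Z ** transpose x) =
        transpose (matrix_inv x) ** ((matrix_inv x ** x) ** Z ** transpose x)"
      by (simp add: matrix_inv_gram[OF assms] matrix_mul_assoc)
    then show ?thesis using SL_matrix_inv[OF assms] by simp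
  qed
  have "trace ((transpose (matrix_inv x) ** (Z ** transpose x)) ** (transpose (matrix_inv x) ** (W ** transpose x)))
     = trace ((Z ** transpose x ** transpose (matrix_inv x) ** W ** transpose x) ** transpose (matrix_inv x))"
    by (subst trace_mul_sym) (simp add: trace_mul_sym[of "transpose (matrix_inv x)"] matrix_mul_assoc)
  also have "\<dots> = trace (Z ** (transpose x ** transpose (matrix_inv x)) ** W ** (transpose x ** transpose (matrix_inv x)))"
    by (simp add: matrix_mul_assoc)
  also have "\<dots> = trace (Z ** W)" using SL_matrix_inv[OF assms] by simp
  finally show ?thesis by (simp add: trace_form_def *)
qed

lemma subspace_tangent: "subspace (tangent P)"
  by (simp add: tangent_def subspace_def transpose_add transpose_scalar trace_add trace_scaleR
      mm.add_right mm.scaleR_right)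

lemma dim_tangent:
  assumes "P \<in> Pos1"
  shows "dim (tangent P :: (real^'n^'n) set) = dim (sym0 :: (real^'n^'n) set)"
proof -
  obtain x where x: "x \<in> SL" "P = gram x" using assms by (auto simp: Pos1_def)
  let ?f = "\<lambda>Z. x ** Z ** transpose x"
  have lin: "linear ?f"
    by (intro bounded_linear.linear bounded_linear_compose[OF mm.bounded_linear_left mm.bounded_linear_right])
  have "inj ?f"
  proof (rule injI)
    fix Z W assume "x ** Z ** transpose x = x ** W ** transpose x"
    then have "matrix_inv x ** (x ** Z ** transpose x) ** transpose (matrix_inv x) =
        matrix_inv x ** (x ** W ** transpose x) ** transpose (matrix_inv x)" by simp
    moreover have "matrix_inv x ** (x ** Z ** transpose x) ** transpose (matrix_inv x) =
        (matrix_inv x ** x) ** Z ** (transpose x ** transpose (matrix_inv x))" for Z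
      by (simp add: matrix_mul_assoc)
    ultimately show "Z = W" using SL_matrix_inv[OF x(1)] by simp
  qed
  then have "dim (?f ` sym0) = dim (sym0 :: (real^'n^'n) set)"
    by (intro dim_image_eq lin) (auto intro: inj_on_subset)
  moreover have "?f ` sym0 = tangent P"
    using tangent_gram_iff[OF x(1)] by (auto simp: x(2))
  ultimately show ?thesis by simp
qed

text \<open>If the Gram matrices agree, then for z in \<open>coset x\<close> the matrix l = y^-1 z
  is orthogonal, and it has determinant 1 because y and z do. Hence \<open>cpos\<close> does not
  depend on the representative and is injective.\<close>

lemma coset_eq_iff:
  assumes "x \<in> SL" "y \<in> SL"
  shows "coset x = coset y \<longleftrightarrow> gram x = gram y"
proof
  assume "coset x = coset y"
  moreover have "x \<in> coset x"
  proof -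
    have "mat 1 \<in> SO" by (simp add: SO_def SL_def)
    then show ?thesis unfolding coset_def by (metis imageI matrix_mul_rid)
  qed
  ultimately obtain k where k: "k \<in> SO" "x = y ** k" unfolding coset_def by blast
  have "gram x = y ** (k ** transpose k) ** transpose y"
    by (simp add: k(2) gram_def matrix_transpose_mul matrix_mul_assoc)
  then show "gram x = gram y" using k(1) by (simp add: SO_def gram_def)
next
  have sub: "coset x \<subseteq> coset y" if x: "x \<in> SL" and y: "y \<in> SL" and eq: "gram x = gram y" for x y :: "real^'n^'n"
  proof
    fix z assume "z \<in> coset x"
    then obtain k where k: "k \<in> SO" "z = x ** k" unfolding coset_def by blast
    define l where "l = matrix_inv y ** z"
    have z: "gram z = gram y"
    proof -
      have "gram z = x ** (k ** transpose k) ** transpose x"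
        by (simp add: k(2) gram_def matrix_transpose_mul matrix_mul_assoc)
      then show ?thesis using k(1) eq by (simp add: SO_def gram_def)
    qed
    have "l ** transpose l = matrix_inv y ** gram z ** transpose (matrix_inv y)"
      by (simp add: l_def gram_def matrix_transpose_mul matrix_mul_assoc)
    also have "\<dots> = (matrix_inv y ** y) ** (transpose y ** transpose (matrix_inv y))"
      by (simp add: z) (simp add: gram_def matrix_mul_assoc)
    also have "\<dots> = mat 1" using SL_matrix_inv[OF y] by simp
    finally have "l ** transpose l = mat 1" .
    moreover have yl: "y ** l = z"
      using SL_matrix_inv(1)[OF y] by (simp add: l_def matrix_mul_assoc)
    moreover have "det z = 1" using k x by (simp add: SO_def SL_def det_mul)
    then have "det l = 1" using det_mul[of y l] yl y by (simp add: SL_def)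
    ultimately have "l \<in> SO" "z = y ** l" by (auto simp: SO_def SL_def)
    then show "z \<in> coset y" unfolding coset_def by blast
  qed
  assume "gram x = gram y"
  then show "coset x = coset y" using sub assms by (metis subset_antisym)
qed

lemma cpos_coset [simp]:
  assumes "x \<in> SL"
  shows "cpos (coset x) = gram x"
proof -
  have "(SOME y. y \<in> SL \<and> coset y = coset x) \<in> SL \<and> coset (SOME y. y \<in> SL \<and> coset y = coset x) = coset x"
    using assms by (intro someI_ex[of "\<lambda>y. y \<in> SL \<and> coset y = coset x"]) blast
  then show ?thesis using assms coset_eq_iff unfolding cpos_def by blast
qed

lemma inj_on_cpos: "inj_on cpos (coset ` SL)"
proof (rule inj_onI)
  fix p q :: "(real^'n^'n) set"
  assume "p \<in> coset ` SL" "q \<in> coset ` SL" and eq: "cpos p = cpos q"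
  then obtain x y where "x \<in> SL" "p = coset x" "y \<in> SL" "q = coset y" by (elim imageE)
  then show "p = q" using eq by (simp add: coset_eq_iff)
qed

lemma cpos_in_Pos1: "q \<in> coset ` SL \<Longrightarrow> cpos q \<in> Pos1"
  by (auto simp: Pos1_def)

section \<open>The Gram map and differentials of maps restricted to SL\<close>

lemma has_derivative_gram: "(gram has_derivative (\<lambda>H. x ** transpose H + H ** transpose x)) (at x within S)"
  unfolding gram_def[abs_def]
  by (intro mm.FDERIV has_derivative_ident bounded_linear_imp_has_derivative bounded_linear_transpose)

lemma smooth_on_gram: "open S \<Longrightarrow> smooth_on S gram"
  unfolding gram_def[abs_def]
  by (intro smooth_on_bilinear[OF bounded_bilinear_matrix_mult] smooth_on_ident
      smooth_on_bounded_linear bounded_linear_transpose)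

lemma continuous_on_gram: "continuous_on S gram"
  using continuous_on_subset[OF smooth_on_continuous_on[OF smooth_on_gram[OF open_UNIV]]] by simp

lemma det_scaleR: "det (c *\<^sub>R A) = c ^ CARD('n) * det A" for A :: "real^'n^'n"
  by (simp add: det_def prod.distrib sum_distrib_left mult_ac)

text \<open>The straight curve x (1 + t Z) leaves SL, and division by the n-th root of the
  determinant brings it back. Since trace Z = 0, the determinant is stationary at t = 0, so the
  correction does not change the velocity.\<close>

lemma SL_curve:
  fixes x :: "real^'n^'n"
  assumes "x \<in> SL" "trace Z = 0"
  obtains \<gamma> T where "open T" "0 \<in> T" "\<gamma> ` T \<subseteq> SL" "\<gamma> 0 = x" "(\<gamma> has_vector_derivative x ** Z) (at 0)"
proof -
  define N where "N = real CARD('n)"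
  have N: "N > 0" by (simp add: N_def)
  define m where "m = (\<lambda>t. mat 1 + t *\<^sub>R Z)"
  define d where "d = (\<lambda>t. det (m t))"
  have m: "(m has_vector_derivative Z) (at t)" for t
    unfolding m_def by (auto intro!: derivative_eq_intros)
  have m0: "m 0 = mat 1" by (simp add: m_def)
  have "((\<lambda>t. d t) has_derivative (\<lambda>h. trace (h *\<^sub>R Z))) (at 0)"
    unfolding d_def
    using has_derivative_compose[OF m[unfolded has_vector_derivative_def, of 0], of det trace]
      has_derivative_det_mat_1 by (simp add: m0)
  then have d': "(d has_real_derivative 0) (at 0)"
    using assms(2) by (simp add: has_field_derivative_def trace_scaleR mult_zero_left[abs_def])
  have d0: "d 0 = 1" by (simp add: d_def m0)
  have "((\<lambda>t. d t powr (-1/N)) has_real_derivative ((-1/N) * d 0 powr (-1/N - 1)) * 0) (at 0)"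
    by (rule DERIV_chain2[OF has_real_derivative_powr d']) (simp add: d0)
  then have e': "((\<lambda>t. d t powr (-1/N)) has_real_derivative 0) (at 0)" by simp
  have "((\<lambda>t. x ** m t) has_vector_derivative x ** Z) (at 0)"
    using bounded_linear.has_vector_derivative[OF mm.bounded_linear_right m] .
  from has_vector_derivative_scaleR[OF e' this]
  have \<gamma>': "((\<lambda>t. d t powr (-1/N) *\<^sub>R (x ** m t)) has_vector_derivative x ** Z) (at 0)"
    by (simp add: d0 m0)
  have cont: "continuous_on UNIV d"
    unfolding d_def m_def
    by (intro continuous_on_compose2[OF smooth_on_continuous_on[OF smooth_on_det]] continuous_intros) auto
  show ?thesis
  proof (rule that)
    show "open (d -` {0<..})" using cont open_greaterThan by (rule open_vimage[rotated])
    show "0 \<in> d -` {0<..}" by (simp add: d0)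
    show "(\<lambda>t. d t powr (-1/N) *\<^sub>R (x ** m t)) ` (d -` {0<..}) \<subseteq> SL"
    proof clarsimp
      fix t assume "0 < d t"
      have "(d t powr (-1/N)) ^ CARD('n) = d t powr (-1/N * N)"
        using \<open>0 < d t\<close> by (simp add: N_def powr_powr powr_realpow[symmetric])
      also have "\<dots> = 1 / d t" using N \<open>0 < d t\<close> by (simp add: powr_minus_divide)
      finally show "d t powr (- (1 / N)) *\<^sub>R (x ** m t) \<in> SL"
        using \<open>0 < d t\<close> assms(1) by (simp add: SL_def det_scaleR det_mul) (simp add: d_def)
    qed
    show "d 0 powr (-1/N) *\<^sub>R (x ** m 0) = x" by (simp add: d0 m0)
  qed (rule \<gamma>')
qed

text \<open>A derivative within SL is tested on the curves of \<open>SL_curve\<close>, which realise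
  all tangent vectors.\<close>

lemma differential_SL_unique:
  assumes "differential_SL f x D" "differential_SL f x D'" "x \<in> SL" "H \<in> tangent_SL x"
  shows "D H = D' H"
proof -
  obtain Z where Z: "trace Z = 0" "H = x ** Z" using assms(4) by (auto simp: tangent_SL_def)
  obtain \<gamma> T where \<gamma>: "open T" "0 \<in> T" "\<gamma> ` T \<subseteq> SL" "\<gamma> 0 = x" "(\<gamma> has_vector_derivative H) (at 0)"
    using SL_curve[OF assms(3) Z(1)] unfolding Z(2) by blast
  have *: "((f \<circ> \<gamma>) has_vector_derivative D H) (at 0)" if "differential_SL f x D" for D
  proof -
    have "(f has_derivative D) (at (\<gamma> 0) within \<gamma> ` T)"
      using that \<gamma>(3,4) unfolding differential_SL_def by (metis has_derivative_subset)
    then have "((f \<circ> \<gamma>) has_vector_derivative D H) (at 0 within T)"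
      by (rule vector_derivative_diff_chain_within[OF has_vector_derivative_at_within[OF \<gamma>(5)]])
    then show ?thesis using \<gamma>(1,2) by (simp only: at_within_open)
  qed
  show ?thesis by (rule vector_derivative_unique_at[OF *[OF assms(1)] *[OF assms(2)]])
qed

section \<open>Charts as parametrisations\<close>

lemma frechet_derivative_unique_on_open:
  assumes "open S" "x \<in> S" "\<And>y. y \<in> S \<Longrightarrow> f y = g y"
    "(f has_derivative f') (at x)" "(g has_derivative g') (at x)"
  shows "f' = g'"
  using has_derivative_transform_within_open[OF assms(4,1,2,3)] assms(5) has_derivative_unique by blast

text \<open>A chart is replaced by two smooth maps with ordinary derivatives on open sets: its
  inverse, as a map p into the matrices, and r, which extends the chart from positive definite
  matrices to the open set W.\<close>

locale chart_param =
  fixes U :: "(real^'n^'n) set set" and c :: "(real^'n^'n) set \<Rightarrow> 'e::euclidean_space"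
    and W :: "(real^'n^'n) set" and r :: "real^'n^'n \<Rightarrow> 'e"
  assumes dim_eq: "DIM('e) = dim (sym0 :: (real^'n^'n) set)"
    and U_subset: "U \<subseteq> coset ` SL" and inj_c: "inj_on c U" and open_image: "open (c ` U)"
    and smooth_p': "smooth_on (c ` U) (cpos \<circ> inv_into U c)"
    and open_W: "open W" and smooth_r: "smooth_on W r"
    and cpos_image: "cpos ` U = W \<inter> Pos1" and r_cpos: "\<And>q. q \<in> U \<Longrightarrow> r (cpos q) = c q"
begin

definition p :: "'e \<Rightarrow> real^'n^'n" where
  "p y = cpos (inv_into U c y)"

definition dp :: "'e \<Rightarrow> 'e \<Rightarrow> real^'n^'n" where
  "dp y = frechet_derivative p (at y)"

definition dr :: "real^'n^'n \<Rightarrow> real^'n^'n \<Rightarrow> 'e" where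
  "dr P = frechet_derivative r (at P)"

lemma p_c [simp]: "q \<in> U \<Longrightarrow> p (c q) = cpos q"
  by (simp add: p_def inj_c)

lemma smooth_p: "smooth_on (c ` U) p"
  using smooth_p' by (simp add: p_def[abs_def] comp_def)

lemma p_in: "y \<in> c ` U \<Longrightarrow> p y \<in> W" "y \<in> c ` U \<Longrightarrow> p y \<in> Pos1"
  using cpos_image by auto

lemma r_p: "y \<in> c ` U \<Longrightarrow> r (p y) = y"
  by (auto simp: r_cpos)

lemma has_derivative_p: "y \<in> c ` U \<Longrightarrow> (p has_derivative dp y) (at y)"
  unfolding dp_def by (rule smooth_on_has_derivative[OF smooth_p])

lemma has_derivative_r: "P \<in> W \<Longrightarrow> (r has_derivative dr P) (at P)"
  unfolding dr_def by (rule smooth_on_has_derivative[OF smooth_r])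

lemma linear_dp: "y \<in> c ` U \<Longrightarrow> linear (dp y)"
  using has_derivative_p has_derivative_linear by blast

lemma linear_dr: "P \<in> W \<Longrightarrow> linear (dr P)"
  using has_derivative_r has_derivative_linear by blast

lemma smooth_dp: "smooth_on (c ` U) (\<lambda>y. dp y u)"
  unfolding dp_def by (rule smooth_on_frechet_derivative[OF smooth_p])

lemma dr_dp:
  assumes "y \<in> c ` U"
  shows "dr (p y) (dp y u) = u"
proof -
  have der: "((\<lambda>y. r (p y)) has_derivative (\<lambda>u. dr (p y) (dp y u))) (at y)"
    using has_derivative_compose[OF has_derivative_p[OF assms] has_derivative_r] p_in assms by blast
  have "(\<lambda>u. dr (p y) (dp y u)) = (\<lambda>u. u)"
    by (rule frechet_derivative_unique_on_open[OF open_image assms r_p der has_derivative_ident])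
  then show ?thesis by meson
qed

lemma Pos1_facts:
  assumes "P \<in> Pos1"
  shows "transpose P = P" "det P = 1"
  using assms by (auto simp: Pos1_def det_gram SL_def)

text \<open>Obtained by differentiating the identities p^t = p and det p = 1.\<close>

lemma dp_tangent:
  assumes "y \<in> c ` U"
  shows "dp y u \<in> tangent (p y)"
proof -
  have "(\<lambda>u. transpose (dp y u)) = dp y"
  proof (rule frechet_derivative_unique_on_open[OF open_image assms])
    show "transpose (p z) = p z" if "z \<in> c ` U" for z
      by (rule Pos1_facts(1)[OF p_in(2)[OF that]])
    show "((\<lambda>z. transpose (p z)) has_derivative (\<lambda>u. transpose (dp y u))) (at y)"
      by (rule bounded_linear.has_derivative[OF bounded_linear_transpose has_derivative_p[OF assms]])
  qed (rule has_derivative_p[OF assms])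
  moreover have "(\<lambda>u. det (p y) * trace (matrix_inv (p y) ** dp y u)) = (\<lambda>u. 0)"
  proof (rule frechet_derivative_unique_on_open[OF open_image assms])
    show "det (p z) = 1" if "z \<in> c ` U" for z
      by (rule Pos1_facts(2)[OF p_in(2)[OF that]])
    have "(det has_derivative (\<lambda>H. det (p y) * trace (matrix_inv (p y) ** H))) (at (p y))"
      by (rule has_derivative_det) (simp add: Pos1_facts(2)[OF p_in(2)[OF assms]])
    from has_derivative_compose[OF has_derivative_p[OF assms] this]
    show "((\<lambda>z. det (p z)) has_derivative (\<lambda>u. det (p y) * trace (matrix_inv (p y) ** dp y u))) (at y)" .
  qed (rule has_derivative_const)
  then have "det (p y) * trace (matrix_inv (p y) ** dp y u) = 0" by meson
  ultimately show ?thesis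
    using Pos1_facts(2)[OF p_in(2)[OF assms]] unfolding tangent_def by (auto simp: fun_eq_iff)
qed

text \<open>\<open>dr_dp\<close> makes the differential injective, and the model space has the
  dimension of the tangent space, so the inclusion is an equality. Tangent matrices can thus be
  lifted back to chart vectors.\<close>

lemma range_dp:
  assumes "y \<in> c ` U"
  shows "range (dp y) = tangent (p y)"
proof (rule subspace_dim_equal)
  show "subspace (range (dp y))"
    using linear_subspace_image[OF linear_dp[OF assms]] subspace_UNIV by blast
  have "inj (dp y)" by (rule inj_on_inverseI[of _ "dr (p y)"]) (rule dr_dp[OF assms])
  then have "dim (range (dp y)) = DIM('e)"
    using dim_image_eq[OF linear_dp[OF assms], of UNIV] by simp
  then show "dim (tangent (p y)) \<le> dim (range (dp y))"
    using dim_tangent[OF p_in(2)[OF assms]] dim_eq by simp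
qed (use subspace_tangent dp_tangent[OF assms] in auto)

lemma dp_dr:
  assumes "y \<in> c ` U" "A \<in> tangent (p y)"
  shows "dp y (dr (p y) A) = A"
proof -
  obtain u where "A = dp y u" using range_dp[OF assms(1)] assms(2) by blast
  then show ?thesis using dr_dp[OF assms(1)] by simp
qed

lemma dp_eq_iff: "y \<in> c ` U \<Longrightarrow> dp y u = dp y v \<longleftrightarrow> u = v"
  using dr_dp by metis

lemma coset_in_U_iff:
  assumes "x \<in> SL"
  shows "coset x \<in> U \<longleftrightarrow> gram x \<in> W"
proof
  assume "coset x \<in> U"
  then have "cpos (coset x) \<in> W" using cpos_image by blast
  then show "gram x \<in> W" using assms by simp
next
  assume "gram x \<in> W"
  then have "gram x \<in> cpos ` U" using cpos_image assms by (simp add: Pos1_def)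
  then obtain q where "q \<in> U" "cpos (coset x) = cpos q" using assms by (metis cpos_coset imageE)
  moreover have "coset x \<in> coset ` SL" "q \<in> coset ` SL" using assms U_subset \<open>q \<in> U\<close> by auto
  ultimately show "coset x \<in> U" using inj_onD[OF inj_on_cpos] by metis
qed

lemma c_coset:
  assumes "x \<in> SL" "gram x \<in> W"
  shows "c (coset x) = r (gram x)"
  using assms r_cpos[of "coset x"] coset_in_U_iff by simp

lemma open_gram_vimage: "open (gram -` W)"
  using open_W continuous_on_gram by (rule open_vimage)

lemma differential_c:
  assumes "x \<in> SL" "coset x \<in> U"
  shows "differential_SL (c \<circ> coset) x (\<lambda>H. dr (gram x) (x ** transpose H + H ** transpose x))"
proof -
  have W: "gram x \<in> W" using assms coset_in_U_iff by simp
  have der: "((\<lambda>x. r (gram x)) has_derivative (\<lambda>H. dr (gram x) (x ** transpose H + H ** transpose x))) (at x within SL)"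
    by (rule has_derivative_compose[OF has_derivative_gram has_derivative_r[OF W]])
  obtain d where d: "d > 0" "ball x d \<subseteq> gram -` W"
    using open_gram_vimage W open_contains_ball by blast
  show ?thesis
    unfolding differential_SL_def
    by (rule has_derivative_transform_within[OF der d(1) assms(1)])
      (use d(2) c_coset in \<open>auto simp: dist_commute subset_iff\<close>)
qed

lemma gram_derivative_tangent:
  assumes "x \<in> SL" "trace Z = 0"
  shows "x ** transpose (x ** Z) + (x ** Z) ** transpose x = x ** (Z + transpose Z) ** transpose x"
    "x ** transpose (x ** Z) + (x ** Z) ** transpose x \<in> tangent (gram x)"
proof -
  show *: "x ** transpose (x ** Z) + (x ** Z) ** transpose x = x ** (Z + transpose Z) ** transpose x"
    by (simp add: matrix_transpose_mul mm.add_left mm.add_right matrix_mul_assoc)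
  have "Z + transpose Z \<in> sym0"
    using assms(2) by (simp add: sym0_def transpose_add trace_add trace_transpose)
  then show "x ** transpose (x ** Z) + (x ** Z) ** transpose x \<in> tangent (gram x)"
    using tangent_gram_iff[OF assms(1)] * by blast
qed

text \<open>Composition with \<open>dp\<close> removes the chart: what remains is the differential
  of \<open>gram\<close>, which sees only the symmetric part of Z.\<close>

lemma dp_differential:
  assumes "x \<in> SL" "coset x \<in> U" "differential_SL (c \<circ> coset) x D" "trace Z = 0"
  shows "dp (c (coset x)) (D (x ** Z)) = x ** (Z + transpose Z) ** transpose x"
proof -
  have "x ** Z \<in> tangent_SL x" using assms(4) by (auto simp: tangent_SL_def)
  then have "D (x ** Z) = dr (gram x) (x ** transpose (x ** Z) + (x ** Z) ** transpose x)"
    using differential_SL_unique[OF assms(3) differential_c[OF assms(1,2)] assms(1)] by simp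
  then show ?thesis
    using dp_dr[of "c (coset x)"] gram_derivative_tangent[OF assms(1,4)] assms(1,2) by simp
qed

text \<open>The vertical vectors are x K with K skew, since \<open>dp\<close> of their image is x (K
  + K^t) x^t. In the trace inner product the complement of the skew matrices is formed by the
  symmetric ones.\<close>

lemma horizontal_iff:
  assumes x: "x \<in> SL" "coset x \<in> U" and D: "differential_SL (c \<circ> coset) x D"
  shows "V \<in> horizontal x D \<longleftrightarrow> (\<exists>Z\<in>sym0. V = x ** Z)"
proof -
  have y: "c (coset x) \<in> c ` U" using x by blast
  have ker: "D (x ** K) = 0 \<longleftrightarrow> K + transpose K = 0" if "trace K = 0" for K
  proof -
    have "D (x ** K) = 0 \<longleftrightarrow> dp (c (coset x)) (D (x ** K)) = 0"
      using dp_eq_iff[OF y, of _ 0] linear_0[OF linear_dp[OF y]] by metis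
    also have "\<dots> \<longleftrightarrow> x ** (K + transpose K) ** transpose x = x ** 0 ** transpose x"
      using dp_differential[OF x D that] by simp
    also have "\<dots> \<longleftrightarrow> K + transpose K = 0"
    proof
      assume eq: "x ** (K + transpose K) ** transpose x = x ** 0 ** transpose x"
      have "K + transpose K = (matrix_inv x ** x) ** (K + transpose K) ** (transpose x ** transpose (matrix_inv x))"
        using SL_matrix_inv[OF x(1)] by simp
      also have "\<dots> = matrix_inv x ** (x ** (K + transpose K) ** transpose x) ** transpose (matrix_inv x)"
        by (simp add: matrix_mul_assoc)
      also have "\<dots> = 0" unfolding eq by simp
      finally show "K + transpose K = 0" .
    qed simp
    finally show ?thesis .
  qed
  have met: "metric_SL x (x ** Z) (x ** K) = trace (Z ** transpose K)" for Z K
    using SL_matrix_inv(2)[OF x(1)] by (simp add: metric_SL_def matrix_mul_assoc)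
  show ?thesis
  proof
    assume V: "V \<in> horizontal x D"
    then obtain Z where Z: "V = x ** Z" "trace Z = 0"
      by (auto simp: horizontal_def tangent_SL_def)
    \<comment> \<open>Twice the skew part of Z serves as the test vector: orthogonality of Z to it
      makes K orthogonal to itself.\<close>
    define K where "K = Z - transpose Z"
    have "trace K = 0" "K + transpose K = 0"
      by (simp_all add: K_def trace_sub trace_transpose transpose_diff)
    then have "metric_SL x V (x ** K) = 0"
      using V ker by (auto simp: horizontal_def tangent_SL_def)
    then have "Z \<bullet> K = 0" by (simp add: Z met trace_mult_transpose)
    moreover have "transpose Z \<bullet> K = - (Z \<bullet> K)"
    proof -
      have "transpose Z \<bullet> K = Z \<bullet> transpose K"
        by (metis trace_mult_transpose trace_transpose matrix_transpose_mul transpose_transpose trace_mul_sym)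
      also have "transpose K = - K" using \<open>K + transpose K = 0\<close> by (simp add: eq_neg_iff_add_eq_0 add.commute)
      finally show ?thesis by simp
    qed
    ultimately have "K \<bullet> K = 0" by (simp add: K_def inner_diff_left)
    then have "transpose Z = Z" by (simp add: K_def)
    then show "\<exists>Z\<in>sym0. V = x ** Z" using Z by (auto simp: sym0_def)
  next
    assume "\<exists>Z\<in>sym0. V = x ** Z"
    then obtain Z where Z: "transpose Z = Z" "trace Z = 0" "V = x ** Z" by (auto simp: sym0_def)
    have "metric_SL x V (x ** K) = 0" if "trace K = 0" "D (x ** K) = 0" for K
    proof -
      have K: "transpose K = - K"
        using ker[OF that(1)] that(2) by (simp add: eq_neg_iff_add_eq_0 add.commute)
      have "trace (Z ** K) = trace (transpose (Z ** K))" by (simp add: trace_transpose)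
      also have "\<dots> = trace (transpose K ** Z)" using Z(1) by (simp add: matrix_transpose_mul)
      also have "\<dots> = - trace (Z ** K)"
        using trace_mul_sym[of K Z] by (simp add: K mm.minus_left)
      finally have "trace (Z ** K) = 0" by simp
      then show ?thesis
        by (simp add: Z(3) met K mm.minus_right)
    qed
    then show "V \<in> horizontal x D"
      using Z(2,3) by (auto simp: horizontal_def tangent_SL_def)
  qed
qed

lemma horizontal_lift:
  assumes x: "x \<in> SL" "coset x \<in> U" and D: "differential_SL (c \<circ> coset) x D"
  shows "\<exists>V\<in>horizontal x D. D V = w"
proof -
  have y: "c (coset x) \<in> c ` U" using x by blast
  have "dp (c (coset x)) w \<in> tangent (gram x)" using dp_tangent[OF y] x by simp
  then obtain Z where Z: "Z \<in> sym0" "dp (c (coset x)) w = x ** Z ** transpose x"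
    using tangent_gram_iff[OF x(1)] by blast
  \<comment> \<open>Half of Z, because the differential of \<open>gram\<close> turns x Y with Y
    symmetric into 2 x Y x^t.\<close>
  define Y where "Y = (1/2) *\<^sub>R Z"
  have Y: "Y \<in> sym0" using Z(1) subspace_scale[OF subspace_sym0] by (simp add: Y_def)
  have "dp (c (coset x)) (D (x ** Y)) = x ** (Y + Y) ** transpose x"
    using dp_differential[OF x D, of Y] Y by (simp add: sym0_def)
  also have "Y + Y = Z" by (simp add: Y_def scaleR_2[symmetric])
  finally have "dp (c (coset x)) (D (x ** Y)) = dp (c (coset x)) w" using Z(2) by simp
  then have "D (x ** Y) = w" using dp_eq_iff[OF y] by blast
  moreover have "x ** Y \<in> horizontal x D" using horizontal_iff[OF x D] Y by blast
  ultimately show ?thesis by blast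
qed

text \<open>Every admissible choice of x in the fibre, of D and of the lifts gives the same number,
  so the definite description is well defined. The two doublings by \<open>gram\<close> cancel the
  quarter in \<open>trace_form\<close>.\<close>

lemma quotient_metric_eq:
  assumes "y \<in> c ` U"
  shows "quotient_metric (U, c) y u v = trace_form (p y) (dp y u) (dp y v)"
proof -
  have key: "metric_SL x V W = trace_form (p y) (dp y u) (dp y v)"
    if x: "x \<in> SL" "coset x \<in> U" "c (coset x) = y" and D: "differential_SL (c \<circ> coset) x D"
      and V: "V \<in> horizontal x D" "D V = u" and W: "W \<in> horizontal x D" "D W = v" for x D V W
  proof -
    obtain Z where Z: "Z \<in> sym0" "V = x ** Z" using V(1) horizontal_iff[OF x(1,2) D] by blast
    obtain Y where Y: "Y \<in> sym0" "W = x ** Y" using W(1) horizontal_iff[OF x(1,2) D] by blast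
    have d: "dp y u = x ** (2 *\<^sub>R Z) ** transpose x" "dp y v = x ** (2 *\<^sub>R Y) ** transpose x"
      using dp_differential[OF x(1,2) D, of Z] dp_differential[OF x(1,2) D, of Y] Z Y V(2) W(2) x(3)
      by (simp_all add: sym0_def scaleR_2)
    have "p y = gram x" using x by auto
    then have "trace_form (p y) (dp y u) (dp y v) = trace ((2 *\<^sub>R Z) ** (2 *\<^sub>R Y)) / 4"
      by (simp only: d trace_form_gram[OF x(1)])
    also have "\<dots> = trace (Z ** Y)"
      by (simp add: mm.scaleR_left mm.scaleR_right trace_scaleR)
    also have "\<dots> = metric_SL x V W"
      using SL_matrix_inv(2)[OF x(1)] Y(1) by (simp add: Z Y metric_SL_def matrix_mul_assoc sym0_def)
    finally show ?thesis by simp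
  qed
  obtain x where x: "x \<in> SL" "coset x \<in> U" "c (coset x) = y" using assms U_subset by blast
  define D where "D = (\<lambda>H. dr (gram x) (x ** transpose H + H ** transpose x))"
  have D: "differential_SL (c \<circ> coset) x D" unfolding D_def by (rule differential_c[OF x(1,2)])
  obtain V X where V: "V \<in> horizontal x D" "D V = u" and X: "X \<in> horizontal x D" "D X = v"
    using horizontal_lift[OF x(1,2) D] by meson
  show ?thesis
    unfolding quotient_metric_def prod.case
  proof (rule the_equality)
    show "\<exists>x\<in>SL. \<exists>D. \<exists>V\<in>horizontal x D. \<exists>W\<in>horizontal x D.
        coset x \<in> U \<and> c (coset x) = y \<and> differential_SL (c \<circ> coset) x D \<and>
        D V = u \<and> D W = v \<and> trace_form (p y) (dp y u) (dp y v) = metric_SL x V W"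
      using x D V X key[OF x D V X] by metis
  next
    fix s assume "\<exists>x\<in>SL. \<exists>D. \<exists>V\<in>horizontal x D. \<exists>W\<in>horizontal x D.
        coset x \<in> U \<and> c (coset x) = y \<and> differential_SL (c \<circ> coset) x D \<and>
        D V = u \<and> D W = v \<and> s = metric_SL x V W"
    then show "s = trace_form (p y) (dp y u) (dp y v)" using key by blast
  qed
qed

text \<open>Converse of \<open>chart_paramI\<close>; it puts the explicitly constructed charts into
  the maximal atlas.\<close>

lemma in_quotient_charts: "(U, c) \<in> quotient_charts"
  unfolding quotient_charts_def
proof (clarify, intro conjI ballI impI)
  have eq: "{x \<in> SL. coset x \<in> U} = SL \<inter> gram -` W" using coset_in_U_iff by auto
  show "U \<subseteq> coset ` SL" "inj_on c U" "open (c ` U)" by (fact U_subset inj_c open_image)+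
  show "openin (top_of_set SL) {x \<in> SL. coset x \<in> U}"
    unfolding eq using open_gram_vimage by (rule openin_open_Int)
  show "smooth_on_subset {x \<in> SL. coset x \<in> U} (c \<circ> coset)"
    unfolding smooth_on_subset_def eq
  proof (intro ballI exI conjI)
    show "smooth_on (gram -` W) (\<lambda>x. r (gram x))"
      by (rule smooth_on_compose[OF open_gram_vimage open_W _ smooth_on_gram[OF open_gram_vimage] smooth_r]) auto
  qed (auto simp: open_gram_vimage c_coset)
  show "\<exists>D. differential_SL (c \<circ> coset) x D \<and> D ` tangent_SL x = UNIV"
    if x: "x \<in> SL" "coset x \<in> U" for x
  proof (intro exI conjI)
    show D: "differential_SL (c \<circ> coset) x (\<lambda>H. dr (gram x) (x ** transpose H + H ** transpose x))"
      (is "differential_SL _ _ ?D")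
      by (rule differential_c[OF x])
    have "u \<in> ?D ` tangent_SL x" for u
      using horizontal_lift[OF x D, of u] unfolding horizontal_def by blast
    then show "?D ` tangent_SL x = UNIV" by blast
  qed
qed

end

section \<open>The base chart and local sections\<close>

lemma Pos1_trace_pos: "P \<in> Pos1 \<Longrightarrow> 0 < trace P" for P :: "real^'n^'n"
  using SL_trace_gram_pos by (auto simp: Pos1_def)

text \<open>The model space is an arbitrary Euclidean space of the right dimension; a linear
  identification with \<open>sym0\<close> is fixed in order to write down one global chart.\<close>

locale sym0_iso =
  fixes iota :: "real^'n^'n \<Rightarrow> 'e::euclidean_space" and kappa :: "'e \<Rightarrow> real^'n^'n"
  assumes linear_iota: "linear iota" and linear_kappa: "linear kappa"
    and kappa_sym0: "kappa v \<in> sym0" and iota_kappa [simp]: "iota (kappa v) = v"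
    and kappa_iota: "A \<in> sym0 \<Longrightarrow> kappa (iota A) = A"
begin

lemma dim_eq: "DIM('e) = dim (sym0 :: (real^'n^'n) set)"
proof -
  have "inj kappa" by (rule inj_on_inverseI[of _ iota]) simp
  then have "dim (range kappa) = DIM('e)" using dim_image_eq[OF linear_kappa, of UNIV] by simp
  moreover have "range kappa = sym0" using kappa_sym0 kappa_iota by (auto simp: image_iff) metis
  ultimately show ?thesis by simp
qed

definition unit_trace :: "real^'n^'n" where
  "unit_trace = (1 / real CARD('n)) *\<^sub>R mat 1"

definition rbase :: "real^'n^'n \<Rightarrow> 'e" where
  "rbase P = iota ((1 / trace P) *\<^sub>R P - unit_trace)"

definition qbase :: "'e \<Rightarrow> real^'n^'n" where
  "qbase y = kappa y + unit_trace"

text \<open>Inverse of the chart: the trace-one matrix is rescaled to determinant 1, with exponent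
  -1/n because the determinant is homogeneous of degree n.\<close>

definition pbase :: "'e \<Rightarrow> real^'n^'n" where
  "pbase y = (det (qbase y) powr (- 1 / real CARD('n))) *\<^sub>R qbase y"

text \<open>An open domain on which \<open>pbase\<close> is smooth. A positive determinant does not
  force positive definiteness, so the image of the chart may be smaller; its openness is a separate
  matter.\<close>

definition det_pos :: "'e set" where
  "det_pos = {y. 0 < det (qbase y)}"

lemma trace_unit_trace: "trace unit_trace = 1"
  by (simp add: unit_trace_def trace_scaleR trace_I)

lemma transpose_unit_trace: "transpose unit_trace = unit_trace"
  by (simp add: unit_trace_def transpose_scalar)

lemma trace_qbase: "trace (qbase y) = 1"
  using kappa_sym0[of y] by (simp add: qbase_def trace_add trace_unit_trace sym0_def)

lemma transpose_qbase: "transpose (qbase y) = qbase y"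
  using kappa_sym0[of y] by (simp add: qbase_def transpose_add transpose_unit_trace sym0_def)

lemma transpose_pbase: "transpose (pbase y) = pbase y"
  by (simp add: pbase_def transpose_scalar transpose_qbase)

lemma qbase_rbase:
  assumes "P \<in> Pos1"
  shows "qbase (rbase P) = (1 / trace P) *\<^sub>R P"
proof -
  have "(1 / trace P) *\<^sub>R P - unit_trace \<in> sym0"
    using Pos1_trace_pos[OF assms] assms
    by (auto simp: sym0_def trace_sub trace_scaleR trace_unit_trace transpose_diff transpose_scalar
        transpose_unit_trace Pos1_def)
  then show ?thesis by (simp add: qbase_def rbase_def kappa_iota)
qed

lemma det_qbase_rbase:
  assumes "P \<in> Pos1"
  shows "det (qbase (rbase P)) = (1 / trace P) ^ CARD('n)"
  using assms by (auto simp: qbase_rbase det_scaleR Pos1_def det_gram SL_def)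

lemma rbase_det_pos: "P \<in> Pos1 \<Longrightarrow> rbase P \<in> det_pos"
  using Pos1_trace_pos[of P] by (simp add: det_pos_def det_qbase_rbase)

lemma power_powr_inverse:
  assumes "0 < t"
  shows "(t ^ CARD('n)) powr (- 1 / real CARD('n)) = 1 / t"
proof -
  have "(t ^ CARD('n)) powr (- 1 / real CARD('n)) = t powr (real CARD('n) * (- 1 / real CARD('n)))"
    using assms by (simp add: powr_powr powr_realpow[symmetric])
  also have "\<dots> = t powr (- 1)" by simp
  also have "\<dots> = 1 / t" using assms by (simp add: powr_minus_divide)
  finally show ?thesis .
qed

lemma pbase_rbase:
  assumes "P \<in> Pos1"
  shows "pbase (rbase P) = P"
  using Pos1_trace_pos[OF assms] power_powr_inverse[of "1 / trace P"]
  by (simp add: pbase_def det_qbase_rbase[OF assms]) (simp add: qbase_rbase[OF assms])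

lemma rbase_pbase:
  assumes "0 < det (qbase y)"
  shows "rbase (pbase y) = y"
proof -
  have "(1 / trace (pbase y)) *\<^sub>R pbase y = qbase y"
    using assms by (simp add: pbase_def trace_scaleR trace_qbase)
  then show ?thesis by (simp add: rbase_def) (simp add: qbase_def)
qed

lemma det_pbase:
  assumes "0 < det (qbase y)"
  shows "det (pbase y) = 1"
proof -
  have "det (pbase y) = (det (qbase y) powr (- 1 / real CARD('n))) ^ CARD('n) * det (qbase y)"
    by (simp add: pbase_def det_scaleR)
  also have "(det (qbase y) powr (- 1 / real CARD('n))) ^ CARD('n) =
      det (qbase y) powr (- 1 / real CARD('n) * real CARD('n))"
    using assms by (simp add: powr_realpow[symmetric] powr_powr)
  also have "\<dots> = 1 / det (qbase y)" using assms by (simp add: powr_minus_divide)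
  finally show ?thesis using assms by simp
qed

lemma smooth_on_qbase: "open S \<Longrightarrow> smooth_on S qbase"
  unfolding qbase_def[abs_def]
  using linear_kappa by (intro smooth_on_add smooth_on_bounded_linear smooth_on_const)
    (simp_all add: linear_conv_bounded_linear)

lemma smooth_on_det_qbase: "open S \<Longrightarrow> smooth_on S (\<lambda>y. det (qbase y))"
  by (rule smooth_on_compose[OF _ open_UNIV _ smooth_on_qbase smooth_on_det]) auto

lemma open_det_pos: "open det_pos"
proof -
  have "det_pos = (\<lambda>y. det (qbase y)) -` {0<..}" by (auto simp: det_pos_def)
  then show ?thesis
    using open_vimage[OF open_greaterThan smooth_on_continuous_on[OF smooth_on_det_qbase[OF open_UNIV]]]
    by simp
qed

lemma smooth_on_pbase: "smooth_on det_pos pbase"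
  unfolding pbase_def[abs_def]
  by (intro smooth_on_bilinear[OF bounded_bilinear_scaleR] smooth_on_powr smooth_on_det_qbase
      smooth_on_qbase open_det_pos) (simp add: det_pos_def)

lemma open_trace_pos: "open {P :: real^'n^'n. 0 < trace P}"
proof -
  have "{P :: real^'n^'n. 0 < trace P} = trace -` {0<..}" by auto
  then show ?thesis
    using open_vimage[OF open_greaterThan linear_continuous_on[OF bounded_linear_trace]] by simp
qed

lemma smooth_on_rbase: "smooth_on {P. 0 < trace P} rbase"
proof -
  have "smooth_on {P :: real^'n^'n. 0 < trace P} (\<lambda>P. iota (trace P powr (- 1) *\<^sub>R P - unit_trace))"
    using linear_iota
    by (intro smooth_on_bounded_linear_compose[where L = iota] smooth_on_diff smooth_on_const
        smooth_on_bilinear[OF bounded_bilinear_scaleR] smooth_on_powr smooth_on_bounded_linear[OF bounded_linear_trace]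
        open_trace_pos smooth_on_ident) (simp_all add: linear_conv_bounded_linear)
  then show ?thesis
    by (rule smooth_on_cong_imp[OF open_trace_pos, rotated]) (simp add: rbase_def powr_minus_divide)
qed

text \<open>The section is x0 G (x0^-1 P x0^-t) with G the local square root and P =
  \<open>pbase y\<close>. Its Gram matrix is P because G of a symmetric matrix is symmetric. In
  particular \<open>pbase y\<close> lies in \<open>Pos1\<close> for y near the base point.\<close>

lemma local_section:
  assumes x0: "x0 \<in> SL"
  obtains S \<sigma> where "open S" "rbase (gram x0) \<in> S" "smooth_on S \<sigma>" "\<sigma> (rbase (gram x0)) = x0"
    "\<And>y. y \<in> S \<Longrightarrow> \<sigma> y \<in> SL" "\<And>y. y \<in> S \<Longrightarrow> y \<in> det_pos" "\<And>y. y \<in> S \<Longrightarrow> gram (\<sigma> y) = pbase y"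
proof -
  obtain R and G :: "real^'n^'n \<Rightarrow> real^'n^'n" where G: "open R" "mat 1 \<in> R" "smooth_on R G" "G (mat 1) = mat 1"
    "\<And>A. A \<in> R \<Longrightarrow> G A ** G A = A" "\<And>A. A \<in> R \<Longrightarrow> transpose A = A \<Longrightarrow> transpose (G A) = G A"
    using local_matrix_sqrt by blast
  define z where "z = matrix_inv x0"
  define F where "F = (\<lambda>y. z ** pbase y ** transpose z)"
  define S1 where "S1 = det_pos \<inter> F -` R"
  define \<sigma> where "\<sigma> = (\<lambda>y. x0 ** G (F y))"
  \<comment> \<open>The Gram identity yields only that the determinant squares to 1; the restriction
    to positive determinants selects the value 1.\<close>
  define S where "S = S1 \<inter> (\<lambda>y. det (\<sigma> y)) -` {0<..}"
  define y0 where "y0 = rbase (gram x0)"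
  have P0: "gram x0 \<in> Pos1" using x0 by (simp add: Pos1_def)
  have F: "smooth_on det_pos F"
    unfolding F_def
    by (intro smooth_on_bounded_linear_compose[OF mm.bounded_linear_left]
        smooth_on_bounded_linear_compose[OF mm.bounded_linear_right] smooth_on_pbase open_det_pos)
  have S1: "open S1"
    unfolding S1_def using smooth_on_continuous_on[OF F] open_det_pos G(1)
    by (simp add: continuous_open_preimage)
  have \<sigma>: "smooth_on S1 \<sigma>"
    unfolding \<sigma>_def
    by (intro smooth_on_bounded_linear_compose[OF mm.bounded_linear_right S1]
        smooth_on_compose[OF S1 G(1) _ smooth_on_subset[OF F] G(3)]) (auto simp: S1_def)
  have "smooth_on S1 (\<lambda>y. det (\<sigma> y))"
    by (rule smooth_on_compose[OF S1 open_UNIV _ \<sigma> smooth_on_det]) auto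
  then have S: "open S"
    unfolding S_def using S1 smooth_on_continuous_on continuous_open_preimage open_greaterThan by blast
  have "F y0 = (z ** x0) ** (transpose x0 ** transpose z)"
    by (simp add: F_def y0_def pbase_rbase[OF P0]) (simp add: gram_def matrix_mul_assoc)
  then have F0: "F y0 = mat 1" using SL_matrix_inv[OF x0] by (simp add: z_def)
  then have \<sigma>0: "\<sigma> y0 = x0" by (simp add: \<sigma>_def G(4))
  have y0: "y0 \<in> det_pos"
    unfolding y0_def by (rule rbase_det_pos[OF P0])
  have gram: "gram (\<sigma> y) = pbase y" if "y \<in> S1" for y
  proof -
    have sym: "transpose (F y) = F y"
      by (simp add: F_def matrix_transpose_mul transpose_pbase matrix_mul_assoc)
    have FR: "F y \<in> R" using that by (simp add: S1_def)
    have "gram (\<sigma> y) = x0 ** (G (F y) ** transpose (G (F y))) ** transpose x0"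
      by (simp add: gram_def \<sigma>_def matrix_transpose_mul matrix_mul_assoc)
    also have "\<dots> = x0 ** F y ** transpose x0" using G(5,6)[OF FR] sym by simp
    also have "\<dots> = (x0 ** z) ** pbase y ** (transpose z ** transpose x0)"
      by (simp add: F_def matrix_mul_assoc)
    also have "\<dots> = pbase y" using SL_matrix_inv[OF x0] by (simp add: z_def)
    finally show ?thesis .
  qed
  show ?thesis
  proof (rule that[OF S])
    show "rbase (gram x0) \<in> S"
      using y0 F0 G(2) \<sigma>0 x0 unfolding y0_def[symmetric] by (simp add: S_def S1_def SL_def)
    show "smooth_on S \<sigma>" using \<sigma> by (rule smooth_on_subset) (auto simp: S_def)
    show "\<sigma> (rbase (gram x0)) = x0" using \<sigma>0 by (simp add: y0_def)
    fix y assume y: "y \<in> S"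
    then have y1: "y \<in> S1" "0 < det (\<sigma> y)" by (auto simp: S_def)
    then show "y \<in> det_pos" by (simp add: S1_def)
    then have "(det (\<sigma> y))\<^sup>2 = 1" using gram[OF y1(1)] det_pbase det_gram by (metis det_pos_def mem_Collect_eq)
    then show "\<sigma> y \<in> SL" using y1(2) by (simp add: SL_def power2_eq_1_iff)
    show "gram (\<sigma> y) = pbase y" by (rule gram[OF y1(1)])
  qed
qed

lemma rbase_eq_iff: "P \<in> Pos1 \<Longrightarrow> Q \<in> Pos1 \<Longrightarrow> rbase P = rbase Q \<longleftrightarrow> P = Q"
  using pbase_rbase by metis

text \<open>The atlas controls \<open>c \<circ> coset\<close> on SL only. Composition with a local
  section turns it into a smooth map h from base coordinates to chart coordinates; the submersion
  condition makes the derivative of h surjective, and the inverse function theorem gives a smooth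
  inverse.\<close>

lemma chart_paramI:
  assumes "(U, c) \<in> (quotient_charts :: ((real^'n^'n) set, 'e) chart set)"
  shows "\<exists>W r. chart_param U c W r"
proof -
  have U: "U \<subseteq> coset ` SL" and opn: "openin (top_of_set SL) {x \<in> SL. coset x \<in> U}"
    and inj: "inj_on c U" and open_cU: "open (c ` U)"
    and ext: "smooth_on_subset {x \<in> SL. coset x \<in> U} (c \<circ> coset)"
    and sub: "\<And>x. x \<in> SL \<Longrightarrow> coset x \<in> U \<Longrightarrow>
        \<exists>D. differential_SL (c \<circ> coset) x D \<and> D ` tangent_SL x = UNIV"
    using assms unfolding quotient_charts_def by auto
  obtain T where T: "open T" "{x \<in> SL. coset x \<in> U} = SL \<inter> T"
    using opn by (auto simp: openin_open)
  \<comment> \<open>The choice of representative is harmless: equal base coordinates mean equal Gram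
    matrices and hence equal cosets.\<close>
  define h where "h = (\<lambda>y. c (coset (SOME x. x \<in> SL \<and> rbase (gram x) = y)))"
  define A where "A = (\<lambda>x. rbase (gram x)) ` {x \<in> SL. coset x \<in> U}"
  have gP: "gram x \<in> Pos1" if "x \<in> SL" for x using that by (simp add: Pos1_def)
  have h: "h (rbase (gram x)) = c (coset x)" if x: "x \<in> SL" for x
  proof -
    define w where "w = (SOME z. z \<in> SL \<and> rbase (gram z) = rbase (gram x))"
    have w: "w \<in> SL \<and> rbase (gram w) = rbase (gram x)"
      unfolding w_def by (rule someI_ex) (use x in blast)
    then have "gram w = gram x" using rbase_eq_iff[OF gP gP[OF x]] by blast
    then have "coset w = coset x" using coset_eq_iff[OF _ x] w by blast
    then show ?thesis by (simp add: h_def w_def)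
  qed
  have local: "\<exists>S. open S \<and> y \<in> S \<and> S \<subseteq> A \<and> smooth_on S h" if y: "y \<in> A" for y
  proof -
    obtain x0 where x0: "x0 \<in> SL" "coset x0 \<in> U" "y = rbase (gram x0)"
      using y unfolding A_def by blast
    obtain S \<sigma> where S: "open S" "y \<in> S" "smooth_on S \<sigma>" "\<sigma> y = x0"
      "\<And>y. y \<in> S \<Longrightarrow> \<sigma> y \<in> SL" "\<And>y. y \<in> S \<Longrightarrow> y \<in> det_pos" "\<And>y. y \<in> S \<Longrightarrow> gram (\<sigma> y) = pbase y"
      using local_section[OF x0(1)] unfolding x0(3) by blast
    have "x0 \<in> {x \<in> SL. coset x \<in> U}" using x0 by simp
    then obtain V F where V: "open V" "x0 \<in> V" "smooth_on V F"
      and F: "\<forall>x\<in>V \<inter> {x \<in> SL. coset x \<in> U}. F x = (c \<circ> coset) x"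
      using ext unfolding smooth_on_subset_def by meson
    \<comment> \<open>Restricts the section to arguments where it lies over U and where the
      extension F of \<open>c \<circ> coset\<close> is available.\<close>
    define S' where "S' = S \<inter> \<sigma> -` (T \<inter> V)"
    have S': "open S'"
      unfolding S'_def using smooth_on_continuous_on[OF S(3)] S(1) T(1) V(1)
      by (intro continuous_open_preimage open_Int)
    have "x0 \<in> T" using x0 T(2) by blast
    then have "y \<in> S'" using S(2,4) V(2) by (simp add: S'_def)
    have \<sigma>U: "coset (\<sigma> z) \<in> U" if "z \<in> S'" for z
    proof -
      have "\<sigma> z \<in> SL \<inter> T" using that S(5) by (simp add: S'_def)
      then show ?thesis unfolding T(2)[symmetric] by simp
    qed
    have rz: "rbase (gram (\<sigma> z)) = z" if "z \<in> S'" for z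
      using that S(6,7) rbase_pbase by (simp add: S'_def det_pos_def)
    have "S' \<subseteq> A"
    proof
      fix z assume z: "z \<in> S'"
      then have "\<sigma> z \<in> SL" using S(5) by (simp add: S'_def)
      then show "z \<in> A" unfolding A_def using rz[OF z] \<sigma>U[OF z] by (intro image_eqI[of _ _ "\<sigma> z"]) auto
    qed
    moreover have "smooth_on S' (\<lambda>z. F (\<sigma> z))"
      by (rule smooth_on_compose[OF S' V(1) _ smooth_on_subset[OF S(3)] V(3)]) (auto simp: S'_def)
    then have "smooth_on S' h"
    proof (rule smooth_on_cong_imp[OF S', rotated])
      fix z assume z: "z \<in> S'"
      then have "F (\<sigma> z) = c (coset (\<sigma> z))" using F S(5) \<sigma>U[OF z] by (simp add: S'_def)
      also have "\<dots> = h z" using h[OF S(5), of z] rz[OF z] z by (simp add: S'_def)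
      finally show "F (\<sigma> z) = h z" .
    qed
    ultimately show ?thesis using S' \<open>y \<in> S'\<close> by blast
  qed
  have openA: "open A" using local open_subopen by meson
  have sm: "smooth_on A h" using local by (intro smooth_on_local) blast
  have inj_h: "inj_on h A"
  proof (rule inj_onI)
    fix y z assume "y \<in> A" "z \<in> A" and eq: "h y = h z"
    then obtain x w where x: "x \<in> SL" "coset x \<in> U" "y = rbase (gram x)"
      and w: "w \<in> SL" "coset w \<in> U" "z = rbase (gram w)" unfolding A_def by blast
    then have "coset x = coset w" using eq h inj_onD[OF inj] by metis
    then show "y = z" using x w coset_eq_iff by metis
  qed
  have hA: "h ` A = c ` U"
  proof -
    have "h ` A = (\<lambda>x. c (coset x)) ` {x \<in> SL. coset x \<in> U}"
      unfolding A_def image_image using h by (intro image_cong) auto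
    also have "\<dots> = c ` U" using U by auto
    finally show ?thesis .
  qed
  \<comment> \<open>On tangent vectors of SL the differential D factors through the derivative of h,
    by uniqueness; surjectivity of D then forces surjectivity of that derivative.\<close>
  have surj: "surj (frechet_derivative h (at y))" if y: "y \<in> A" for y
  proof -
    obtain x where x: "x \<in> SL" "coset x \<in> U" "y = rbase (gram x)"
      using y unfolding A_def by blast
    obtain D where D: "differential_SL (c \<circ> coset) x D" "D ` tangent_SL x = UNIV"
      using sub[OF x(1,2)] by blast
    have "(rbase has_derivative frechet_derivative rbase (at (gram x))) (at (gram x))"
      using smooth_on_has_derivative[OF smooth_on_rbase] SL_trace_gram_pos[OF x(1)] by simp
    from has_derivative_compose[OF has_derivative_gram this]
    obtain E where "((\<lambda>x. rbase (gram x)) has_derivative E) (at x within SL)" by blast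
    moreover have "(h has_derivative frechet_derivative h (at y)) (at (rbase (gram x)))"
      using smooth_on_has_derivative[OF sm y] by (simp add: x(3))
    ultimately have E: "((\<lambda>x. h (rbase (gram x))) has_derivative (\<lambda>H. frechet_derivative h (at y) (E H))) (at x within SL)"
      by (rule has_derivative_compose)
    have "differential_SL (c \<circ> coset) x (\<lambda>H. frechet_derivative h (at y) (E H))"
      unfolding differential_SL_def
      by (rule has_derivative_transform[OF x(1) _ E]) (simp add: h)
    then have "D H = frechet_derivative h (at y) (E H)" if "H \<in> tangent_SL x" for H
      using differential_SL_unique[OF D(1) _ x(1) that] by blast
    then have "D ` tangent_SL x \<subseteq> range (frechet_derivative h (at y))" by auto
    then show ?thesis using D(2) by blast
  qed
  define g where "g = inv_into A h"
  have g: "g (h y) = y" if "y \<in> A" for y using that inj_h by (simp add: g_def)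
  have smg: "smooth_on (c ` U) g"
    using smooth_on_inverse_function(2)[OF openA sm g surj] by (simp add: hA)
  define W where "W = {P. 0 < trace P} \<inter> rbase -` A"
  have "chart_param U c W (\<lambda>P. h (rbase P))"
  proof
    show "DIM('e) = dim (sym0 :: (real^'n^'n) set)" by (rule dim_eq)
    show "U \<subseteq> coset ` SL" "inj_on c U" "open (c ` U)" by fact+
    have sub': "g ` (c ` U) \<subseteq> det_pos"
    proof -
      have "g ` (c ` U) = A" unfolding hA[symmetric] using g by (force simp: image_image)
      also have "\<dots> \<subseteq> det_pos"
        using rbase_det_pos gP by (auto simp: A_def)
      finally show ?thesis .
    qed
    have "smooth_on (c ` U) (\<lambda>y. pbase (g y))"
      by (rule smooth_on_compose[OF open_cU open_det_pos sub' smg smooth_on_pbase])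
    then show "smooth_on (c ` U) (cpos \<circ> inv_into U c)"
    proof (rule smooth_on_cong_imp[OF open_cU, rotated])
      fix y assume "y \<in> c ` U"
      then obtain x where x: "x \<in> SL" "coset x \<in> U" "y = c (coset x)" using U by blast
      then have "g y = rbase (gram x)" using g[of "rbase (gram x)"] h by (auto simp: A_def)
      then show "pbase (g y) = (cpos \<circ> inv_into U c) y"
        using x inj pbase_rbase[OF gP] by simp
    qed
    show "open W"
      unfolding W_def using open_trace_pos smooth_on_continuous_on[OF smooth_on_rbase] openA
      by (simp add: continuous_open_preimage)
    show "smooth_on W (\<lambda>P. h (rbase P))"
      by (rule smooth_on_compose[OF \<open>open W\<close> openA _ smooth_on_subset[OF smooth_on_rbase] sm])
        (auto simp: W_def)
    show "cpos ` U = W \<inter> Pos1"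
    proof (intro equalityI subsetI)
      fix P assume "P \<in> cpos ` U"
      then obtain x where "x \<in> SL" "coset x \<in> U" "P = gram x" using U by force
      then show "P \<in> W \<inter> Pos1" using SL_trace_gram_pos gP by (auto simp: W_def A_def)
    next
      fix P assume P: "P \<in> W \<inter> Pos1"
      then obtain x where x: "x \<in> SL" "coset x \<in> U" "rbase P = rbase (gram x)" by (auto simp: W_def A_def)
      then have "P = cpos (coset x)" using rbase_eq_iff[of P "gram x"] P gP[OF x(1)] by simp
      then show "P \<in> cpos ` U" using x by blast
    qed
    show "h (rbase (cpos q)) = c q" if q: "q \<in> U" for q
    proof -
      obtain x where "x \<in> SL" "q = coset x" using U q by blast
      then show ?thesis using h by simp
    qed
  qed
  then show ?thesis by blast
qed

text \<open>The shift by v moves a chosen point to the origin, as slice charts are cut out by linear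
  and not affine subspaces.\<close>

definition cbase :: "'e \<Rightarrow> (real^'n^'n) set \<Rightarrow> 'e" where
  "cbase v q = rbase (cpos q) - v"

lemma chart_param_base: "chart_param (coset ` SL) (cbase v) {P. 0 < trace P} (\<lambda>P. rbase P - v)"
proof
  show "DIM('e) = dim (sym0 :: (real^'n^'n) set)" by (rule dim_eq)
  show inj: "inj_on (cbase v) (coset ` SL)"
  proof (rule inj_onI)
    fix q q' :: "(real^'n^'n) set"
    assume q: "q \<in> coset ` SL" "q' \<in> coset ` SL" "cbase v q = cbase v q'"
    then have "cpos q = cpos q'"
      using rbase_eq_iff[OF cpos_in_Pos1 cpos_in_Pos1] by (simp add: cbase_def)
    then show "q = q'" using q(1,2) inj_onD[OF inj_on_cpos] by blast
  qed
  have image: "cbase v ` (coset ` SL) = (\<lambda>y. y - v) ` rbase ` Pos1"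
    by (auto simp: cbase_def Pos1_def image_image)
  \<comment> \<open>A local section through each point shows that all nearby coordinates come from
    matrices in \<open>Pos1\<close>.\<close>
  have "open (rbase ` Pos1)"
  proof (subst open_subopen, intro ballI)
    fix y assume "y \<in> rbase ` Pos1"
    then obtain x0 where x0: "x0 \<in> SL" "y = rbase (gram x0)" by (auto simp: Pos1_def)
    obtain S \<sigma> where S: "open S" "y \<in> S" "\<And>y. y \<in> S \<Longrightarrow> \<sigma> y \<in> SL"
      "\<And>y. y \<in> S \<Longrightarrow> y \<in> det_pos" "\<And>y. y \<in> S \<Longrightarrow> gram (\<sigma> y) = pbase y"
      using local_section[OF x0(1)] unfolding x0(2) by metis
    have "S \<subseteq> rbase ` Pos1"
    proof
      fix z assume "z \<in> S"
      then have "z = rbase (gram (\<sigma> z))" "\<sigma> z \<in> SL"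
        using S rbase_pbase by (auto simp: det_pos_def)
      then show "z \<in> rbase ` Pos1" unfolding Pos1_def by blast
    qed
    then show "\<exists>S. open S \<and> y \<in> S \<and> S \<subseteq> rbase ` Pos1" using S(1,2) by blast
  qed
  then show op: "open (cbase v ` (coset ` SL))"
    unfolding image using open_translation_subtract[of "rbase ` Pos1" v] by simp
  have plus: "(\<lambda>y. y + v) ` (cbase v ` (coset ` SL)) \<subseteq> det_pos"
  proof -
    have "(\<lambda>y. y + v) ` (cbase v ` (coset ` SL)) = rbase ` Pos1"
      unfolding image by (simp add: image_image)
    then show ?thesis using rbase_det_pos by auto
  qed
  have "smooth_on (cbase v ` (coset ` SL)) (\<lambda>y. pbase (y + v))"
    by (rule smooth_on_compose[OF op open_det_pos plus _ smooth_on_pbase])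
      (intro smooth_on_add op smooth_on_ident smooth_on_const)
  then show "smooth_on (cbase v ` (coset ` SL)) (cpos \<circ> inv_into (coset ` SL) (cbase v))"
  proof (rule smooth_on_cong_imp[OF op, rotated])
    fix y assume "y \<in> cbase v ` (coset ` SL)"
    then obtain q where q: "q \<in> coset ` SL" "y = cbase v q" by blast
    then show "pbase (y + v) = (cpos \<circ> inv_into (coset ` SL) (cbase v)) y"
      using inv_into_f_f[OF inj q(1)] pbase_rbase[OF cpos_in_Pos1[OF q(1)]] by (simp add: cbase_def)
  qed
  show "smooth_on {P :: real^'n^'n. 0 < trace P} (\<lambda>P. rbase P - v)"
    by (intro smooth_on_diff open_trace_pos smooth_on_rbase smooth_on_const)
  show "cpos ` (coset ` SL) = {P :: real^'n^'n. 0 < trace P} \<inter> Pos1"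
    using SL_trace_gram_pos by (auto simp: Pos1_def image_image)
qed (auto simp: open_trace_pos cbase_def)

end

section \<open>The Riemannian manifold\<close>

lemma bilinear_trace_form: "bilinear (trace_form P)"
proof -
  have 1: "linear (\<lambda>A. trace ((matrix_inv P ** A) ** B) / 4)" for B
    by (intro bounded_linear.linear bounded_linear_compose[OF bounded_linear_divide]
        bounded_linear_compose[OF bounded_linear_trace] bounded_linear_compose[OF mm.bounded_linear_left]
        mm.bounded_linear_right)
  have 2: "linear (\<lambda>B. trace (A ** (matrix_inv P ** B)) / 4)" for A
    by (intro bounded_linear.linear bounded_linear_compose[OF bounded_linear_divide]
        bounded_linear_compose[OF bounded_linear_trace] bounded_linear_compose[OF mm.bounded_linear_right]
        mm.bounded_linear_right)
  show ?thesis unfolding bilinear_def trace_form_def[abs_def] using 1 2 by blast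
qed

lemma trace_form_commute: "trace_form P A B = trace_form P B A"
  unfolding trace_form_def using trace_mul_sym by metis

lemma trace_form_pos:
  assumes "P \<in> Pos1" "A \<in> tangent P" "A \<noteq> 0"
  shows "0 < trace_form P A A"
proof -
  obtain x where x: "x \<in> SL" "P = gram x" using assms(1) by (auto simp: Pos1_def)
  obtain Z where Z: "Z \<in> sym0" "A = x ** Z ** transpose x"
    using tangent_gram_iff[OF x(1)] assms(2) by (auto simp: x(2))
  have "trace_form P A A = (Z \<bullet> Z) / 4"
    using Z trace_mult_transpose[of Z Z] by (simp add: x(2) trace_form_gram[OF x(1)] sym0_def)
  moreover have "Z \<noteq> 0" using assms(3) Z(2) by auto
  then have "0 < Z \<bullet> Z" by simp
  ultimately show ?thesis by linarith
qed

lemma smooth_on_trace_form: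
  assumes "open S" "smooth_on S P" "smooth_on S A" "smooth_on S B" "\<And>x. x \<in> S \<Longrightarrow> det (P x) \<noteq> 0"
  shows "smooth_on S (\<lambda>x. trace_form (P x) (A x) (B x))"
  unfolding trace_form_def
  by (intro smooth_on_bounded_linear_compose[OF bounded_linear_divide assms(1)]
      smooth_on_bounded_linear_compose[OF bounded_linear_trace assms(1)]
      smooth_on_bilinear[OF bounded_bilinear_matrix_mult assms(1)]
      smooth_on_matrix_inv[OF assms(1,2,5)] assms(3,4))

section \<open>The metric in a single chart\<close>

context chart_param
begin

lemma in_U_iff:
  assumes "q \<in> coset ` SL"
  shows "q \<in> U \<longleftrightarrow> cpos q \<in> W"
  using assms coset_in_U_iff by auto

lemma metric_linear:
  assumes "y \<in> c ` U"
  shows "bilinear (quotient_metric (U, c) y)"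
  using bilinear_trace_form[of "p y"] linear_dp[OF assms]
  unfolding bilinear_def quotient_metric_eq[OF assms, abs_def]
  by (auto intro: linear_compose[unfolded o_def])

lemma metric_commute:
  assumes "y \<in> c ` U"
  shows "quotient_metric (U, c) y u v = quotient_metric (U, c) y v u"
  by (simp add: quotient_metric_eq[OF assms] trace_form_commute)

lemma metric_pos:
  assumes "y \<in> c ` U" "u \<noteq> 0"
  shows "0 < quotient_metric (U, c) y u u"
proof -
  have "dp y u \<noteq> 0" using dp_eq_iff[OF assms(1), of u 0] linear_0[OF linear_dp[OF assms(1)]] assms(2) by simp
  then show ?thesis
    using trace_form_pos[OF p_in(2)[OF assms(1)] dp_tangent[OF assms(1)]]
    by (simp add: quotient_metric_eq[OF assms(1)])
qed

lemma det_p: "y \<in> c ` U \<Longrightarrow> det (p y) = 1"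
  by (rule Pos1_facts(2)[OF p_in(2)])

lemma smooth_metric: "smooth_on (c ` U) (\<lambda>y. quotient_metric (U, c) y u v)"
proof (rule smooth_on_cong_imp[OF open_image])
  show "smooth_on (c ` U) (\<lambda>y. trace_form (p y) (dp y u) (dp y v))"
    by (rule smooth_on_trace_form[OF open_image smooth_p smooth_dp smooth_dp]) (simp add: det_p)
qed (simp add: quotient_metric_eq)

end

text \<open>On the overlap the transition map is \<open>s \<circ> A.p\<close>, the parametrisation
  of one chart followed by the matrix extension of the other; smoothness and compatibility of the
  metrics follow from this composition.\<close>

locale two_charts = A: chart_param U c W r + B: chart_param V d X s
  for U :: "(real^'n^'n) set set" and c :: "(real^'n^'n) set \<Rightarrow> 'e::euclidean_space" and W r
    and V :: "(real^'n^'n) set set" and d :: "(real^'n^'n) set \<Rightarrow> 'e" and X s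
begin

lemma image_Int: "c ` (U \<inter> V) = c ` U \<inter> A.p -` X"
proof -
  have "q \<in> V \<longleftrightarrow> cpos q \<in> X" if "q \<in> U" for q
    using B.in_U_iff A.U_subset that by blast
  then show ?thesis by auto
qed

lemma open_image_Int: "open (c ` (U \<inter> V))"
  unfolding image_Int
  by (rule continuous_open_preimage[OF smooth_on_continuous_on[OF A.smooth_p] A.open_image B.open_W])

lemma transition_eq: "y \<in> c ` (U \<inter> V) \<Longrightarrow> (d \<circ> inv_into U c) y = s (A.p y)"
  using A.inj_c B.r_cpos by auto

lemma smooth_transition: "smooth_on (c ` (U \<inter> V)) (d \<circ> inv_into U c)"
proof (rule smooth_on_cong_imp[OF open_image_Int])
  show "smooth_on (c ` (U \<inter> V)) (\<lambda>y. s (A.p y))"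
    by (rule smooth_on_compose[OF open_image_Int B.open_W _ smooth_on_subset[OF A.smooth_p] B.smooth_r])
      (auto simp: image_Int)
qed (simp only: transition_eq)

lemma metric_transition:
  assumes y: "y \<in> c ` (U \<inter> V)"
  shows "quotient_metric (U, c) y u v =
    (let F = d \<circ> inv_into U c; F' = frechet_derivative F (at y)
     in quotient_metric (V, d) (F y) (F' u) (F' v))"
proof -
  have yU: "y \<in> c ` U" and pX: "A.p y \<in> X" using y by (auto simp: image_Int)
  obtain q where q: "q \<in> U" "q \<in> V" "y = c q" using y by blast
  have Fy: "(d \<circ> inv_into U c) y = d q" using q A.inj_c by simp
  have "((\<lambda>y. s (A.p y)) has_derivative (\<lambda>u. B.dr (A.p y) (A.dp y u))) (at y)"
    by (rule has_derivative_compose[OF A.has_derivative_p[OF yU] B.has_derivative_r[OF pX]])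
  then have "((d \<circ> inv_into U c) has_derivative (\<lambda>u. B.dr (A.p y) (A.dp y u))) (at y)"
    by (rule has_derivative_transform_within_open[OF _ open_image_Int y]) (simp only: transition_eq)
  then have F': "frechet_derivative (d \<circ> inv_into U c) (at y) = (\<lambda>u. B.dr (A.p y) (A.dp y u))"
    by (rule frechet_derivative_at[symmetric])
  have dq: "d q \<in> d ` V" and p_eq: "B.p (d q) = A.p y" using q by auto
  have "B.dp (d q) (B.dr (A.p y) (A.dp y u)) = A.dp y u" for u
    using B.dp_dr[OF dq] A.dp_tangent[OF yU] by (simp add: p_eq)
  then show ?thesis
    by (simp add: Let_def F' Fy A.quotient_metric_eq[OF yU] B.quotient_metric_eq[OF dq] p_eq del: o_apply)
qed

end

context sym0_iso
begin

text \<open>One global chart determines the topology: a set open in it is open in every chart,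
  because \<open>rbase\<close> composed with a parametrisation is continuous. The Hausdorff property
  and second countability are then pulled back from Euclidean space.\<close>

lemma manifold_topology_eq:
  "manifold_topology (SL_mod_SO :: ((real^'n^'n) set, 'e) riemannian) =
    pullback_topology (coset ` SL) (cbase 0) euclidean"
proof -
  interpret B: chart_param "coset ` SL" "cbase 0" "{P. 0 < trace P}" "\<lambda>P. rbase P - 0"
    by (rule chart_param_base)
  have "(S \<subseteq> coset ` SL \<and> (\<forall>(U, c)\<in>(quotient_charts :: ((real^'n^'n) set, 'e) chart set). open (c ` (U \<inter> S)))) \<longleftrightarrow>
      openin (pullback_topology (coset ` SL) (cbase 0) euclidean) S" (is "?L \<longleftrightarrow> ?R") for S
  proof
    assume L: ?L
    then have "open (cbase 0 ` (coset ` SL \<inter> S))" using B.in_quotient_charts by blast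
    moreover have "S = cbase 0 -` (cbase 0 ` (coset ` SL \<inter> S)) \<inter> coset ` SL"
    proof (intro equalityI subsetI)
      show "x \<in> cbase 0 -` (cbase 0 ` (coset ` SL \<inter> S)) \<inter> coset ` SL" if "x \<in> S" for x
        using that L by (intro IntI vimageI2 imageI) auto
      fix x assume x: "x \<in> cbase 0 -` (cbase 0 ` (coset ` SL \<inter> S)) \<inter> coset ` SL"
      then have "cbase 0 x \<in> cbase 0 ` (coset ` SL \<inter> S)" by simp
      then obtain z where z: "z \<in> coset ` SL \<inter> S" "cbase 0 x = cbase 0 z" by (rule imageE)
      then have "x = z" using inj_onD[OF B.inj_c z(2)] x by simp
      then show "x \<in> S" using z(1) by simp
    qed
    ultimately show ?R by (auto simp: openin_pullback_topology)
  next
    assume ?R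
    then obtain T where T: "open T" "S = cbase 0 -` T \<inter> coset ` SL"
      by (auto simp: openin_pullback_topology)
    have "open (c ` (U \<inter> S))" if "(U, c) \<in> (quotient_charts :: ((real^'n^'n) set, 'e) chart set)" for U c
    proof -
      obtain W r where "chart_param U c W r" using chart_paramI[OF \<open>(U, c) \<in> quotient_charts\<close>] by blast
      then interpret A: chart_param U c W r .
      have "continuous_on (c ` U) (\<lambda>y. rbase (A.p y))"
        using A.p_in(2) Pos1_trace_pos
        by (intro continuous_on_compose2[OF smooth_on_continuous_on[OF smooth_on_rbase] smooth_on_continuous_on[OF A.smooth_p]])
          blast
      moreover have "c ` (U \<inter> S) = c ` U \<inter> (\<lambda>y. rbase (A.p y)) -` T"
        using A.U_subset by (auto simp: T(2) cbase_def)
      ultimately show ?thesis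
        using continuous_open_preimage[OF _ A.open_image T(1)] by simp
    qed
    then show ?L using T(2) by blast
  qed
  then have "manifold_topology (SL_mod_SO :: ((real^'n^'n) set, 'e) riemannian) =
      topology (openin (pullback_topology (coset ` SL) (cbase 0) euclidean))"
    unfolding manifold_topology_def SL_mod_SO_def by simp
  then show ?thesis by (simp add: openin_inverse)
qed

lemma Hausdorff: "Hausdorff_space (pullback_topology (coset ` SL) (cbase 0) (euclidean :: 'e topology))"
  unfolding Hausdorff_space_def
proof (intro allI impI)
  interpret B: chart_param "coset ` SL" "cbase 0" "{P. 0 < trace P}" "\<lambda>P. rbase P - 0"
    by (rule chart_param_base)
  fix x y :: "(real^'n^'n) set"
  assume "x \<in> topspace (pullback_topology (coset ` SL) (cbase 0) (euclidean :: 'e topology)) \<and>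
    y \<in> topspace (pullback_topology (coset ` SL) (cbase 0) (euclidean :: 'e topology)) \<and> x \<noteq> y"
  then have xy: "x \<in> coset ` SL" "y \<in> coset ` SL" "cbase 0 x \<noteq> cbase 0 y"
    using inj_onD[OF B.inj_c] by (auto simp: topspace_pullback_topology)
  then obtain T1 T2 :: "'e set" where T: "open T1" "open T2" "cbase 0 x \<in> T1" "cbase 0 y \<in> T2" "T1 \<inter> T2 = {}"
    using hausdorff[OF xy(3)] by metis
  show "\<exists>S1 S2. openin (pullback_topology (coset ` SL) (cbase 0) (euclidean :: 'e topology)) S1 \<and>
      openin (pullback_topology (coset ` SL) (cbase 0) (euclidean :: 'e topology)) S2 \<and> x \<in> S1 \<and> y \<in> S2 \<and> disjnt S1 S2"
    by (rule exI[of _ "cbase 0 -` T1 \<inter> coset ` SL"], rule exI[of _ "cbase 0 -` T2 \<inter> coset ` SL"])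
      (use T xy in \<open>auto simp: openin_pullback_topology disjnt_def\<close>)
qed

lemma second_countable: "second_countable (pullback_topology (coset ` SL) (cbase 0) (euclidean :: 'e topology))"
proof -
  obtain \<B> :: "'e set set" where B: "countable \<B>" "\<And>C. C \<in> \<B> \<Longrightarrow> open C" "\<And>S. open S \<Longrightarrow> \<exists>\<U>\<subseteq>\<B>. S = \<Union>\<U>"
    using univ_second_countable by blast
  show ?thesis
    unfolding second_countable_def
  proof (intro exI conjI allI impI ballI)
    show "countable ((\<lambda>T. cbase 0 -` T \<inter> coset ` SL) ` \<B>)" using B(1) by simp
    show "openin (pullback_topology (coset ` SL) (cbase 0) euclidean) V"
      if "V \<in> (\<lambda>T. cbase 0 -` T \<inter> coset ` SL) ` \<B>" for V
      using that B(2) by (auto simp: openin_pullback_topology)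
    fix S and x :: "(real^'n^'n) set"
    assume "openin (pullback_topology (coset ` SL) (cbase 0) (euclidean :: 'e topology)) S \<and> x \<in> S"
    then obtain T where T: "open T" "S = cbase 0 -` T \<inter> coset ` SL" "x \<in> S"
      by (auto simp: openin_pullback_topology)
    obtain \<U> where "\<U> \<subseteq> \<B>" "T = \<Union>\<U>" using B(3)[OF T(1)] by blast
    moreover have "cbase 0 x \<in> T" using T(2,3) by blast
    ultimately obtain C where "C \<in> \<B>" "cbase 0 x \<in> C" "C \<subseteq> T" by blast
    then show "\<exists>V\<in>(\<lambda>T. cbase 0 -` T \<inter> coset ` SL) ` \<B>. x \<in> V \<and> V \<subseteq> S"
      using T(2,3) by (intro bexI[of _ "cbase 0 -` C \<inter> coset ` SL"]) auto
  qed
qed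

lemma two_chartsI:
  assumes "(U, c) \<in> (quotient_charts :: ((real^'n^'n) set, 'e) chart set)"
    "(V, d) \<in> (quotient_charts :: ((real^'n^'n) set, 'e) chart set)"
  shows "\<exists>W r X s. two_charts U c W r V d X s"
  using chart_paramI[OF assms(1)] chart_paramI[OF assms(2)] unfolding two_charts_def by blast

lemma riemannian_manifold: "riemannian_manifold (SL_mod_SO :: ((real^'n^'n) set, 'e) riemannian)"
proof -
  let ?Q = "quotient_charts :: ((real^'n^'n) set, 'e) chart set"
  interpret base: chart_param "coset ` SL" "cbase 0" "{P. 0 < trace P}" "\<lambda>P. rbase P - 0"
    by (rule chart_param_base)
  have sm: "smooth_manifold (SL_mod_SO :: ((real^'n^'n) set, 'e) riemannian)"
    unfolding smooth_manifold_def manifold_topology_eq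
  proof (intro conjI Hausdorff second_countable)
    have "(coset ` SL, cbase 0) \<in> ?Q" by (rule base.in_quotient_charts)
    moreover have "U \<subseteq> coset ` SL" if "(U, c) \<in> ?Q" for U and c
      using that unfolding quotient_charts_def by blast
    ultimately show "(\<Union>(U, c)\<in>charts (SL_mod_SO :: ((real^'n^'n) set, 'e) riemannian). U) =
        points (SL_mod_SO :: ((real^'n^'n) set, 'e) riemannian)"
      unfolding SL_mod_SO_def riemannian.simps by (intro equalityI UN_least) auto
    show "\<forall>(U, c)\<in>charts (SL_mod_SO :: ((real^'n^'n) set, 'e) riemannian). inj_on c U \<and> open (c ` U)"
      unfolding SL_mod_SO_def quotient_charts_def by auto
    have "open (c ` (U \<inter> V)) \<and> smooth_on (c ` (U \<inter> V)) (d \<circ> inv_into U c)"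
      if charts: "(U, c) \<in> ?Q" "(V, d) \<in> ?Q" for U c V d
    proof -
      obtain W r X s where "two_charts U c W r V d X s" using two_chartsI[OF charts] by blast
      then interpret two_charts U c W r V d X s .
      show ?thesis using open_image_Int smooth_transition by blast
    qed
    then show "\<forall>(U, c)\<in>charts (SL_mod_SO :: ((real^'n^'n) set, 'e) riemannian).
        \<forall>(V, d)\<in>charts (SL_mod_SO :: ((real^'n^'n) set, 'e) riemannian).
          open (c ` (U \<inter> V)) \<and> smooth_on (c ` (U \<inter> V)) (d \<circ> inv_into U c)"
      unfolding SL_mod_SO_def by auto
  qed
  have loc: "(\<forall>y\<in>c ` U. bilinear (quotient_metric (U, c) y) \<and>
           (\<forall>u v. quotient_metric (U, c) y u v = quotient_metric (U, c) y v u) \<and>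
           (\<forall>u. u \<noteq> 0 \<longrightarrow> quotient_metric (U, c) y u u > 0)) \<and>
        (\<forall>u v. smooth_on (c ` U) (\<lambda>y. quotient_metric (U, c) y u v))"
    if chart: "(U, c) \<in> ?Q" for U c
  proof -
    obtain W r where "chart_param U c W r" using chart_paramI[OF chart] by blast
    then interpret chart_param U c W r .
    show ?thesis using metric_linear metric_commute metric_pos smooth_metric by blast
  qed
  have trans: "quotient_metric (U, c) y u v =
      (let F = d \<circ> inv_into U c; F' = frechet_derivative F (at y)
       in quotient_metric (V, d) (F y) (F' u) (F' v))"
    if charts: "(U, c) \<in> ?Q" "(V, d) \<in> ?Q" and y: "y \<in> c ` (U \<inter> V)" for U c V d y u v
  proof -
    obtain W r X s where "two_charts U c W r V d X s" using two_chartsI[OF charts] by blast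
    then interpret two_charts U c W r V d X s .
    show ?thesis by (rule metric_transition[OF y])
  qed
  show ?thesis
    unfolding riemannian_manifold_def
    apply (intro conjI sm)
    subgoal using loc unfolding SL_mod_SO_def by auto
    subgoal using trans unfolding SL_mod_SO_def riemannian.simps by blast
    done
qed

end

section \<open>Gradients, Levi-Civita connection and Hessians in a chart\<close>

text \<open>The identity trace (G F) = trace (F G) for maps between different spaces. It moves the
  divergence from the model space to the space of all matrices.\<close>

lemma trace_linear_cyclic:
  fixes F :: "'a::euclidean_space \<Rightarrow> 'b::euclidean_space" and G :: "'b \<Rightarrow> 'a"
  assumes "linear F" "linear G"
  shows "(\<Sum>b\<in>Basis. G (F b) \<bullet> b) = (\<Sum>m\<in>Basis. F (G m) \<bullet> m)"
proof -
  have 1: "G (F b) \<bullet> b = (\<Sum>m\<in>Basis. (F b \<bullet> m) * (G m \<bullet> b))" for b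
    using linear_sum[OF assms(2), of "\<lambda>m. (F b \<bullet> m) *\<^sub>R m" Basis] linear_scale[OF assms(2)]
    by (simp add: euclidean_representation inner_sum_left)
  have 2: "F (G m) \<bullet> m = (\<Sum>b\<in>Basis. (G m \<bullet> b) * (F b \<bullet> m))" for m
    using linear_sum[OF assms(1), of "\<lambda>b. (G m \<bullet> b) *\<^sub>R b" Basis] linear_scale[OF assms(1)]
    by (simp add: euclidean_representation inner_sum_left)
  show ?thesis unfolding 1 2 by (subst sum.swap) (simp add: mult.commute)
qed

lemma sum_Basis_matrix:
  "(\<Sum>m\<in>(Basis :: (real^'n^'n) set). f m) = (\<Sum>i\<in>UNIV. \<Sum>j\<in>UNIV. f (axis i (axis j 1)))"
proof -
  let ?h = "\<lambda>(i, j). axis i (axis j 1) :: real^'n^'n"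
  have B: "(Basis :: (real^'n^'n) set) = ?h ` (UNIV \<times> UNIV)"
    by (auto simp: Basis_vec_def)
  have inj: "inj_on ?h (UNIV \<times> UNIV)"
    by (rule inj_onI) (auto simp: axis_eq_axis)
  have "(\<Sum>m\<in>(Basis :: (real^'n^'n) set). f m) = (\<Sum>x\<in>UNIV \<times> UNIV. f (?h x))"
    unfolding B by (simp only: sum.reindex[OF inj] comp_def)
  also have "\<dots> = (\<Sum>i\<in>UNIV. \<Sum>j\<in>UNIV. f (axis i (axis j 1)))"
    unfolding sum.cartesian_product by (intro sum.cong) auto
  finally show ?thesis .
qed

lemma matrix_mult_unit_component:
  "(A ** axis i (axis j 1) ** B) $ k $ l = A $ k $ i * (B :: real^'n^'n) $ j $ l"
proof -
  have "(A ** axis i (axis j 1)) $ k $ m = (if m = j then A $ k $ i else 0)" for m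
  proof -
    have "(A ** axis i (axis j 1)) $ k $ m = (\<Sum>q\<in>UNIV. A $ k $ q * axis i (axis j 1) $ q $ m)"
      by (simp add: matrix_matrix_mult_def)
    also have "\<dots> = (\<Sum>q\<in>UNIV. if q = i then (if m = j then A $ k $ i else 0) else 0)"
      by (intro sum.cong) (auto simp: axis_def)
    finally show ?thesis by simp
  qed
  note * = this
  have "(A ** axis i (axis j 1) ** B) $ k $ l = (\<Sum>m\<in>UNIV. (A ** axis i (axis j 1)) $ k $ m * B $ m $ l)"
    by (simp add: matrix_matrix_mult_def)
  also have "\<dots> = (\<Sum>m\<in>UNIV. if m = j then A $ k $ i * B $ j $ l else 0)"
    by (intro sum.cong) (auto simp: *)
  finally show ?thesis by simp
qed

lemma inner_matrix_unit: "A \<bullet> axis i (axis j 1) = (A :: real^'n^'n) $ i $ j"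
  by (simp add: inner_axis)

text \<open>The sum is the trace of the operator m \<mapsto> A m B, computed on matrix
  units.\<close>

lemma trace_two_sided_mult:
  "(\<Sum>m\<in>Basis. (A ** m ** B) \<bullet> m) = trace A * trace B" for A B :: "real^'n^'n"
  by (simp add: sum_Basis_matrix inner_matrix_unit matrix_mult_unit_component trace_def sum_product)

lemma transpose_unit: "transpose (axis i (axis j 1) :: real^'n^'n) = axis j (axis i 1)"
  by (auto simp: transpose_def axis_def vec_eq_iff)

text \<open>Transposition swaps the units (i, j) and (j, i), which turns the product of traces into
  an inner product.\<close>

lemma trace_two_sided_mult_transpose:
  "(\<Sum>m\<in>Basis. (A ** transpose m ** B) \<bullet> m) = A \<bullet> B" for A B :: "real^'n^'n"
  by (simp add: sum_Basis_matrix inner_matrix_unit matrix_mult_unit_component transpose_unit)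
    (simp add: inner_vec_def)

text \<open>The differential A \<mapsto> trace (S A) is represented by 4 P S P, the 4 undoing the
  quarter in \<open>trace_form\<close>; the multiple of P removes the component normal to the
  determinant-one hypersurface.\<close>

definition gradient_matrix :: "real^'n^'n \<Rightarrow> real^'n^'n \<Rightarrow> real^'n^'n" where
  "gradient_matrix S P = 4 *\<^sub>R (P ** S ** P - (trace (S ** P) / CARD('n)) *\<^sub>R P)"

text \<open>The Hessian of \<open>P \<mapsto> trace (S ** P)\<close>, as an endomorphism of the tangent space at \<open>P\<close>.\<close>
definition hessian_matrix :: "real^'n^'n \<Rightarrow> real^'n^'n \<Rightarrow> real^'n^'n \<Rightarrow> real^'n^'n" where
  "hessian_matrix S P A = 2 *\<^sub>R (A ** S ** P + P ** S ** A) - (4 * trace (S ** A) / CARD('n)) *\<^sub>R P"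

text \<open>Orthogonal projection for \<open>trace_form\<close>: P spans the normal direction among
  symmetric matrices, and the denominator is trace (P^-1 P) = n.\<close>

definition tangent_part :: "real^'n^'n \<Rightarrow> real^'n^'n \<Rightarrow> real^'n^'n" where
  "tangent_part P A = A - (trace (matrix_inv P ** A) / CARD('n)) *\<^sub>R P"

lemma Pos1_inverse:
  assumes "P \<in> Pos1"
  shows "matrix_inv P ** P = mat 1" "P ** matrix_inv P = mat 1"
    "A ** matrix_inv P ** P = A" "A ** P ** matrix_inv P = A"
    "transpose (matrix_inv P) = matrix_inv P"
proof -
  obtain x where x: "x \<in> SL" "P = gram x" using assms by (auto simp: Pos1_def)
  have "det P \<noteq> 0" using x by (simp add: det_gram SL_def)
  then show 1: "matrix_inv P ** P = mat 1" "P ** matrix_inv P = mat 1" by (rule matrix_inv)+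
  then show "A ** matrix_inv P ** P = A" "A ** P ** matrix_inv P = A"
    by (simp_all add: matrix_mul_assoc[symmetric])
  show "transpose (matrix_inv P) = matrix_inv P"
    using x by (simp add: matrix_inv_gram matrix_transpose_mul)
qed

lemma trace_matrix_inv_mult:
  "P \<in> Pos1 \<Longrightarrow> trace (matrix_inv P ** P) = CARD('n)" for P :: "real^'n^'n"
  by (simp add: Pos1_inverse trace_I)

lemma tangent_part_in_tangent:
  assumes "P \<in> Pos1" "transpose A = A"
  shows "tangent_part P A \<in> tangent P"
  using assms Pos1_inverse(1)[OF assms(1)]
  by (auto simp: tangent_part_def tangent_def transpose_diff transpose_scalar Pos1_def mm.diff_right
      mm.scaleR_right trace_sub trace_scaleR trace_I)

lemma trace_form_left:
  "P \<in> Pos1 \<Longrightarrow> trace_form P P A = trace (matrix_inv P ** A) / 4"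
  by (simp add: trace_form_def Pos1_inverse)

lemma trace_form_tangent_part:
  assumes "P \<in> Pos1" "C \<in> tangent P"
  shows "trace_form P (tangent_part P A) C = trace_form P A C"
  using assms
  by (simp add: tangent_part_def bilinear_lsub[OF bilinear_trace_form] bilinear_lmul[OF bilinear_trace_form]
      trace_form_left tangent_def)

lemma gradient_matrix_tangent:
  assumes "P \<in> Pos1" "transpose S = S"
  shows "gradient_matrix S P \<in> tangent P"
proof -
  have "transpose (P ** S ** P) = P ** S ** P"
    using assms by (auto simp: matrix_transpose_mul matrix_mul_assoc Pos1_def)
  then have "tangent_part P (P ** S ** P) \<in> tangent P" using assms(1) by (rule tangent_part_in_tangent[rotated])
  moreover have "gradient_matrix S P = 4 *\<^sub>R tangent_part P (P ** S ** P)"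
    using assms(1) by (simp add: gradient_matrix_def tangent_part_def matrix_mul_assoc Pos1_inverse)
  ultimately show ?thesis using subspace_scale[OF subspace_tangent] by metis
qed

lemma trace_form_gradient_matrix:
  assumes "P \<in> Pos1" "A \<in> tangent P"
  shows "trace_form P (gradient_matrix S P) A = trace (S ** A)"
proof -
  have "trace_form P (P ** S ** P) A = trace (S ** A) / 4"
    using assms(1) by (simp add: trace_form_def matrix_mul_assoc Pos1_inverse)
  moreover have "trace_form P P A = 0" using assms by (simp add: trace_form_left tangent_def)
  ultimately show ?thesis
    by (simp add: gradient_matrix_def bilinear_lsub[OF bilinear_trace_form] bilinear_lmul[OF bilinear_trace_form])
qed

lemma linear_hessian_matrix: "linear (hessian_matrix S P)"
  by (auto simp: linear_iff hessian_matrix_def mm.add_left mm.add_right mm.scaleR_left mm.scaleR_right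
      trace_add trace_scaleR add_divide_distrib scaleR_add_left scaleR_add_right algebra_simps)

lemma hessian_matrix_tangent:
  assumes "P \<in> Pos1" "transpose S = S" "A \<in> tangent P"
  shows "hessian_matrix S P A \<in> tangent P"
proof -
  have "transpose (hessian_matrix S P A) = hessian_matrix S P A"
    using assms by (auto simp: hessian_matrix_def transpose_add transpose_diff transpose_scalar
        matrix_transpose_mul matrix_mul_assoc Pos1_def tangent_def add.commute)
  moreover have "trace (matrix_inv P ** hessian_matrix S P A) = 0"
  proof -
    have 1: "trace (matrix_inv P ** (A ** S ** P)) = trace (S ** A)"
    proof -
      have "trace (matrix_inv P ** (A ** S ** P)) = trace (A ** S ** P ** matrix_inv P)"
        by (rule trace_mul_sym)
      also have "\<dots> = trace (A ** S)" by (simp add: Pos1_inverse[OF assms(1)])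
      finally show ?thesis using trace_mul_sym[of A S] by simp
    qed
    have 2: "trace (matrix_inv P ** (P ** S ** A)) = trace (S ** A)"
      by (simp add: matrix_mul_assoc Pos1_inverse[OF assms(1)])
    show ?thesis
      using 1 2 by (simp add: hessian_matrix_def mm.add_right mm.diff_right mm.scaleR_right trace_add trace_sub
          trace_scaleR trace_matrix_inv_mult[OF assms(1)])
  qed
  ultimately show ?thesis by (simp add: tangent_def)
qed

text \<open>The two products in the Hessian contribute equally by cyclicity of the trace, and the
  multiple of P is orthogonal to A.\<close>

lemma trace_form_hessian_matrix:
  assumes "P \<in> Pos1" "A \<in> tangent P"
  shows "trace_form P (hessian_matrix S P A) A = trace (S ** A ** matrix_inv P ** A)"
proof -
  have 1: "trace_form P (A ** S ** P) A = trace (S ** A ** matrix_inv P ** A) / 4"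
  proof -
    have "trace (matrix_inv P ** (A ** S ** P) ** (matrix_inv P ** A)) = trace ((matrix_inv P ** A) ** (S ** A))"
      by (simp add: matrix_mul_assoc Pos1_inverse[OF assms(1)])
    also have "\<dots> = trace ((S ** A) ** (matrix_inv P ** A))" by (rule trace_mul_sym)
    finally show ?thesis by (simp add: trace_form_def matrix_mul_assoc)
  qed
  have 2: "trace_form P (P ** S ** A) A = trace (S ** A ** matrix_inv P ** A) / 4"
    by (simp add: trace_form_def matrix_mul_assoc Pos1_inverse[OF assms(1)])
  have 3: "trace_form P P A = 0" using assms by (simp add: trace_form_left tangent_def)
  show ?thesis
    using 1 2 3 by (simp add: hessian_matrix_def bilinear_lsub[OF bilinear_trace_form] bilinear_ladd[OF bilinear_trace_form]
        bilinear_lmul[OF bilinear_trace_form])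
qed

text \<open>The trace over the tangent space is computed on all matrices, by composing with the projection
  \<open>m \<mapsto> tangent_part P ((m + m\<^sup>t) / 2)\<close>.\<close>
lemma trace_hessian_matrix:
  fixes P S :: "real^'n^'n"
  assumes P: "P \<in> Pos1" and S: "transpose S = S"
  shows "(\<Sum>m\<in>Basis. hessian_matrix S P (tangent_part P ((1/2) *\<^sub>R (m + transpose m))) \<bullet> m) =
    2 * (real CARD('n) + 1 - 2 / real CARD('n)) * trace (S ** P)"
proof -
  define n where "n = real CARD('n)"
  define s where "s = trace (S ** P)"
  define H where "H = hessian_matrix S P P"
  have n: "n > 0" by (simp add: n_def)
  have symP: "transpose P = P" using P by (auto simp: Pos1_def)
  have sPS: "trace (P ** S) = s" unfolding s_def by (rule trace_mul_sym)
  have tr: "trace (matrix_inv P ** transpose m) = trace (matrix_inv P ** m)" for m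
    by (metis Pos1_inverse(5)[OF P] matrix_transpose_mul trace_mul_sym trace_transpose)
  have trS: "trace (S ** transpose m) = trace (S ** m)" for m
    by (metis S matrix_transpose_mul trace_mul_sym trace_transpose)
  have inner: "trace (X ** m) = X \<bullet> m" if "transpose X = X" for X m :: "real^'n^'n"
    using trace_mult_transpose[of m X] that trace_mul_sym[of X m] by (simp add: inner_commute)
  \<comment> \<open>Four two-sided multiplications, with traces n s, s, n s and s, and two rank-one
    maps. The first rank-one map contributes -(4/n) s; the second contributes 0 because
    \<open>matrix_inv P\<close> and H are orthogonal.\<close>
  have expand: "hessian_matrix S P (tangent_part P ((1/2) *\<^sub>R (m + transpose m))) \<bullet> m =
      (mat 1 ** m ** (S ** P)) \<bullet> m + (mat 1 ** transpose m ** (S ** P)) \<bullet> m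
      + ((P ** S) ** m ** mat 1) \<bullet> m + ((P ** S) ** transpose m ** mat 1) \<bullet> m
      - (4 / n) * ((S \<bullet> m) * (P \<bullet> m)) - (1 / n) * ((matrix_inv P \<bullet> m) * (H \<bullet> m))" for m
  proof -
    define K where "K = (1/2) *\<^sub>R (m + transpose m)"
    have "trace (matrix_inv P ** K) = matrix_inv P \<bullet> m"
      using tr[of m] inner[OF Pos1_inverse(5)[OF P], of m]
      by (simp add: K_def mm.scaleR_right mm.add_right trace_scaleR trace_add)
    then have 1: "hessian_matrix S P (tangent_part P K) = hessian_matrix S P K - ((matrix_inv P \<bullet> m) / n) *\<^sub>R H"
      by (simp add: tangent_part_def linear_diff[OF linear_hessian_matrix] linear_scale[OF linear_hessian_matrix] H_def n_def)
    have "trace (S ** K) = S \<bullet> m"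
      using trS[of m] inner[OF S, of m]
      by (simp add: K_def mm.scaleR_right mm.add_right trace_scaleR trace_add)
    then have 2: "hessian_matrix S P K = m ** S ** P + transpose m ** S ** P + P ** S ** m + P ** S ** transpose m - (4 * (S \<bullet> m) / n) *\<^sub>R P"
      by (simp add: hessian_matrix_def n_def) (simp add: K_def mm.scaleR_left mm.scaleR_right mm.add_left mm.add_right scaleR_add_right)
    show ?thesis
      unfolding K_def[symmetric] 1 2 by (simp add: inner_diff_left inner_add_left matrix_mul_assoc)
  qed
  have "matrix_inv P \<bullet> H = 0"
  proof -
    have "H = 4 *\<^sub>R (P ** S ** P) - (4 * s / n) *\<^sub>R P"
      by (simp add: H_def hessian_matrix_def s_def n_def scaleR_2[symmetric])
    then have "trace (matrix_inv P ** H) = 0"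
      using n by (simp add: mm.diff_right mm.scaleR_right trace_sub trace_scaleR matrix_mul_assoc
          Pos1_inverse[OF P] trace_I n_def[symmetric] s_def[symmetric])
    then show ?thesis using inner[OF Pos1_inverse(5)[OF P]] by simp
  qed
  moreover have "S \<bullet> P = s" "mat 1 \<bullet> (S ** P) = s" "(P ** S) \<bullet> mat 1 = s"
    using inner[OF S, of P] inner[of "mat 1" "S ** P"] inner[of "mat 1" "P ** S"] sPS
    by (simp_all add: s_def inner_commute)
  moreover have "(\<Sum>m\<in>Basis. (X \<bullet> m) * (Y \<bullet> m)) = X \<bullet> Y" for X Y :: "real^'n^'n"
    by (rule euclidean_inner[symmetric])
  ultimately have "(\<Sum>m\<in>Basis. hessian_matrix S P (tangent_part P ((1/2) *\<^sub>R (m + transpose m))) \<bullet> m) =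
      n * s + s + s * n + s - (4 / n) * s"
    unfolding expand sum.distrib sum_subtractf sum_distrib_left[symmetric]
      trace_two_sided_mult trace_two_sided_mult_transpose
    by (simp add: trace_I sPS n_def[symmetric] s_def[symmetric])
  then show ?thesis using n by (simp add: n_def[symmetric] s_def[symmetric] field_simps)
qed

section \<open>Gradient and Levi-Civita connection transported to matrices\<close>

context chart_param
begin

abbreviation g :: "'e local_metric" where
  "g \<equiv> quotient_metric (U, c)"

text \<open>Supplies the uniqueness behind the definite descriptions of the gradient and of the
  Christoffel symbols.\<close>

lemma metric_nondegenerate:
  assumes "y \<in> c ` U" "\<And>z. g y w z = g y w' z"
  shows "w = w'"
proof (rule ccontr)
  assume "w \<noteq> w'"
  then have "0 < g y (w - w') (w - w')" using metric_pos[OF assms(1)] by simp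
  then show False using assms(2) by (simp add: bilinear_lsub[OF metric_linear[OF assms(1)]])
qed

definition grad :: "real^'n^'n \<Rightarrow> 'e \<Rightarrow> 'e" where
  "grad S y = dr (p y) (gradient_matrix S (p y))"

lemma dp_grad:
  assumes "y \<in> c ` U" "transpose S = S"
  shows "dp y (grad S y) = gradient_matrix S (p y)"
  unfolding grad_def by (rule dp_dr[OF assms(1) gradient_matrix_tangent[OF p_in(2)[OF assms(1)] assms(2)]])

lemma metric_grad:
  assumes "y \<in> c ` U" "transpose S = S"
  shows "g y (grad S y) z = trace (S ** dp y z)"
  using trace_form_gradient_matrix[OF p_in(2)[OF assms(1)] dp_tangent[OF assms(1)]]
  by (simp add: quotient_metric_eq[OF assms(1)] dp_grad[OF assms])

lemma has_derivative_trace_p: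
  assumes "y \<in> c ` U" "\<And>z. z \<in> c ` U \<Longrightarrow> f z = trace (S ** p z)"
  shows "(f has_derivative (\<lambda>v. trace (S ** dp y v))) (at y)"
proof (rule has_derivative_transform_within_open[OF _ open_image assms(1)])
  show "((\<lambda>z. trace (S ** p z)) has_derivative (\<lambda>v. trace (S ** dp y v))) (at y)"
    by (intro bounded_linear.has_derivative[OF bounded_linear_trace]
        bounded_linear.has_derivative[OF mm.bounded_linear_right] has_derivative_p assms(1))
qed (simp add: assms(2))

lemma gradient_eq:
  assumes "y \<in> c ` U" "transpose S = S" "\<And>z. z \<in> c ` U \<Longrightarrow> f z = trace (S ** p z)"
  shows "gradient g f y = grad S y"
proof -
  have f': "frechet_derivative f (at y) = (\<lambda>v. trace (S ** dp y v))"
    by (rule frechet_derivative_at[symmetric, OF has_derivative_trace_p[OF assms(1,3)]])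
  show ?thesis
    unfolding gradient_def
    by (rule the_equality) (use metric_grad[OF assms(1,2)] metric_nondegenerate[OF assms(1)] in \<open>auto simp: f'\<close>)
qed

lemma smooth_gradient_matrix_p: "smooth_on (c ` U) (\<lambda>y. gradient_matrix S (p y))"
  unfolding gradient_matrix_def
  by (intro smooth_on_bounded_linear_compose[OF bounded_linear_scaleR_right open_image] smooth_on_diff open_image
      smooth_on_bilinear[OF bounded_bilinear_matrix_mult open_image] smooth_on_bilinear[OF bounded_bilinear_scaleR open_image]
      smooth_on_bounded_linear_compose[OF bounded_linear_divide open_image]
      smooth_on_bounded_linear_compose[OF bounded_linear_trace open_image] smooth_p smooth_on_const)

lemma smooth_dr_compose:
  assumes "smooth_on (c ` U) X"
  shows "smooth_on (c ` U) (\<lambda>y. dr (p y) (X y))"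
proof (rule smooth_on_cong_imp[OF open_image])
  show "smooth_on (c ` U) (\<lambda>y. \<Sum>m\<in>Basis. (X y \<bullet> m) *\<^sub>R dr (p y) m)"
  proof (intro smooth_on_sum smooth_on_bilinear[OF bounded_bilinear_scaleR open_image] open_image
      smooth_on_bounded_linear_compose[OF bounded_linear_inner_left open_image] assms)
    show "smooth_on (c ` U) (\<lambda>y. dr (p y) m)" for m
      unfolding dr_def
      by (rule smooth_on_compose[OF open_image open_W _ smooth_p smooth_on_frechet_derivative[OF smooth_r]])
        (use p_in(1) in blast)
  qed
  show "(\<Sum>m\<in>Basis. (X y \<bullet> m) *\<^sub>R dr (p y) m) = dr (p y) (X y)" if "y \<in> c ` U" for y
    using linear_sum[OF linear_dr[OF p_in(1)[OF that]], of "\<lambda>m. (X y \<bullet> m) *\<^sub>R m" Basis]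
      linear_scale[OF linear_dr[OF p_in(1)[OF that]]]
    by (simp add: euclidean_representation)
qed

lemma smooth_grad: "smooth_on (c ` U) (grad S)"
  unfolding grad_def[abs_def] by (rule smooth_dr_compose[OF smooth_gradient_matrix_p])

definition ddp :: "'e \<Rightarrow> 'e \<Rightarrow> 'e \<Rightarrow> real^'n^'n" where
  "ddp y u v = frechet_derivative (\<lambda>x. dp x v) (at y) u"

lemma has_derivative_dp: "y \<in> c ` U \<Longrightarrow> ((\<lambda>x. dp x v) has_derivative (\<lambda>u. ddp y u v)) (at y)"
  unfolding ddp_def using smooth_on_has_derivative[OF smooth_dp] by simp

lemma ddp_commute: "y \<in> c ` U \<Longrightarrow> ddp y u v = ddp y v u"
  unfolding ddp_def dp_def by (rule second_derivative_symmetric[OF open_image smooth_p])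

lemma transpose_dp: "y \<in> c ` U \<Longrightarrow> transpose (dp y u) = dp y u"
  using dp_tangent by (simp add: tangent_def)

lemma transpose_ddp:
  assumes "y \<in> c ` U"
  shows "transpose (ddp y u v) = ddp y u v"
proof -
  have "(\<lambda>u. transpose (ddp y u v)) = (\<lambda>u. ddp y u v)"
    by (rule frechet_derivative_unique_on_open[OF open_image assms, of "\<lambda>x. transpose (dp x v)" "\<lambda>x. dp x v"])
      (use transpose_dp bounded_linear.has_derivative[OF bounded_linear_transpose] has_derivative_dp assms in blast)+
  then show ?thesis by meson
qed

text \<open>Obtained by differentiating P^-1 P = 1, once smoothness of the inverse is known.\<close>

lemma has_derivative_inv_p:
  assumes "y \<in> c ` U"
  shows "((\<lambda>x. matrix_inv (p x)) has_derivative
    (\<lambda>u. - (matrix_inv (p y) ** dp y u ** matrix_inv (p y)))) (at y)"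
proof -
  define Q where "Q = (\<lambda>x. matrix_inv (p x))"
  have "smooth_on (c ` U) Q"
    unfolding Q_def by (rule smooth_on_matrix_inv[OF open_image smooth_p]) (simp add: det_p)
  from smooth_on_has_derivative[OF this assms]
  obtain Q' where Q': "(Q has_derivative Q') (at y)" by blast
  have "(\<lambda>u. Q y ** dp y u + Q' u ** p y) = (\<lambda>u. 0)"
    by (rule frechet_derivative_unique_on_open[OF open_image assms _ mm.FDERIV[OF Q' has_derivative_p[OF assms]]])
      (auto simp: Q_def Pos1_inverse(1)[OF p_in(2)])
  then have "Q y ** dp y u + Q' u ** p y = 0" for u by meson
  then have "Q' u ** p y = - (Q y ** dp y u)" for u by (simp add: eq_neg_iff_add_eq_0 add.commute)
  then have "Q' u ** p y ** Q y = - (Q y ** dp y u) ** Q y" for u by simp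
  then have "Q' u = - (Q y ** dp y u ** Q y)" for u
    by (simp add: Q_def mm.minus_left Pos1_inverse(4)[OF p_in(2)[OF assms]])
  then have "Q' = (\<lambda>u. - (Q y ** dp y u ** Q y))" by (rule ext)
  then show ?thesis using Q' by (simp add: Q_def)
qed

text \<open>Cyclicity rotates the three factors, and transposition reverses them since all matrices
  involved are symmetric. The cubic terms of the Koszul formula are thereby all equal.\<close>

lemma cubic_trace_symmetric:
  assumes "y \<in> c ` U" and Q: "Q = matrix_inv (p y)" and A: "transpose A = A" "transpose B = B" "transpose C = C"
  shows "trace (Q ** A ** Q ** B ** Q ** C) = trace (Q ** B ** Q ** A ** Q ** C)"
    "trace (Q ** A ** Q ** B ** Q ** C) = trace (Q ** B ** Q ** C ** Q ** A)"
proof -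
  show cyc: "trace (Q ** A ** Q ** B ** Q ** C) = trace (Q ** B ** Q ** C ** Q ** A)" for A B C
    using trace_mul_sym[of "Q ** A" "Q ** B ** Q ** C"] by (simp add: matrix_mul_assoc)
  have "transpose Q = Q" using Pos1_inverse(5)[OF p_in(2)[OF assms(1)]] by (simp add: Q)
  then have "trace (Q ** A ** Q ** B ** Q ** C) = trace (C ** Q ** B ** Q ** A ** Q)"
    using A trace_transpose[of "Q ** A ** Q ** B ** Q ** C"] by (simp add: matrix_transpose_mul matrix_mul_assoc)
  also have "\<dots> = trace (Q ** C ** Q ** B ** Q ** A)"
    using trace_mul_sym[of "C ** Q ** B ** Q ** A" Q] by (simp add: matrix_mul_assoc)
  also have "\<dots> = trace (Q ** B ** Q ** A ** Q ** C)" by (rule cyc)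
  finally show "trace (Q ** A ** Q ** B ** Q ** C) = trace (Q ** B ** Q ** A ** Q ** C)" .
qed

lemma frechet_derivative_metric:
  assumes "y \<in> c ` U"
  shows "frechet_derivative (\<lambda>x. g x v z) (at y) u =
    trace_form (p y) (ddp y u v) (dp y z) + trace_form (p y) (dp y v) (ddp y u z)
    - trace (matrix_inv (p y) ** dp y u ** matrix_inv (p y) ** dp y v ** matrix_inv (p y) ** dp y z) / 2"
proof -
  define Q where "Q = (\<lambda>x. matrix_inv (p x))"
  define Q' where "Q' = (\<lambda>u. - (Q y ** dp y u ** Q y))"
  have Q: "(Q has_derivative Q') (at y)"
    using has_derivative_inv_p[OF assms] by (simp add: Q_def Q'_def)
  note dp = has_derivative_dp[OF assms]
  have "((\<lambda>x. trace ((Q x ** dp x v) ** (Q x ** dp x z)) / 4) has_derivative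
    (\<lambda>u. trace ((Q y ** dp y v) ** (Q y ** ddp y u z + Q' u ** dp y z) +
       (Q y ** ddp y u v + Q' u ** dp y v) ** (Q y ** dp y z)) / 4)) (at y)"
    by (intro bounded_linear.has_derivative[OF bounded_linear_divide]
        bounded_linear.has_derivative[OF bounded_linear_trace] mm.FDERIV Q dp)
  then have "((\<lambda>x. g x v z) has_derivative
    (\<lambda>u. trace ((Q y ** dp y v) ** (Q y ** ddp y u z + Q' u ** dp y z) +
       (Q y ** ddp y u v + Q' u ** dp y v) ** (Q y ** dp y z)) / 4)) (at y)"
    by (rule has_derivative_transform_within_open[OF _ open_image assms])
      (simp add: quotient_metric_eq trace_form_def Q_def)
  from fun_cong[OF frechet_derivative_at[OF this], of u]
  have "frechet_derivative (\<lambda>x. g x v z) (at y) u =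
      trace ((Q y ** dp y v) ** (Q y ** ddp y u z + Q' u ** dp y z) +
       (Q y ** ddp y u v + Q' u ** dp y v) ** (Q y ** dp y z)) / 4"
    by (rule sym)
  also have "\<dots> = trace ((Q y ** dp y v) ** (Q y ** ddp y u z)) / 4 + trace ((Q y ** ddp y u v) ** (Q y ** dp y z)) / 4
     - (trace (Q y ** dp y v ** Q y ** dp y u ** Q y ** dp y z) + trace (Q y ** dp y u ** Q y ** dp y v ** Q y ** dp y z)) / 4"
    by (simp add: Q'_def mm.add_left mm.add_right mm.minus_left mm.minus_right mm.diff_left mm.diff_right
        trace_add trace_sub matrix_mul_assoc add_divide_distrib diff_divide_distrib)
  also have "trace (Q y ** dp y v ** Q y ** dp y u ** Q y ** dp y z) = trace (Q y ** dp y u ** Q y ** dp y v ** Q y ** dp y z)"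
    by (rule cubic_trace_symmetric(1)[OF assms _ transpose_dp[OF assms] transpose_dp[OF assms] transpose_dp[OF assms]])
      (simp add: Q_def)
  finally show ?thesis by (simp add: trace_form_def Q_def)
qed

text \<open>The covariant derivative in the space of all matrices with the metric \<open>trace_form\<close>; its tangential
  part is the image of the Christoffel symbols of the chart.\<close>
definition acceleration :: "'e \<Rightarrow> 'e \<Rightarrow> 'e \<Rightarrow> real^'n^'n" where
  "acceleration y u v = ddp y u v -
     (1/2) *\<^sub>R (dp y u ** matrix_inv (p y) ** dp y v + dp y v ** matrix_inv (p y) ** dp y u)"

lemma transpose_acceleration:
  assumes "y \<in> c ` U"
  shows "transpose (acceleration y u v) = acceleration y u v"
  by (simp add: acceleration_def transpose_diff transpose_scalar transpose_add matrix_transpose_mul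
      transpose_ddp[OF assms] transpose_dp[OF assms] Pos1_inverse(5)[OF p_in(2)[OF assms]] matrix_mul_assoc add.commute)

text \<open>Symmetry of second derivatives cancels all but two copies of the term with
  \<open>ddp y u v\<close>. Of the equal cubic terms T/2, two enter with minus and one with plus,
  leaving -T/2, which is twice the -T/4 carried by \<open>acceleration\<close>.\<close>

lemma koszul:
  assumes "y \<in> c ` U"
  shows "frechet_derivative (\<lambda>x. g x v z) (at y) u + frechet_derivative (\<lambda>x. g x u z) (at y) v
    - frechet_derivative (\<lambda>x. g x u v) (at y) z = 2 * trace_form (p y) (acceleration y u v) (dp y z)"
proof -
  define Q where "Q = matrix_inv (p y)"
  define T where "T = trace (Q ** dp y u ** Q ** dp y v ** Q ** dp y z)"
  note sym = transpose_dp[OF assms]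
  have 1: "trace (Q ** dp y v ** Q ** dp y u ** Q ** dp y z) = T"
    unfolding T_def by (rule cubic_trace_symmetric(1)[OF assms Q_def sym sym sym])
  have 2: "trace (Q ** dp y z ** Q ** dp y u ** Q ** dp y v) = T"
    unfolding T_def by (rule cubic_trace_symmetric(2)[OF assms Q_def sym sym sym])
  have "trace_form (p y) (acceleration y u v) (dp y z) = trace_form (p y) (ddp y u v) (dp y z) - T / 4"
    using 1 unfolding acceleration_def bilinear_lsub[OF bilinear_trace_form] bilinear_lmul[OF bilinear_trace_form]
      bilinear_ladd[OF bilinear_trace_form]
    by (simp add: trace_form_def Q_def[symmetric] matrix_mul_assoc T_def)
  then show ?thesis
    using 1 2 ddp_commute[OF assms, of z u] ddp_commute[OF assms, of z v] ddp_commute[OF assms, of v u]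
      trace_form_commute[of "p y" "dp y v"] trace_form_commute[of "p y" "dp y u"]
    by (simp add: frechet_derivative_metric[OF assms] Q_def[symmetric] T_def[symmetric] field_simps)
qed

text \<open>The Koszul formula is tested only against tangent matrices \<open>dp y z\<close>, so it
  fixes the tangential part of the acceleration, and nondegeneracy makes the vector unique.\<close>

lemma dp_christoffel:
  assumes "y \<in> c ` U"
  shows "dp y (christoffel g y u v) = tangent_part (p y) (acceleration y u v)"
proof -
  define w where "w = dr (p y) (tangent_part (p y) (acceleration y u v))"
  have w: "dp y w = tangent_part (p y) (acceleration y u v)"
    unfolding w_def
    by (rule dp_dr[OF assms tangent_part_in_tangent[OF p_in(2)[OF assms] transpose_acceleration[OF assms]]])
  have gw: "g y w z = trace_form (p y) (acceleration y u v) (dp y z)" for z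
    by (simp add: quotient_metric_eq[OF assms] w trace_form_tangent_part[OF p_in(2)[OF assms] dp_tangent[OF assms]])
  have "christoffel g y u v = w"
    unfolding christoffel_def koszul[OF assms]
  proof (rule the_equality)
    show "\<forall>z. 2 * g y w z = 2 * trace_form (p y) (acceleration y u v) (dp y z)" using gw by simp
    fix w' assume "\<forall>z. 2 * g y w' z = 2 * trace_form (p y) (acceleration y u v) (dp y z)"
    then show "w' = w" using gw by (intro metric_nondegenerate[OF assms]) simp
  qed
  then show ?thesis using w by simp
qed

text \<open>Base point and vector both vary; expansion of X in the basis reduces this to the product
  rule with scalar coefficients.\<close>

lemma has_derivative_dp_field:
  assumes "y \<in> c ` U" "(X has_derivative X') (at y)"
  shows "((\<lambda>x. dp x (X x)) has_derivative (\<lambda>u. dp y (X' u) + ddp y u (X y))) (at y)"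
proof -
  have dp: "dp x w = (\<Sum>b\<in>Basis. (w \<bullet> b) *\<^sub>R dp x b)" if "x \<in> c ` U" for x w
    using linear_sum[OF linear_dp[OF that], of "\<lambda>b. (w \<bullet> b) *\<^sub>R b" Basis] linear_scale[OF linear_dp[OF that]]
    by (simp add: euclidean_representation)
  have "((\<lambda>x. \<Sum>b\<in>Basis. (w \<bullet> b) *\<^sub>R dp x b) has_derivative (\<lambda>u. \<Sum>b\<in>Basis. (w \<bullet> b) *\<^sub>R ddp y u b)) (at y)" for w
    by (intro has_derivative_sum has_derivative_scaleR_right has_derivative_dp assms(1))
  then have "((\<lambda>x. dp x w) has_derivative (\<lambda>u. \<Sum>b\<in>Basis. (w \<bullet> b) *\<^sub>R ddp y u b)) (at y)" for w
    by (rule has_derivative_transform_within_open[OF _ open_image assms(1)]) (rule dp[symmetric])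
  then have ddp: "(\<lambda>u. ddp y u w) = (\<lambda>u. \<Sum>b\<in>Basis. (w \<bullet> b) *\<^sub>R ddp y u b)" for w
    using has_derivative_dp[OF assms(1)] has_derivative_unique by blast
  have "((\<lambda>x. \<Sum>b\<in>Basis. (X x \<bullet> b) *\<^sub>R dp x b) has_derivative
      (\<lambda>u. \<Sum>b\<in>Basis. (X y \<bullet> b) *\<^sub>R ddp y u b + (X' u \<bullet> b) *\<^sub>R dp y b)) (at y)"
    by (intro has_derivative_sum has_derivative_scaleR has_derivative_inner_left has_derivative_dp assms)
  then have "((\<lambda>x. dp x (X x)) has_derivative
      (\<lambda>u. \<Sum>b\<in>Basis. (X y \<bullet> b) *\<^sub>R ddp y u b + (X' u \<bullet> b) *\<^sub>R dp y b)) (at y)"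
    by (rule has_derivative_transform_within_open[OF _ open_image assms(1)]) (rule dp[symmetric])
  moreover have "(\<Sum>b\<in>Basis. (X y \<bullet> b) *\<^sub>R ddp y u b + (X' u \<bullet> b) *\<^sub>R dp y b) = dp y (X' u) + ddp y u (X y)" for u
    using fun_cong[OF ddp[of "X y"], of u] dp[OF assms(1), of "X' u"] by (simp add: sum.distrib)
  ultimately show ?thesis by simp
qed

lemma has_derivative_gradient_matrix:
  "((\<lambda>P. gradient_matrix S P) has_derivative (\<lambda>A. 4 *\<^sub>R (A ** S ** P + P ** S ** A
     - ((trace (S ** A) / CARD('n)) *\<^sub>R P + (trace (S ** P) / CARD('n)) *\<^sub>R A)))) (at (P :: real^'n^'n))"
proof -
  have 1: "((\<lambda>P. P ** S ** P) has_derivative (\<lambda>A. (P ** S) ** A + (A ** S) ** P)) (at P)"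
    by (intro mm.FDERIV has_derivative_ident bounded_linear.has_derivative[OF mm.bounded_linear_left])
  have 2: "((\<lambda>P. trace (S ** P) / CARD('n)) has_derivative (\<lambda>A. trace (S ** A) / CARD('n))) (at P)"
    by (intro bounded_linear_imp_has_derivative bounded_linear_compose[OF bounded_linear_divide]
        bounded_linear_compose[OF bounded_linear_trace] mm.bounded_linear_right)
  have "((\<lambda>P. 4 *\<^sub>R (P ** S ** P - (trace (S ** P) / CARD('n)) *\<^sub>R P)) has_derivative
    (\<lambda>A. 4 *\<^sub>R ((P ** S) ** A + (A ** S) ** P - ((trace (S ** P) / CARD('n)) *\<^sub>R A + (trace (S ** A) / CARD('n)) *\<^sub>R P)))) (at P)"
    by (intro has_derivative_scaleR_right has_derivative_diff 1 has_derivative_scaleR 2 has_derivative_ident)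
  then show ?thesis by (simp add: gradient_matrix_def[abs_def] add.commute)
qed

text \<open>Differentiating \<open>dp x (X x) = gradient_matrix S (p x)\<close> expresses the
  unknown derivative of X through matrices; the second derivatives of p then cancel against those in
  \<open>acceleration\<close>.\<close>

lemma covariant_derivative_grad:
  assumes "y \<in> c ` U" and S: "transpose S = S" and X: "\<And>x. x \<in> c ` U \<Longrightarrow> X x = grad S x"
  shows "dp y (covariant_derivative g y u X) = hessian_matrix S (p y) (dp y u)"
proof -
  define P where "P = p y"
  define A where "A = dp y u"
  define G where "G = gradient_matrix S P"
  define N where "N = 4 *\<^sub>R (A ** S ** P + P ** S ** A
     - ((trace (S ** A) / CARD('n)) *\<^sub>R P + (trace (S ** P) / CARD('n)) *\<^sub>R A))"
  have P: "P \<in> Pos1" unfolding P_def by (rule p_in(2)[OF assms(1)])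
  note inv = Pos1_inverse[OF P]
  have "(X has_derivative frechet_derivative (grad S) (at y)) (at y)"
    by (rule has_derivative_transform_within_open[OF smooth_on_has_derivative[OF smooth_grad assms(1)] open_image assms(1)])
      (simp add: X)
  then have X': "(X has_derivative frechet_derivative X (at y)) (at y)"
    using frechet_derivative_at by metis
  have dpX: "gradient_matrix S (p x) = dp x (X x)" if "x \<in> c ` U" for x
    using dp_grad[OF that S] X[OF that] by simp
  have der: "((\<lambda>x. gradient_matrix S (p x)) has_derivative (\<lambda>u. 4 *\<^sub>R (dp y u ** S ** P + P ** S ** dp y u
     - ((trace (S ** dp y u) / CARD('n)) *\<^sub>R P + (trace (S ** P) / CARD('n)) *\<^sub>R dp y u)))) (at y)"
    using has_derivative_compose[OF has_derivative_p[OF assms(1)] has_derivative_gradient_matrix] by (simp add: P_def)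
  have "(\<lambda>u. 4 *\<^sub>R (dp y u ** S ** P + P ** S ** dp y u
     - ((trace (S ** dp y u) / CARD('n)) *\<^sub>R P + (trace (S ** P) / CARD('n)) *\<^sub>R dp y u))) =
     (\<lambda>u. dp y (frechet_derivative X (at y) u) + ddp y u (X y))"
    by (rule frechet_derivative_unique_on_open[OF open_image assms(1) dpX der has_derivative_dp_field[OF assms(1) X']])
  then have 1: "dp y (frechet_derivative X (at y) u) = N - ddp y u (X y)"
    unfolding N_def A_def by (simp add: fun_eq_iff eq_diff_eq)
  have acc: "acceleration y u (X y) = ddp y u (X y) - (1/2) *\<^sub>R (A ** matrix_inv P ** G + G ** matrix_inv P ** A)"
    using dpX[OF assms(1)] by (simp add: acceleration_def A_def G_def P_def)
  \<comment> \<open>The coefficient of P removed by \<open>tangent_part\<close>. It turns out to be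
    0: the covariant derivative and the Hessian are both tangent, whereas P is not.\<close>
  define t where "t = trace (matrix_inv P ** acceleration y u (X y)) / CARD('n)"
  have AG: "A ** matrix_inv P ** G = 4 *\<^sub>R (A ** S ** P - (trace (S ** P) / CARD('n)) *\<^sub>R A)"
    by (simp add: G_def gradient_matrix_def mm.scaleR_right mm.diff_right matrix_mul_assoc inv)
  have GA: "G ** matrix_inv P ** A = 4 *\<^sub>R (P ** S ** A - (trace (S ** P) / CARD('n)) *\<^sub>R A)"
    by (simp add: G_def gradient_matrix_def mm.scaleR_left mm.diff_left matrix_mul_assoc inv)
  have "4 *\<^sub>R (X + Y - (a *\<^sub>R P + b *\<^sub>R A)) - (1/2) *\<^sub>R (4 *\<^sub>R (X - b *\<^sub>R A) + 4 *\<^sub>R (Y - b *\<^sub>R A)) =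
      2 *\<^sub>R (X + Y) - (4 * a) *\<^sub>R P" for X Y :: "real^'n^'n" and a b
    by (simp add: vec_eq_iff algebra_simps)
  from this[of "A ** S ** P" "P ** S ** A" "trace (S ** A) / CARD('n)" "trace (S ** P) / CARD('n)"]
  have H: "N - (1/2) *\<^sub>R (A ** matrix_inv P ** G + G ** matrix_inv P ** A) = hessian_matrix S P A"
    unfolding AG GA N_def hessian_matrix_def by simp
  have "dp y (covariant_derivative g y u X) = dp y (frechet_derivative X (at y) u) + dp y (christoffel g y u (X y))"
    unfolding covariant_derivative_def by (rule linear_add[OF linear_dp[OF assms(1)]])
  also have "\<dots> = hessian_matrix S P A - t *\<^sub>R P"
    unfolding 1 dp_christoffel[OF assms(1)] H[symmetric] by (simp add: tangent_part_def acc t_def P_def[symmetric])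
  finally have eq: "dp y (covariant_derivative g y u X) = hessian_matrix S P A - t *\<^sub>R P" .
  have "trace (matrix_inv P ** dp y (covariant_derivative g y u X)) = 0"
    using dp_tangent[OF assms(1)] by (simp add: tangent_def P_def)
  moreover have "trace (matrix_inv P ** hessian_matrix S P A) = 0"
    using hessian_matrix_tangent[OF P S] dp_tangent[OF assms(1)] by (simp add: tangent_def P_def A_def)
  ultimately have "t = 0"
    using trace_matrix_inv_mult[OF P] by (simp add: eq mm.diff_right mm.scaleR_right trace_sub trace_scaleR)
  then show ?thesis using eq by (simp add: P_def A_def)
qed

lemma divergence_grad:
  assumes "y \<in> c ` U" and S: "transpose S = S" and X: "\<And>x. x \<in> c ` U \<Longrightarrow> X x = grad S x"
  shows "divergence g X y = 2 * (real CARD('n) + 1 - 2 / real CARD('n)) * trace (S ** p y)"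
proof -
  define P where "P = p y"
  have P: "P \<in> Pos1" unfolding P_def by (rule p_in(2)[OF assms(1)])
  \<comment> \<open>Symmetrising and projecting extends the operator from the tangent space to all
    matrices, so that \<open>trace_linear_cyclic\<close> can trade the basis of the model space for
    the matrix basis.\<close>
  define proj where "proj = (\<lambda>m. tangent_part P ((1/2) *\<^sub>R (m + transpose m)))"
  have proj: "proj m \<in> tangent P" for m
    unfolding proj_def by (rule tangent_part_in_tangent[OF P]) (simp add: transpose_scalar transpose_add add.commute)
  have proj_id: "proj A = A" if "A \<in> tangent P" for A
    using that by (simp add: proj_def tangent_def tangent_part_def scaleR_2[symmetric])
  have lin: "linear proj"
    by (auto simp: linear_iff proj_def tangent_part_def transpose_add transpose_scalar mm.add_right mm.scaleR_right
        trace_add trace_scaleR add_divide_distrib algebra_simps)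
  have lq: "linear (\<lambda>m. dr P (proj m))"
    using linear_compose[OF lin linear_dr[OF p_in(1)[OF assms(1)]]] by (simp add: comp_def P_def)
  have lF: "linear (\<lambda>u. hessian_matrix S P (dp y u))"
    using linear_compose[OF linear_dp[OF assms(1)] linear_hessian_matrix] by (simp add: comp_def)
  have "covariant_derivative g y u X = dr P (proj (hessian_matrix S P (dp y u)))" for u
  proof -
    have "covariant_derivative g y u X = dr P (hessian_matrix S P (dp y u))"
      using dr_dp[OF assms(1), of "covariant_derivative g y u X"] covariant_derivative_grad[OF assms, of u]
      by (simp add: P_def)
    then show ?thesis
      using proj_id hessian_matrix_tangent[OF P S] dp_tangent[OF assms(1)] by (simp add: P_def)
  qed
  then have "divergence g X y = (\<Sum>b\<in>Basis. dr P (proj (hessian_matrix S P (dp y b))) \<bullet> b)"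
    by (simp add: divergence_def)
  also have "\<dots> = (\<Sum>m\<in>Basis. hessian_matrix S P (dp y (dr P (proj m))) \<bullet> m)"
    using trace_linear_cyclic[OF lF lq] .
  also have "\<dots> = (\<Sum>m\<in>Basis. hessian_matrix S P (proj m) \<bullet> m)"
    using dp_dr[OF assms(1)] proj by (simp add: P_def)
  also have "\<dots> = 2 * (real CARD('n) + 1 - 2 / real CARD('n)) * trace (S ** P)"
    unfolding proj_def by (rule trace_hessian_matrix[OF P S])
  finally show ?thesis by (simp add: P_def)
qed

end

section \<open>The quadratic form and its zero set\<close>

definition outer :: "real^'n \<Rightarrow> real^'n \<Rightarrow> real^'n^'n" where
  "outer a b = (\<chi> i j. a $ i * b $ j)"

text \<open>With \<open>a = a1 + \<i> a2\<close>, the traces of \<open>re_form a1 a2 ** P\<close> and \<open>im_form a1 a2 ** P\<close> are the real and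
  the imaginary part of \<open>a\<^sup>t P a\<close>.\<close>
definition re_form :: "real^'n \<Rightarrow> real^'n \<Rightarrow> real^'n^'n" where
  "re_form a1 a2 = outer a1 a1 - outer a2 a2"

definition im_form :: "real^'n \<Rightarrow> real^'n \<Rightarrow> real^'n^'n" where
  "im_form a1 a2 = outer a1 a2 + outer a2 a1"

definition quad :: "real^'n \<Rightarrow> real^'n^'n \<Rightarrow> real^'n \<Rightarrow> real" where
  "quad a P b = a \<bullet> (P *v b)"

lemma transpose_outer: "transpose (outer a b) = outer b a"
  by (simp add: outer_def transpose_def vec_eq_iff mult.commute)

lemma transpose_re_form: "transpose (re_form a1 a2) = re_form a1 a2"
  by (simp add: re_form_def transpose_diff transpose_outer)

lemma transpose_im_form: "transpose (im_form a1 a2) = im_form a1 a2"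
  by (simp add: im_form_def transpose_add transpose_outer add.commute)

text \<open>Rank-one factors collapse, so traces of alternating products of the two forms with P
  become polynomials in the values of \<open>quad\<close> at a1 and a2.\<close>

lemma outer_mult_outer: "outer a b ** P ** outer e f = quad b P e *\<^sub>R outer a f"
proof -
  have "(outer a b ** P ** outer e f) $ i $ j = quad b P e * (a $ i * f $ j)" for i j
  proof -
    have "(outer a b ** P ** outer e f) $ i $ j = (\<Sum>k\<in>UNIV. (\<Sum>l\<in>UNIV. a $ i * b $ l * P $ l $ k) * (e $ k * f $ j))"
      by (simp add: matrix_matrix_mult_def outer_def)
    also have "\<dots> = (\<Sum>k\<in>UNIV. \<Sum>l\<in>UNIV. (b $ l * (P $ l $ k * e $ k)) * (a $ i * f $ j))"
      unfolding sum_distrib_right by (simp add: mult_ac)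
    also have "\<dots> = (\<Sum>l\<in>UNIV. \<Sum>k\<in>UNIV. (b $ l * (P $ l $ k * e $ k)) * (a $ i * f $ j))"
      by (rule sum.swap)
    also have "\<dots> = quad b P e * (a $ i * f $ j)"
      by (simp add: quad_def inner_vec_def matrix_vector_mult_def sum_distrib_left sum_distrib_right mult_ac)
    finally show ?thesis .
  qed
  then show ?thesis by (simp add: vec_eq_iff outer_def)
qed

lemma trace_outer_mult: "trace (outer a b ** P) = quad b P a"
proof -
  have "trace (outer a b ** P) = (\<Sum>i\<in>UNIV. \<Sum>l\<in>UNIV. a $ i * (b $ l * P $ l $ i))"
    by (simp add: trace_def matrix_matrix_mult_def outer_def mult_ac)
  also have "\<dots> = (\<Sum>l\<in>UNIV. \<Sum>i\<in>UNIV. a $ i * (b $ l * P $ l $ i))" by (rule sum.swap)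
  also have "\<dots> = quad b P a"
    by (simp add: quad_def inner_vec_def matrix_vector_mult_def sum_distrib_left mult_ac)
  finally show ?thesis .
qed

lemma quad_commute: "transpose P = P \<Longrightarrow> quad a P b = quad b P a"
  unfolding trace_outer_mult[symmetric]
  by (metis matrix_transpose_mul trace_mul_sym trace_transpose transpose_outer)

lemma quad_gram_pos:
  assumes "x \<in> SL" "a \<noteq> 0"
  shows "0 < quad a (gram x) a"
proof -
  have "quad a (gram x) a = (transpose x *v a) \<bullet> (transpose x *v a)"
    unfolding quad_def gram_def
    by (metis dot_lmul_matrix matrix_vector_mul_assoc transpose_matrix_vector)
  moreover have "transpose x *v a \<noteq> 0"
  proof
    assume "transpose x *v a = 0"
    then have "(transpose (matrix_inv x) ** transpose x) *v a = 0"
      by (metis matrix_vector_mul_assoc matrix_vector_mult_0_right)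
    then show False using SL_matrix_inv(3)[OF assms(1)] assms(2) by simp
  qed
  ultimately show ?thesis by simp
qed

lemma trace_forms:
  assumes "transpose P = P"
  shows "trace (re_form a1 a2 ** P) = quad a1 P a1 - quad a2 P a2"
    "trace (im_form a1 a2 ** P) = 2 * quad a1 P a2"
    "trace (re_form a1 a2 ** P ** re_form a1 a2 ** P) =
      (quad a1 P a1)\<^sup>2 - 2 * (quad a1 P a2)\<^sup>2 + (quad a2 P a2)\<^sup>2"
    "trace (im_form a1 a2 ** P ** im_form a1 a2 ** P) =
      2 * quad a1 P a1 * quad a2 P a2 + 2 * (quad a1 P a2)\<^sup>2"
    "trace (re_form a1 a2 ** P ** im_form a1 a2 ** P) =
      2 * quad a1 P a2 * (quad a1 P a1 - quad a2 P a2)"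
  using quad_commute[OF assms, of a2 a1]
  by (simp_all add: re_form_def im_form_def mm.add_left mm.add_right mm.diff_left mm.diff_right
      outer_mult_outer trace_add trace_sub trace_scaleR trace_outer_mult mm.scaleR_left
      power2_eq_square algebra_simps)

text \<open>Up to a factor these are Hessians evaluated in gradient directions. At a zero, a1 and a2
  are P-orthogonal of equal P-length, so T P T is the same multiple of
  \<open>outer a1 a1 + outer a2 a2\<close> for both forms, and the trace of either form against it
  is 0.\<close>

lemma trace_cubic_forms_zero:
  assumes "transpose P = P" "quad a1 P a2 = 0" "quad a1 P a1 = quad a2 P a2"
    and "S \<in> {re_form a1 a2, im_form a1 a2}" "T \<in> {re_form a1 a2, im_form a1 a2}"
  shows "trace (S ** P ** T ** P ** T ** P) = 0"
proof -
  have 21: "quad a2 P a1 = 0" using quad_commute[OF assms(1), of a2 a1] assms(2) by simp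
  have TT: "T ** P ** T = quad a2 P a2 *\<^sub>R (outer a1 a1 + outer a2 a2)"
    using assms(5) by (auto simp: re_form_def im_form_def mm.add_left mm.add_right mm.diff_left mm.diff_right
      outer_mult_outer assms(2,3) 21 scaleR_add_right)
  have "S ** P ** T ** P ** T ** P = S ** P ** (T ** P ** T) ** P" by (simp add: matrix_mul_assoc)
  also have "trace \<dots> = quad a2 P a2 * trace (S ** P ** (outer a1 a1 + outer a2 a2) ** P)"
    unfolding TT by (simp add: mm.scaleR_right mm.scaleR_left trace_scaleR)
  also have "trace (S ** P ** (outer a1 a1 + outer a2 a2) ** P) = 0"
    using assms(4) by (auto simp: re_form_def im_form_def mm.add_left mm.add_right mm.diff_left mm.diff_right
      outer_mult_outer assms(2,3) 21 mm.scaleR_left mm.minus_left trace_add trace_sub trace_scaleR trace_outer_mult)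
  finally show ?thesis by simp
qed

text \<open>The coefficients of a vector in F are its inner products with F, so both sides are the
  trace of L. This compares the divergence, taken in coordinates, with a frame adapted to the zero
  set.\<close>

lemma sum_orthonormal_trace:
  fixes gy :: "'e::euclidean_space \<Rightarrow> 'e \<Rightarrow> real"
  assumes bil: "bilinear gy" and fin: "finite F" and span: "span F = UNIV"
    and on: "\<And>u v. u \<in> F \<Longrightarrow> v \<in> F \<Longrightarrow> gy u v = (if u = v then 1 else 0)" and L: "linear L"
  shows "(\<Sum>e\<in>F. gy (L e) e) = (\<Sum>b\<in>Basis. L b \<bullet> b)"
proof -
  have expand: "v = (\<Sum>e\<in>F. gy v e *\<^sub>R e)" for v
  proof -
    have "v \<in> span F" using span by simp
    then obtain k where k: "v = (\<Sum>e\<in>F. k e *\<^sub>R e)" unfolding span_finite[OF fin] by auto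
    have "gy v e = k e" if "e \<in> F" for e
    proof -
      have lin: "linear (\<lambda>u. gy u e)" using bil by (simp add: bilinear_def)
      have "gy v e = (\<Sum>u\<in>F. k u * gy u e)"
        using linear_sum[OF lin, of "\<lambda>u. k u *\<^sub>R u" F] linear_scale[OF lin] by (simp add: k)
      also have "\<dots> = (\<Sum>u\<in>F. if u = e then k u else 0)" using that by (intro sum.cong) (auto simp: on)
      finally show ?thesis using that fin by simp
    qed
    then show ?thesis using k by simp
  qed
  have "(\<Sum>b\<in>Basis. L b \<bullet> b) = (\<Sum>b\<in>Basis. \<Sum>e\<in>F. (e \<bullet> b) * gy (L b) e)"
    by (subst expand) (simp add: inner_sum_left mult.commute)
  also have "\<dots> = (\<Sum>e\<in>F. \<Sum>b\<in>Basis. (e \<bullet> b) * gy (L b) e)" by (rule sum.swap)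
  also have "\<dots> = (\<Sum>e\<in>F. gy (L e) e)"
  proof (rule sum.cong[OF refl])
    fix e
    have lin: "linear (\<lambda>u. gy (L u) e)"
      using linear_compose[OF L, of "\<lambda>u. gy u e"] bil by (simp add: bilinear_def comp_def)
    show "(\<Sum>b\<in>Basis. (e \<bullet> b) * gy (L b) e) = gy (L e) e"
      using linear_sum[OF lin, of "\<lambda>b. (e \<bullet> b) *\<^sub>R b" Basis] linear_scale[OF lin]
      by (simp add: euclidean_representation)
  qed
  finally show ?thesis by simp
qed

section \<open>Eigenfunction equations, regularity of the zero set and minimality\<close>

context chart_param
begin

lemma metric_grad_grad:
  assumes y: "y \<in> c ` U" and S: "transpose S = S" and T: "transpose T = T"
  shows "g y (grad S y) (grad T y) =
    4 * (trace (S ** p y ** T ** p y) - trace (S ** p y) * trace (T ** p y) / CARD('n))"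
  by (simp add: metric_grad[OF y S] dp_grad[OF y T] gradient_matrix_def mm.scaleR_right mm.diff_right
      trace_scaleR trace_sub matrix_mul_assoc)

text \<open>The first constant is that of \<open>divergence_grad\<close>. For the second, a a^t has
  rank one, so the complex bilinear extension of trace (S P S P) at S = a a^t equals (a^t P a)^2, as
  does the square of trace (S P); this leaves 4 - 4/n.\<close>

lemma eigenfunction_local:
  assumes f: "\<And>z. z \<in> c ` U \<Longrightarrow> f z = Complex (trace (re_form a1 a2 ** p z)) (trace (im_form a1 a2 ** p z))"
    and y: "y \<in> c ` U"
  shows "laplace_beltrami g f y = complex_of_real (2 * (real CARD('n) + 1 - 2 / real CARD('n))) * f y"
    "conformality g f f y = complex_of_real (4 * (1 - 1 / real CARD('n))) * (f y)\<^sup>2"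
proof -
  have gR: "gradient g (\<lambda>x. Re (f x)) z = grad (re_form a1 a2) z" if "z \<in> c ` U" for z
    by (rule gradient_eq[OF that transpose_re_form]) (simp add: f)
  have gI: "gradient g (\<lambda>x. Im (f x)) z = grad (im_form a1 a2) z" if "z \<in> c ` U" for z
    by (rule gradient_eq[OF that transpose_im_form]) (simp add: f)
  show "laplace_beltrami g f y = complex_of_real (2 * (real CARD('n) + 1 - 2 / real CARD('n))) * f y"
    using divergence_grad[OF y transpose_re_form gR] divergence_grad[OF y transpose_im_form gI]
    by (simp add: laplace_beltrami_def f[OF y] complex_eq_iff)
  have sym: "transpose (p y) = p y" by (rule Pos1_facts(1)[OF p_in(2)[OF y]])
  have comm: "trace (im_form a1 a2 ** p y ** re_form a1 a2 ** p y) = trace (re_form a1 a2 ** p y ** im_form a1 a2 ** p y)"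
    using trace_mul_sym[of "im_form a1 a2 ** p y" "re_form a1 a2 ** p y"] by (simp add: matrix_mul_assoc)
  show "conformality g f f y = complex_of_real (4 * (1 - 1 / real CARD('n))) * (f y)\<^sup>2"
    unfolding conformality_def Let_def gR[OF y] gI[OF y]
    by (simp add: metric_grad_grad[OF y] transpose_re_form transpose_im_form comm trace_forms[OF sym] f[OF y]
        complex_eq_iff power2_eq_square)
      (simp add: field_simps)
qed

lemma smooth_local:
  assumes f: "\<And>z. z \<in> c ` U \<Longrightarrow> f z = Complex (trace (R ** p z)) (trace (S ** p z))"
  shows "smooth_on (c ` U) f"
proof (rule smooth_on_cong_imp[OF open_image])
  have "smooth_on (c ` U) (\<lambda>z. trace (R ** p z))" for R
    by (intro smooth_on_bounded_linear_compose[OF bounded_linear_trace open_image]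
        smooth_on_bounded_linear_compose[OF mm.bounded_linear_right open_image] smooth_p)
  then have s: "smooth_on (c ` U) (\<lambda>z. trace (R ** p z) *\<^sub>R w)" for R and w :: complex
    by (rule smooth_on_bounded_linear_compose[OF bounded_linear_scaleR_left open_image])
  show "smooth_on (c ` U) (\<lambda>z. trace (R ** p z) *\<^sub>R 1 + trace (S ** p z) *\<^sub>R \<i>)"
    by (intro smooth_on_add open_image s)
qed (simp add: f complex_eq_iff)

text \<open>Orthogonal vectors of equal nonzero length split off a plane by the explicit projection
  in the third claim, so their common orthogonal complement has codimension two.\<close>

lemma kernel_orthogonal_pair:
  assumes y: "y \<in> c ` U" and m: "0 < m" and gRR: "g y Rv Rv = m" and gII: "g y Iv Iv = m" and gRI: "g y Rv Iv = 0"
  shows "subspace {w. g y Rv w = 0 \<and> g y Iv w = 0}"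
    "dim {w. g y Rv w = 0 \<and> g y Iv w = 0} + 2 = DIM('e)"
    "w - (g y Rv w / m) *\<^sub>R Rv - (g y Iv w / m) *\<^sub>R Iv \<in> {w. g y Rv w = 0 \<and> g y Iv w = 0}"
proof -
  define K where "K = {w. g y Rv w = 0 \<and> g y Iv w = 0}"
  have gIR: "g y Iv Rv = 0" using gRI metric_commute[OF y] by simp
  note bil = metric_linear[OF y]
  note bil_simps = bilinear_rmul[OF bil] bilinear_rsub[OF bil]
  have linR: "linear (g y Rv)" and linI: "linear (g y Iv)" using bil by (auto simp: bilinear_def)
  have subK: "subspace K"
    unfolding K_def subspace_def
    by (auto simp: linear_0[OF linR] linear_0[OF linI] linear_add[OF linR] linear_add[OF linI] linear_scale[OF linR] linear_scale[OF linI])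
  have split: "w - (g y Rv w / m) *\<^sub>R Rv - (g y Iv w / m) *\<^sub>R Iv \<in> K" for w
    using m by (simp add: K_def bil_simps gRR gII gRI gIR)
  have "span (insert Rv (insert Iv K)) = UNIV"
  proof -
    have "w \<in> span (insert Rv (insert Iv K))" for w
    proof -
      have "(w - (g y Rv w / m) *\<^sub>R Rv - (g y Iv w / m) *\<^sub>R Iv) + (g y Rv w / m) *\<^sub>R Rv + (g y Iv w / m) *\<^sub>R Iv
          \<in> span (insert Rv (insert Iv K))"
        using split[of w] by (intro span_add span_scale) (auto intro: span_base)
      then show ?thesis by simp
    qed
    then show ?thesis by blast
  qed
  then have "dim (insert Rv (insert Iv K)) = DIM('e)" by (metis dim_span dim_UNIV)
  moreover have "dim (insert Rv (insert Iv K)) \<le> dim K + 2"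
    by (simp add: dim_insert)
  ultimately have "dim K \<ge> DIM('e) - 2" by simp
  moreover have "dim K + 2 \<le> DIM('e)"
  proof -
    have Iv: "Iv \<notin> span K"
      using gII m subK by (simp add: span_eq_iff[THEN iffD2] K_def)
    have Rv: "Rv \<notin> span (insert Iv K)"
    proof
      assume "Rv \<in> span (insert Iv K)"
      then obtain k where "Rv - k *\<^sub>R Iv \<in> span K" using span_breakdown_eq by blast
      then have "g y Rv (Rv - k *\<^sub>R Iv) = 0" using subK by (simp add: span_eq_iff[THEN iffD2] K_def)
      then show False using m by (simp add: bil_simps gRR gRI)
    qed
    have "dim (insert Rv (insert Iv K)) = dim K + 2" using Iv Rv by (simp add: dim_insert)
    then show ?thesis by (metis dim_subset_UNIV)
  qed
  ultimately have dimK: "dim K + 2 = DIM('e)" by linarith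
  show "subspace {w. g y Rv w = 0 \<and> g y Iv w = 0}" using subK by (simp add: K_def)
  show "dim {w. g y Rv w = 0 \<and> g y Iv w = 0} + 2 = DIM('e)" using dimK by (simp add: K_def)
  show "w - (g y Rv w / m) *\<^sub>R Rv - (g y Iv w / m) *\<^sub>R Iv \<in> {w. g y Rv w = 0 \<and> g y Iv w = 0}"
    using split[of w] by (simp add: K_def)
qed

text \<open>Shows that 0 is a regular value. With q = \<open>quad a2 (p y) a2\<close>, the 8 is the
  4 of \<open>metric_grad_grad\<close> times the 2 in trace (S P S P) = 2 q^2, valid at a zero for
  both forms S.\<close>

lemma zero_set_gradients:
  fixes a1 a2 :: "real^'n"
  assumes y: "y \<in> c ` U" and a2: "a2 \<noteq> 0"
    and zero: "trace (re_form a1 a2 ** p y) = 0" "trace (im_form a1 a2 ** p y) = 0"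
  shows "quad a1 (p y) a2 = 0" "quad a1 (p y) a1 = quad a2 (p y) a2" "0 < 8 * (quad a2 (p y) a2)\<^sup>2"
    "g y (grad (re_form a1 a2) y) (grad (re_form a1 a2) y) = 8 * (quad a2 (p y) a2)\<^sup>2"
    "g y (grad (im_form a1 a2) y) (grad (im_form a1 a2) y) = 8 * (quad a2 (p y) a2)\<^sup>2"
    "g y (grad (re_form a1 a2) y) (grad (im_form a1 a2) y) = 0"
proof -
  have P: "p y \<in> Pos1" by (rule p_in(2)[OF y])
  have symP: "transpose (p y) = p y" by (rule Pos1_facts(1)[OF P])
  show q12: "quad a1 (p y) a2 = 0" using zero(2) by (simp add: trace_forms[OF symP])
  show q11: "quad a1 (p y) a1 = quad a2 (p y) a2" using zero(1) by (simp add: trace_forms[OF symP])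
  have "0 < quad a2 (p y) a2" using P quad_gram_pos a2 by (auto simp: Pos1_def)
  then show "0 < 8 * (quad a2 (p y) a2)\<^sup>2" by simp
  show "g y (grad (re_form a1 a2) y) (grad (re_form a1 a2) y) = 8 * (quad a2 (p y) a2)\<^sup>2"
    "g y (grad (im_form a1 a2) y) (grad (im_form a1 a2) y) = 8 * (quad a2 (p y) a2)\<^sup>2"
    "g y (grad (re_form a1 a2) y) (grad (im_form a1 a2) y) = 0"
    by (simp_all add: metric_grad_grad[OF y] transpose_re_form transpose_im_form zero)
      (simp_all add: trace_forms[OF symP] q12 q11 power2_eq_square)
qed

text \<open>If \<open>L\<close> is the tangent space in a slice chart, the mean curvature vector is tangent to \<open>L\<close>, hence
  its normal part vanishes: the trace over \<open>L\<close> of the Hessian of the real and of the imaginary part is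
  the full Laplacian minus the contributions of the two gradients, and both are zero.\<close>
lemma minimal_local:
  fixes a1 a2 :: "real^'n"
  assumes a2: "a2 \<noteq> 0"
    and zero: "\<And>q. q \<in> U \<Longrightarrow> q \<in> N \<longleftrightarrow> trace (re_form a1 a2 ** cpos q) = 0 \<and> trace (im_form a1 a2 ** cpos q) = 0"
    and slice: "slice_chart N 2 (U, c) L" and q: "q \<in> N \<inter> U"
    and E: "orthonormal_basis g L (c q) E"
  shows "(\<Sum>e\<in>E. second_fundamental_form g L (c q) e e) = 0"
proof -
  define y where "y = c q"
  define P where "P = p y"
  define R where "R = re_form a1 a2"
  define I where "I = im_form a1 a2"
  define Rv where "Rv = grad R y"
  define Iv where "Iv = grad I y"
  have y: "y \<in> c ` U" using q by (auto simp: y_def)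
  have P: "P \<in> Pos1" unfolding P_def by (rule p_in(2)[OF y])
  have symP: "transpose P = P" by (rule Pos1_facts(1)[OF P])
  have symR: "transpose R = R" unfolding R_def by (rule transpose_re_form)
  have symI: "transpose I = I" unfolding I_def by (rule transpose_im_form)
  have L: "subspace L" "dim L + 2 = DIM('e)" and NL: "\<And>q. q \<in> U \<Longrightarrow> q \<in> N \<longleftrightarrow> c q \<in> L"
    using slice by (auto simp: slice_chart_def)
  have NyL: "trace (R ** p z) = 0 \<and> trace (I ** p z) = 0" if "z \<in> c ` U" "z \<in> L" for z
    using that zero NL by (auto simp: R_def I_def)
  have yL: "y \<in> L" using q NL[of q] by (simp add: y_def)
  have R0: "trace (R ** P) = 0" and I0: "trace (I ** P) = 0" using NyL[OF y yL] by (auto simp: P_def)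
  note zg = zero_set_gradients[OF y a2, of a1, folded P_def R_def I_def, folded Rv_def Iv_def, OF R0 I0]
  define m where "m = 8 * (quad a2 P a2)\<^sup>2"
  note q12 = zg(1) and q11 = zg(2) and m = zg(3)[folded m_def] and gRR = zg(4)[folded m_def]
    and gII = zg(5)[folded m_def] and gRI = zg(6)
  have gIR: "g y Iv Rv = 0" using gRI metric_commute[OF y] by simp
  note bil = metric_linear[OF y]
  note bil_simps = bilinear_lmul[OF bil] bilinear_rmul[OF bil] bilinear_ladd[OF bil] bilinear_radd[OF bil]
    bilinear_lsub[OF bil] bilinear_rsub[OF bil]
  \<comment> \<open>L is linear and contains y, so the line t \<mapsto> y + t e stays in L and,
    while inside the chart, in N. The functions trace (S p) vanish along it, and so do their first
    and second derivatives.\<close>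
  have tangent_L: "g y Rv e = 0 \<and> g y Iv e = 0 \<and> trace (R ** ddp y e e) = 0 \<and> trace (I ** ddp y e e) = 0" if e: "e \<in> L" for e
  proof -
    have "trace (S ** dp y e) = 0 \<and> trace (S ** ddp y e e) = 0" if "S \<in> {R, I}" for S
    proof -
      define l where "l = (\<lambda>t. y + t *\<^sub>R e)"
      define O' where "O' = l -` (c ` U)"
      have cont: "continuous_on UNIV l" unfolding l_def by (intro continuous_intros)
      have O: "open O'" unfolding O'_def using open_vimage[OF open_image cont] .
      have O0: "0 \<in> O'" using y by (simp add: O'_def l_def)
      have l: "(l has_derivative (\<lambda>t. t *\<^sub>R e)) (at t)" for t
        unfolding l_def by (auto intro!: derivative_eq_intros)
      have lL: "l t \<in> L" for t unfolding l_def using L(1) yL e by (simp add: subspace_add subspace_scale)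
      have f0: "trace (S ** p (l t)) = 0" if "t \<in> O'" for t
        using NyL[of "l t"] lL that \<open>S \<in> {R, I}\<close> by (auto simp: O'_def)
      have d1: "trace (S ** dp (l t) e) = 0" if t: "t \<in> O'" for t
      proof -
        have lt: "l t \<in> c ` U" using t by (simp add: O'_def)
        have der: "((\<lambda>t. trace (S ** p (l t))) has_derivative (\<lambda>h. trace (S ** dp (l t) (h *\<^sub>R e)))) (at t)"
          by (rule has_derivative_compose[OF l has_derivative_trace_p[OF lt refl]])
        have "(\<lambda>h. trace (S ** dp (l t) (h *\<^sub>R e))) = (\<lambda>h. 0)"
          by (rule frechet_derivative_unique_on_open[OF O t f0 der has_derivative_const])
        then have "trace (S ** dp (l t) (1 *\<^sub>R e)) = 0" by meson
        then show ?thesis by simp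
      qed
      have "((\<lambda>x. trace (S ** dp x e)) has_derivative (\<lambda>u. trace (S ** ddp y u e))) (at (l 0))"
        using bounded_linear.has_derivative[OF bounded_linear_compose[OF bounded_linear_trace mm.bounded_linear_right] has_derivative_dp[OF y]]
        by (simp add: l_def)
      from has_derivative_compose[OF l this]
      have der: "((\<lambda>t. trace (S ** dp (l t) e)) has_derivative (\<lambda>h. trace (S ** ddp y (h *\<^sub>R e) e))) (at 0)" .
      have "(\<lambda>h. trace (S ** ddp y (h *\<^sub>R e) e)) = (\<lambda>h. 0)"
        by (rule frechet_derivative_unique_on_open[OF O O0 d1 der has_derivative_const])
      then have "trace (S ** ddp y (1 *\<^sub>R e) e) = 0" by meson
      moreover have "trace (S ** dp y e) = 0" using d1[OF O0] by (simp add: l_def)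
      ultimately show ?thesis by simp
    qed
    then show ?thesis unfolding Rv_def Iv_def by (simp add: metric_grad[OF y symR] metric_grad[OF y symI])
  qed
  define K where "K = {w. g y Rv w = 0 \<and> g y Iv w = 0}"
  note ker = kernel_orthogonal_pair[OF y m gRR gII gRI, folded K_def]
  have "L \<subseteq> K" using tangent_L by (auto simp: K_def)
  then have LK: "L = K"
    using subspace_dim_equal[OF L(1) ker(1)] L(2) ker(2) by simp
  note split = ker(3)
  have finE: "finite E" and spanE: "span E = L" and onE: "\<And>u v. u \<in> E \<Longrightarrow> v \<in> E \<Longrightarrow> g y u v = (if u = v then 1 else 0)"
    using E by (auto simp: orthonormal_basis_def y_def)
  have EL: "E \<subseteq> L" using spanE span_superset by blast
  define r where "r = 1 / sqrt m"
  have r: "r * r * m = 1" "r \<noteq> 0" using m by (auto simp: r_def field_simps real_sqrt_mult_self)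
  define n1 where "n1 = r *\<^sub>R Rv"
  define n2 where "n2 = r *\<^sub>R Iv"
  \<comment> \<open>The two unit normals complete E to an orthonormal basis of the full tangent
    space.\<close>
  define F where "F = insert n1 (insert n2 E)"
  have n_on: "g y n1 n1 = 1" "g y n2 n2 = 1" "g y n1 n2 = 0" "g y n2 n1 = 0"
    using r by (simp_all add: n1_def n2_def bil_simps gRR gII gRI gIR mult.assoc)
  have nE: "g y n1 e = 0" "g y n2 e = 0" "g y e n1 = 0" "g y e n2 = 0" if "e \<in> E" for e
    using tangent_L[of e] that EL metric_commute[OF y, of e] by (auto simp: n1_def n2_def bil_simps)
  have notin: "n1 \<notin> E" "n2 \<notin> E" "n1 \<noteq> n2" using nE(1)[of n1] nE(2)[of n2] n_on by auto
  have onF: "g y u v = (if u = v then 1 else 0)" if "u \<in> F" "v \<in> F" for u v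
    using that onE nE n_on notin unfolding F_def by auto
  have spanF: "span F = UNIV"
  proof -
    have "w \<in> span F" for w
    proof -
      have "K \<subseteq> span F" using LK spanE span_mono[of E F] by (auto simp: F_def)
      moreover have "n1 \<in> span F" "n2 \<in> span F" by (auto simp: F_def intro: span_base)
      then have "(1 / r) *\<^sub>R n1 \<in> span F" "(1 / r) *\<^sub>R n2 \<in> span F" by (auto intro: span_scale)
      then have "Rv \<in> span F" "Iv \<in> span F" using r by (simp_all add: n1_def n2_def)
      ultimately have "(w - (g y Rv w / m) *\<^sub>R Rv - (g y Iv w / m) *\<^sub>R Iv) + (g y Rv w / m) *\<^sub>R Rv + (g y Iv w / m) *\<^sub>R Iv \<in> span F"
        using split[of w] by (intro span_add span_scale) auto
      then show ?thesis by simp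
    qed
    then show ?thesis by blast
  qed
  \<comment> \<open>The trace of the Hessian over F is the Laplacian, a multiple of trace (S P) = 0.
    The two normal terms vanish by \<open>trace_cubic_forms_zero\<close>, leaving the sum over
    E.\<close>
  have hess: "(\<Sum>e\<in>E. trace (S ** dp y e ** matrix_inv P ** dp y e)) = 0" if S: "S \<in> {R, I}" for S
  proof -
    have symS: "transpose S = S" and S0: "trace (S ** P) = 0" using S symR symI R0 I0 by auto
    define Lc where "Lc = (\<lambda>u. covariant_derivative g y u (grad S))"
    have dpL: "dp y (Lc u) = hessian_matrix S P (dp y u)" for u
      unfolding Lc_def P_def by (rule covariant_derivative_grad[OF y symS refl])
    have "Lc = (\<lambda>u. dr P (hessian_matrix S P (dp y u)))"
      using dr_dp[OF y] dpL by (metis P_def)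
    then have linL: "linear Lc"
      using linear_compose[OF linear_compose[OF linear_dp[OF y] linear_hessian_matrix[of S P]] linear_dr[OF p_in(1)[OF y]]]
      by (simp add: comp_def P_def)
    have gL: "g y (Lc u) u = trace (S ** dp y u ** matrix_inv P ** dp y u)" for u
      using trace_form_hessian_matrix[OF P] dp_tangent[OF y] by (simp add: quotient_metric_eq[OF y] dpL P_def)
    have "(\<Sum>e\<in>F. g y (Lc e) e) = (\<Sum>b\<in>Basis. Lc b \<bullet> b)"
      by (rule sum_orthonormal_trace[OF bil _ spanF onF linL]) (simp add: F_def finE)
    also have "\<dots> = 0"
      using divergence_grad[OF y symS refl] S0 by (simp add: divergence_def Lc_def P_def)
    finally have "g y (Lc n1) n1 + (g y (Lc n2) n2 + (\<Sum>e\<in>E. g y (Lc e) e)) = 0"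
      using notin finE by (simp add: F_def)
    moreover have norm0: "g y (Lc (r *\<^sub>R grad T y)) (r *\<^sub>R grad T y) = 0" if T: "T \<in> {R, I}" for T
    proof -
      have symT: "transpose T = T" and T0: "trace (T ** P) = 0" using T symR symI R0 I0 by auto
      \<comment> \<open>The correction by a multiple of P drops out of the gradient because trace (T
        P) = 0.\<close>
      have "dp y (grad T y) = 4 *\<^sub>R (P ** T ** P)"
        using dp_grad[OF y symT] T0 by (simp add: gradient_matrix_def P_def)
      then have "dp y (r *\<^sub>R grad T y) = (4 * r) *\<^sub>R (P ** T ** P)"
        using linear_scale[OF linear_dp[OF y]] by simp
      then have "g y (Lc (r *\<^sub>R grad T y)) (r *\<^sub>R grad T y) = (4 * r) * (4 * r) * trace (S ** P ** T ** P ** T ** P)"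
        by (simp add: gL mm.scaleR_left mm.scaleR_right trace_scaleR matrix_mul_assoc Pos1_inverse[OF P])
      also have "trace (S ** P ** T ** P ** T ** P) = 0"
        using trace_cubic_forms_zero[OF symP q12 q11] S T by (simp add: R_def I_def)
      finally show ?thesis by simp
    qed
    ultimately show ?thesis
      using norm0[of R] norm0[of I] by (simp add: n1_def n2_def Rv_def Iv_def gL)
  qed
  \<comment> \<open>For fields with constant components the covariant derivative is the Christoffel
    term, so the trace of the second fundamental form is the normal part of H.\<close>
  define H where "H = (\<Sum>e\<in>E. christoffel g y e e)"
  have "g y (grad S y) H = 0" if S: "S \<in> {R, I}" for S
  proof -
    have symS: "transpose S = S" and S0: "trace (S ** P) = 0" using S symR symI R0 I0 by auto
    have lin: "linear (g y (grad S y))" using bil by (simp add: bilinear_def)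
    \<comment> \<open>Since trace (S \<open>ddp y e e\<close>) vanishes on L, only the quadratic
      term of the acceleration survives, and it is minus the Hessian of the function.\<close>
    have "g y (grad S y) (christoffel g y e e) = - trace (S ** dp y e ** matrix_inv P ** dp y e)" if e: "e \<in> E" for e
    proof -
      have "g y (grad S y) (christoffel g y e e) = trace (S ** tangent_part P (acceleration y e e))"
        by (simp add: metric_grad[OF y symS] dp_christoffel[OF y] P_def)
      also have "\<dots> = trace (S ** acceleration y e e)"
        using S0 by (simp add: tangent_part_def mm.diff_right mm.scaleR_right trace_sub trace_scaleR)
      also have "acceleration y e e = ddp y e e - dp y e ** matrix_inv P ** dp y e"
        by (simp add: acceleration_def P_def scaleR_2[symmetric])
      also have "trace (S ** \<dots>) = - trace (S ** dp y e ** matrix_inv P ** dp y e)"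
        using tangent_L[of e] e EL S by (auto simp: mm.diff_right trace_sub matrix_mul_assoc)
      finally show ?thesis .
    qed
    then show ?thesis
      using hess[OF S] by (simp add: H_def linear_sum[OF lin] sum_negf)
  qed
  then have HL: "H \<in> L" unfolding LK K_def Rv_def Iv_def by simp
  \<comment> \<open>Existence and uniqueness of the orthogonal splitting justify the definite
    description in \<open>normal_part\<close>.\<close>
  have normal: "\<exists>\<nu>. w - \<nu> \<in> L \<and> (\<forall>v\<in>L. g y \<nu> v = 0)" for w
  proof (intro exI conjI ballI)
    show "w - ((g y Rv w / m) *\<^sub>R Rv + (g y Iv w / m) *\<^sub>R Iv) \<in> L"
      using split[of w] LK by (simp add: algebra_simps)
    show "g y ((g y Rv w / m) *\<^sub>R Rv + (g y Iv w / m) *\<^sub>R Iv) v = 0" if "v \<in> L" for v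
      using tangent_L[OF that] by (simp add: bil_simps)
  qed
  have normal_unique: "\<nu> = \<nu>'" if "w - \<nu> \<in> L" "\<forall>v\<in>L. g y \<nu> v = 0" "w - \<nu>' \<in> L" "\<forall>v\<in>L. g y \<nu>' v = 0" for w \<nu> \<nu>'
  proof -
    have "\<nu> - \<nu>' \<in> L" using subspace_diff[OF L(1) that(3,1)] by simp
    then have "g y (\<nu> - \<nu>') (\<nu> - \<nu>') = 0" using that(2,4) by (simp add: bilinear_lsub[OF bil])
    then show ?thesis using metric_pos[OF y, of "\<nu> - \<nu>'"] by fastforce
  qed
  have np: "w - normal_part g L y w \<in> L \<and> (\<forall>v\<in>L. g y (normal_part g L y w) v = 0)" for w
    unfolding normal_part_def by (rule theI') (use normal normal_unique in blast)
  have cov: "covariant_derivative g y e (\<lambda>_. e) = christoffel g y e e" for e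
    by (simp add: covariant_derivative_def)
  have "(\<Sum>e\<in>E. second_fundamental_form g L y e e) = (\<Sum>e\<in>E. normal_part g L y (christoffel g y e e))" (is "?N = _")
    by (simp add: second_fundamental_form_def cov)
  moreover have "H - (\<Sum>e\<in>E. normal_part g L y (christoffel g y e e)) \<in> L"
    unfolding H_def sum_subtractf[symmetric] using np by (intro subspace_sum[OF L(1)]) blast
  moreover have "\<forall>v\<in>L. g y (\<Sum>e\<in>E. normal_part g L y (christoffel g y e e)) v = 0"
  proof
    fix v assume "v \<in> L"
    have lin: "linear (\<lambda>u. g y u v)" using bil by (simp add: bilinear_def)
    show "g y (\<Sum>e\<in>E. normal_part g L y (christoffel g y e e)) v = 0"
      using np \<open>v \<in> L\<close> by (simp add: linear_sum[OF lin])
  qed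
  \<comment> \<open>The sum and 0 are both normal parts of H, because H lies in L.\<close>
  ultimately have "?N = 0"
    using normal_unique[of H ?N 0] HL by (simp add: bilinear_lzero[OF bil])
  then show ?thesis by (simp add: y_def)
qed

end

section \<open>Lengths of curves\<close>

text \<open>The derivative may be unbounded, so the fundamental theorem is used for the gauge
  integral. If the integral of |h'| is infinite the bound is trivial; otherwise h' is Lebesgue
  integrable and both integrals agree.\<close>

lemma nn_integral_lower_bound:
  fixes h :: "real \<Rightarrow> real"
  assumes S: "finite S" and cont: "continuous_on {0..1} h"
    and der: "\<And>t. t \<in> {0<..<1} - S \<Longrightarrow> (h has_vector_derivative h' t) (at t)"
    and bound: "\<And>t. t \<in> {0<..<1} - S \<Longrightarrow> \<bar>h' t\<bar> \<le> s t"
  shows "ennreal (h 1 - h 0) \<le> (\<integral>\<^sup>+t\<in>{0..1}. ennreal (s t) \<partial>lborel)"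
proof -
  have int: "(h' has_integral (h 1 - h 0)) {0..1}"
    by (rule fundamental_theorem_of_calculus_interior_strong[OF S _ der cont]) auto
  define J where "J = (\<integral>\<^sup>+t. ennreal \<bar>h' t\<bar> \<partial>lebesgue_on {0..1})"
  have meas: "h' \<in> borel_measurable (lebesgue_on {0..1})"
    using int by (intro integrable_imp_measurable) (auto simp: integrable_on_def)
  have 1: "ennreal (h 1 - h 0) \<le> J"
  proof (cases "J < \<infinity>")
    case True
    then have "integrable (lebesgue_on {0..1}) h'"
      using meas by (intro integrableI_bounded) (auto simp: J_def)
    then have "h 1 - h 0 = (LINT t|lebesgue_on {0..1}. h' t)"
      using lebesgue_integral_eq_integral[of "{0..1::real}" h'] int integral_unique[OF int] by simp
    also have "\<dots> \<le> (LINT t|lebesgue_on {0..1}. \<bar>h' t\<bar>)"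
      using \<open>integrable (lebesgue_on {0..1}) h'\<close> by (intro integral_mono) auto
    also have "ennreal \<dots> = J"
      unfolding J_def using \<open>integrable (lebesgue_on {0..1}) h'\<close> by (intro nn_integral_eq_integral[symmetric]) auto
    finally show ?thesis by (simp add: ennreal_leI)
  next
    case False
    then have "J = top" by (simp add: less_top[symmetric])
    then show ?thesis by simp
  qed
  have "J = (\<integral>\<^sup>+t\<in>{0..1}. ennreal \<bar>h' t\<bar> \<partial>lebesgue)"
    unfolding J_def by (intro nn_integral_restrict_space) auto
  also have "\<dots> = (\<integral>\<^sup>+t\<in>{0..1}. ennreal \<bar>h' t\<bar> \<partial>lborel)"
    by (rule nn_integral_completion)
  also have "\<dots> \<le> (\<integral>\<^sup>+t\<in>{0..1}. ennreal (s t) \<partial>lborel)"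
  proof (rule nn_integral_mono_AE)
    have "AE t in lborel. t \<notin> S \<union> {0, 1}"
      using S by (intro AE_not_in finite_imp_null_set_lborel) auto
    then show "AE t in lborel. ennreal \<bar>h' t\<bar> * indicator {0..1} t \<le> ennreal (s t) * indicator {0..1} t"
      by eventually_elim (use bound in \<open>auto simp: indicator_def intro!: ennreal_leI\<close>)
  qed
  finally show ?thesis using 1 by simp
qed

text \<open>With P = x x^t one has trace P = |x|^2, and A = x Z x^t has squared length |Z|^2 / 4 in
  \<open>trace_form\<close>, so boundedness of matrix multiplication gives both estimates.\<close>

lemma length_one_matrix_bound:
  obtains C :: real where "C > 0"
    "\<And>P A :: real^'n^'n. P \<in> Pos1 \<Longrightarrow> A \<in> tangent P \<Longrightarrow> norm A \<le> C * trace P * sqrt (trace_form P A A)"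
    "\<And>P :: real^'n^'n. P \<in> Pos1 \<Longrightarrow> norm P \<le> C * trace P"
proof -
  obtain K where K: "K > 0" "\<And>(X :: real^'n^'n) (Y :: real^'n^'n). norm (X ** Y) \<le> norm X * norm Y * K"
    using mm.pos_bounded by blast
  \<comment> \<open>K * K comes from the two products in x Z x^t and 2 from the quarter in
    \<open>trace_form\<close>; the bare K serves the bound on P.\<close>
  define C where "C = max K (2 * (K * K))"
  have A: "norm A \<le> C * trace P * sqrt (trace_form P A A)"
    if P: "P \<in> Pos1" and tan: "A \<in> tangent P" for P A :: "real^'n^'n"
  proof -
    obtain x where x: "x \<in> SL" "P = gram x" using P by (auto simp: Pos1_def)
    obtain Z where Z: "Z \<in> sym0" "A = x ** Z ** transpose x"
      using tangent_gram_iff[OF x(1)] tan by (auto simp: x(2))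
    have "trace_form P A A = (norm Z / 2)\<^sup>2"
      using Z trace_mult_transpose[of Z Z]
      by (simp add: x(2) trace_form_gram[OF x(1)] sym0_def power_divide power2_norm_eq_inner)
    then have s: "sqrt (trace_form P A A) = norm Z / 2" by simp
    have "norm A \<le> norm (x ** Z) * norm (transpose x) * K" unfolding Z(2) by (rule K(2))
    also have "\<dots> \<le> (norm x * norm Z * K) * norm x * K"
      using K by (simp add: norm_transpose mult_right_mono)
    also have "\<dots> = (2 * (K * K)) * (trace P * (norm Z / 2))"
      by (simp add: x(2) trace_gram power2_eq_square)
    also have "\<dots> \<le> C * (trace P * (norm Z / 2))"
      using Pos1_trace_pos[OF P] by (intro mult_right_mono) (auto simp: C_def)
    finally show ?thesis by (simp add: s)
  qed
  have B: "norm P \<le> C * trace P" if P: "P \<in> Pos1" for P :: "real^'n^'n"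
  proof -
    obtain x where x: "x \<in> SL" "P = gram x" using P by (auto simp: Pos1_def)
    have "norm P \<le> norm x * norm (transpose x) * K" unfolding x(2) gram_def by (rule K(2))
    also have "\<dots> = K * trace P" by (simp add: norm_transpose x(2) trace_gram power2_eq_square)
    also have "\<dots> \<le> C * trace P"
      using Pos1_trace_pos[OF P] by (intro mult_right_mono) (auto simp: C_def)
    finally show ?thesis .
  qed
  show ?thesis by (rule that[OF _ A B]) (use K in \<open>auto simp: C_def\<close>)
qed

text \<open>Tangent matrices of bounded length grow at most like trace P. Both the logarithm of the
  trace and the normalised matrix divide this growth out, so their differentials are bounded
  uniformly.\<close>

lemma Lipschitz_coordinates:
  obtains C :: real and f' :: "real^'n^'n \<Rightarrow> real^'n^'n \<Rightarrow> real" and h' :: "real^'n^'n \<Rightarrow> real^'n^'n \<Rightarrow> real^'n^'n"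
  where "C > 0"
    "\<And>P. P \<in> Pos1 \<Longrightarrow> ((\<lambda>P. ln (trace P)) has_derivative f' P) (at P)"
    "\<And>P. P \<in> Pos1 \<Longrightarrow> ((\<lambda>P. (1 / trace P) *\<^sub>R P) has_derivative h' P) (at P)"
    "\<And>P A. P \<in> Pos1 \<Longrightarrow> A \<in> tangent P \<Longrightarrow> norm (f' P A) \<le> C * sqrt (trace_form P A A)"
    "\<And>P A. P \<in> Pos1 \<Longrightarrow> A \<in> tangent P \<Longrightarrow> norm (h' P A) \<le> C * sqrt (trace_form P A A)"
proof -
  obtain C :: real where C: "C > 0"
    "\<And>P A :: real^'n^'n. P \<in> Pos1 \<Longrightarrow> A \<in> tangent P \<Longrightarrow> norm A \<le> C * trace P * sqrt (trace_form P A A)"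
    "\<And>P :: real^'n^'n. P \<in> Pos1 \<Longrightarrow> norm P \<le> C * trace P"
    using length_one_matrix_bound by blast
  define D where "D = norm (mat 1 :: real^'n^'n)"
  have tr: "\<bar>trace A\<bar> \<le> D * norm A" for A :: "real^'n^'n"
    using Cauchy_Schwarz_ineq2[of "mat 1" A] trace_mult_transpose[of A "mat 1"] by (simp add: D_def inner_commute)
  have D: "D \<ge> 0" by (simp add: D_def)
  \<comment> \<open>After multiplication by C the three summands bound the term A / trace P, the
    logarithmic derivative trace A / trace P, and that derivative times P / trace P.\<close>
  define B where "B = (1 + D + D * C) * C"
  have dtr: "(trace has_derivative trace) (at P)" for P :: "real^'n^'n"
    by (rule bounded_linear_imp_has_derivative[OF bounded_linear_trace])
  define f' where "f' = (\<lambda>P A :: real^'n^'n. trace A / trace (P :: real^'n^'n))"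
  define h' where "h' = (\<lambda>P A :: real^'n^'n. (1 / trace P) *\<^sub>R A - (trace A / (trace P * trace P)) *\<^sub>R (P :: real^'n^'n))"
  show ?thesis
  proof (rule that)
    show "B > 0" unfolding B_def using C(1) D by (intro mult_pos_pos add_pos_nonneg) auto
    fix P :: "real^'n^'n" assume P: "P \<in> Pos1"
    note pos = Pos1_trace_pos[OF P]
    show "((\<lambda>P. ln (trace P)) has_derivative f' P) (at P)"
      using has_derivative_ln[OF pos dtr] by (simp add: f'_def divide_inverse)
    have "((\<lambda>P. 1 / trace P) has_derivative (\<lambda>A. - (trace A / (trace P * trace P)))) (at P)"
      using pos by (auto intro!: derivative_eq_intros dtr simp: field_simps)
    from has_derivative_scaleR[OF this has_derivative_ident]
    show "((\<lambda>P. (1 / trace P) *\<^sub>R P) has_derivative h' P) (at P)"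
      by (simp add: h'_def)
    fix A assume A: "A \<in> tangent P"
    define s where "s = sqrt (trace_form P A A)"
    have nA: "norm A \<le> trace P * (C * s)" using C(2)[OF P A] by (simp add: s_def mult_ac)
    then have Cs: "0 \<le> C * s" using pos norm_ge_zero[of A] by (metis order_trans zero_le_mult_iff not_less)
    then have s0: "0 \<le> s" using C(1) by (simp add: zero_le_mult_iff)
    have tA: "\<bar>trace A\<bar> \<le> trace P * (D * (C * s))"
      using tr[of A] mult_left_mono[OF nA D] by (simp add: mult_ac)
    have "\<bar>f' P A\<bar> = \<bar>trace A\<bar> / trace P" using pos by (simp add: f'_def)
    also have "\<dots> \<le> D * (C * s)" using tA pos by (simp add: pos_divide_le_eq mult_ac)
    finally have f: "\<bar>f' P A\<bar> \<le> D * (C * s)" .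
    have DCs: "0 \<le> D * (C * s)" using D Cs by simp
    have DCCs: "0 \<le> D * (C * s) * C" using DCs C(1) by simp
    have Beq: "B * s = C * s + D * (C * s) + D * (C * s) * C" by (simp add: B_def algebra_simps)
    show "norm (f' P A) \<le> B * sqrt (trace_form P A A)"
      unfolding s_def[symmetric] Beq using f Cs DCCs by simp
    have "norm (h' P A) \<le> norm ((1 / trace P) *\<^sub>R A) + norm ((trace A / (trace P * trace P)) *\<^sub>R P)"
      unfolding h'_def by (rule norm_triangle_ineq4)
    also have "norm ((1 / trace P) *\<^sub>R A) \<le> C * s" using nA pos by (simp add: pos_divide_le_eq mult_ac)
    also have "norm ((trace A / (trace P * trace P)) *\<^sub>R P) = \<bar>f' P A\<bar> * (norm P / trace P)"
      using pos by (simp add: f'_def)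
    also have "\<dots> \<le> D * (C * s) * C"
      using f C(3)[OF P] pos DCs by (intro mult_mono) (auto simp: pos_divide_le_eq)
    finally show "norm (h' P A) \<le> B * sqrt (trace_form P A A)"
      unfolding s_def[symmetric] Beq using DCs by simp
  qed
qed

text \<open>Factors x i with X i = \<open>gram (x i)\<close> satisfy |x i|^2 = trace (X i), so they
  stay bounded, and a subsequential limit is a factor of P with determinant 1.\<close>

lemma Pos1_limit:
  fixes P :: "real^'n^'n"
  assumes "\<And>i. X i \<in> Pos1" "X \<longlonglongrightarrow> P"
  shows "P \<in> Pos1"
proof -
  have "\<exists>x. x \<in> SL \<and> X i = gram x" for i using assms(1)[of i] by (auto simp: Pos1_def)
  then obtain x where x: "\<And>i. x i \<in> SL" "\<And>i. X i = gram (x i)" by metis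
  have "(\<lambda>i. trace (X i)) \<longlonglongrightarrow> trace P"
    by (rule bounded_linear.tendsto[OF bounded_linear_trace assms(2)])
  then have "Bseq (\<lambda>i. trace (X i))" by (intro convergent_imp_Bseq convergentI)
  then obtain B where B: "\<And>i. norm (trace (X i)) \<le> B" by (auto simp: Bseq_def)
  have "norm (x i) \<le> sqrt B" for i
    using B[of i] by (intro real_le_rsqrt) (simp add: x(2) trace_gram)
  then have "bounded (range x)" unfolding bounded_iff by blast
  then obtain l r where l: "strict_mono r" "(x \<circ> r) \<longlonglongrightarrow> l"
    using bounded_imp_convergent_subsequence by blast
  have "(\<lambda>i. gram (x (r i))) \<longlonglongrightarrow> gram l"
  proof (rule isCont_tendsto_compose[where g = gram])
    show "isCont gram l" using continuous_on_gram[of "UNIV :: (real^'n^'n) set"] by (simp add: continuous_on_eq_continuous_at)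
    show "(\<lambda>i. x (r i)) \<longlonglongrightarrow> l" using l(2) by (simp add: comp_def)
  qed
  moreover have "(\<lambda>i. gram (x (r i))) \<longlonglongrightarrow> P"
    using LIMSEQ_subseq_LIMSEQ[OF assms(2) l(1)] by (simp add: comp_def x(2))
  ultimately have "P = gram l" by (rule LIMSEQ_unique[symmetric])
  moreover have "(\<lambda>i. det (x (r i))) \<longlonglongrightarrow> det l"
  proof (rule isCont_tendsto_compose[where g = det])
    show "isCont det l" using smooth_on_continuous_on[OF smooth_on_det[where 'n = 'n]] by (simp add: continuous_on_eq_continuous_at)
    show "(\<lambda>i. x (r i)) \<longlonglongrightarrow> l" using l(2) by (simp add: comp_def)
  qed
  then have "det l = 1"
    using x(1) LIMSEQ_unique[OF _ tendsto_const[of "1::real"]] by (simp add: SL_def)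
  ultimately show ?thesis by (auto simp: Pos1_def SL_def)
qed

section \<open>Speeds, lower bounds on lengths and Cauchy sequences\<close>

context sym0_iso
begin

abbreviation M :: "((real^'n^'n) set, 'e) riemannian" where
  "M \<equiv> SL_mod_SO"

lemma charts_M: "charts M = quotient_charts" and points_M: "points M = coset ` SL"
  and metric_M: "metric M = quotient_metric"
  by (simp_all add: SL_mod_SO_def)

text \<open>\<open>chart_at\<close> returns an unspecified chart; passing to the matrix curve
  \<open>cpos \<circ> \<gamma>\<close> makes the speed independent of it.\<close>

lemma speed_eq:
  fixes \<gamma> :: "real \<Rightarrow> (real^'n^'n) set"
  assumes T: "open T" "t \<in> T" "\<And>s. s \<in> T \<Longrightarrow> \<gamma> s \<in> coset ` SL"
    and A: "((\<lambda>s. cpos (\<gamma> s)) has_vector_derivative A) (at t)"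
  shows "speed M \<gamma> t = sqrt (trace_form (cpos (\<gamma> t)) A A)" "A \<in> tangent (cpos (\<gamma> t))"
proof -
  have "chart_at M (\<gamma> t) \<in> charts M \<and> \<gamma> t \<in> fst (chart_at M (\<gamma> t))"
  proof -
    have "(coset ` SL, cbase 0) \<in> charts M \<and> \<gamma> t \<in> fst (coset ` SL, cbase 0)"
      using chart_param.in_quotient_charts[OF chart_param_base] T by (simp add: charts_M)
    then show ?thesis unfolding chart_at_def by (rule someI)
  qed
  then obtain V d where Vd: "chart_at M (\<gamma> t) = (V, d)" "(V, d) \<in> quotient_charts" "\<gamma> t \<in> V"
    by (metis charts_M fst_conv surj_pair)
  then obtain W r where "chart_param V d W r" using chart_paramI by blast
  then interpret chart_param V d W r .
  have "isCont (\<lambda>s. cpos (\<gamma> s)) t"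
    using A has_vector_derivative_continuous by blast
  moreover have tW: "cpos (\<gamma> t) \<in> W" using in_U_iff Vd(3) T by blast
  ultimately have "\<exists>T1. open T1 \<and> t \<in> T1 \<and> (\<forall>s\<in>T1. cpos (\<gamma> s) \<in> W)"
    using open_W unfolding continuous_at_open by (elim allE[of _ W] impE conjI)
  then obtain T1 where T1: "open T1" "t \<in> T1" "\<And>s. s \<in> T1 \<Longrightarrow> cpos (\<gamma> s) \<in> W" by meson
  define T' where "T' = T \<inter> T1"
  have T': "open T'" "t \<in> T'" using T T1 by (auto simp: T'_def)
  have V: "\<gamma> s \<in> V" if "s \<in> T'" for s
    using that in_U_iff T(3) T1(3) by (auto simp: T'_def)
  have "((\<lambda>s. r (cpos (\<gamma> s))) has_vector_derivative dr (cpos (\<gamma> t)) A) (at t)"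
    using vector_derivative_diff_chain_within[OF A has_derivative_at_withinI[OF has_derivative_r[OF tW]]] by (simp add: comp_def)
  then have v: "((\<lambda>s. d (\<gamma> s)) has_vector_derivative dr (cpos (\<gamma> t)) A) (at t)"
    by (rule has_vector_derivative_transform_within_open[OF _ T']) (simp add: r_cpos V)
  define v where "v = dr (cpos (\<gamma> t)) A"
  have y: "d (\<gamma> t) \<in> d ` V" using Vd(3) by blast
  have "((\<lambda>s. p (d (\<gamma> s))) has_vector_derivative dp (d (\<gamma> t)) v) (at t)"
    using vector_derivative_diff_chain_within[OF v has_derivative_at_withinI[OF has_derivative_p[OF y]]] by (simp add: comp_def v_def)
  then have "((\<lambda>s. cpos (\<gamma> s)) has_vector_derivative dp (d (\<gamma> t)) v) (at t)"
    by (rule has_vector_derivative_transform_within_open[OF _ T']) (simp add: V)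
  then have Av: "A = dp (d (\<gamma> t)) v" by (rule vector_derivative_unique_at[OF A])
  have p: "p (d (\<gamma> t)) = cpos (\<gamma> t)" using Vd(3) by simp
  show "A \<in> tangent (cpos (\<gamma> t))" using dp_tangent[OF y] by (simp add: Av p)
  have "vector_derivative (d \<circ> \<gamma>) (at t) = v"
    using vector_derivative_at[OF v] by (simp add: comp_def v_def)
  then show "speed M \<gamma> t = sqrt (trace_form (cpos (\<gamma> t)) A A)"
    by (simp add: speed_def Vd(1) Let_def metric_M quotient_metric_eq[OF y] p Av[symmetric])
qed

lemma curve_regular_local:
  assumes "piecewise_C1_curve M \<gamma>" "t \<in> {0..1}"
  obtains \<delta> S where "\<delta> > 0" "finite S" "\<gamma> t \<in> coset ` SL"
    "continuous (at t within {0..1}) (\<lambda>t. cpos (\<gamma> t))"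
    "\<And>s. s \<in> {0<..<1} \<inter> ball t \<delta> - S \<Longrightarrow> \<exists>A. ((\<lambda>s. cpos (\<gamma> s)) has_vector_derivative A) (at s)"
proof -
  obtain U c \<delta> where Uc: "(U, c) \<in> (quotient_charts :: ((real^'n^'n) set, 'e) chart set)" "\<delta> > 0"
      "\<gamma> ` ({0..1} \<inter> {t - \<delta>..t + \<delta>}) \<subseteq> U" "(c \<circ> \<gamma>) piecewise_C1_differentiable_on ({0..1} \<inter> {t - \<delta>..t + \<delta>})"
    using assms unfolding piecewise_C1_curve_def charts_M by fast
  let ?J = "{0..1} \<inter> {t - \<delta>..t + \<delta>}"
  obtain S where S: "finite S" "(c \<circ> \<gamma>) C1_differentiable_on (?J - S)" and cont: "continuous_on ?J (c \<circ> \<gamma>)"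
    using Uc(4) unfolding piecewise_C1_differentiable_on_def by blast
  obtain W r where "chart_param U c W r" using chart_paramI[OF Uc(1)] by blast
  then interpret chart_param U c W r .
  have J: "\<gamma> s \<in> U" if "s \<in> ?J" for s using Uc(3) that by blast
  have tJ: "t \<in> ?J" using assms(2) Uc(2) by simp
  show ?thesis
  proof (rule that[OF Uc(2) S(1)])
    show "\<gamma> t \<in> coset ` SL" using J[OF tJ] U_subset by blast
    have "continuous_on ?J (\<lambda>s. p ((c \<circ> \<gamma>) s))"
      by (rule continuous_on_compose2[OF smooth_on_continuous_on[OF smooth_p] cont]) (use J in auto)
    then have "continuous_on ?J (\<lambda>s. cpos (\<gamma> s))"
      by (rule continuous_on_eq) (simp add: J)
    then have "continuous (at t within ?J) (\<lambda>s. cpos (\<gamma> s))"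
      using tJ unfolding continuous_on_eq_continuous_within by blast
    moreover have "at t within {0..1} = at t within ?J"
      by (rule at_within_nhd[of t "ball t \<delta>"]) (use Uc(2) in \<open>auto simp: dist_real_def\<close>)
    ultimately show "continuous (at t within {0..1}) (\<lambda>t. cpos (\<gamma> t))" by simp
    fix s assume s: "s \<in> {0<..<1} \<inter> ball t \<delta> - S"
    let ?T = "{0<..<1} \<inter> ball t \<delta>"
    have T: "open ?T" "s \<in> ?T" using s by (simp_all add: open_Int)
    have TJ: "?T \<subseteq> ?J" by (auto simp: dist_real_def)
    have "s \<in> ?J - S" using s TJ by blast
    then obtain v where v: "((c \<circ> \<gamma>) has_vector_derivative v) (at s)"
      using S(2) unfolding C1_differentiable_on_def by blast
    have y: "(c \<circ> \<gamma>) s \<in> c ` U" using J T TJ by auto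
    have "((\<lambda>s. p ((c \<circ> \<gamma>) s)) has_vector_derivative dp ((c \<circ> \<gamma>) s) v) (at s)"
      using vector_derivative_diff_chain_within[OF v has_derivative_at_withinI[OF has_derivative_p[OF y]]] by (simp add: comp_def)
    then have "((\<lambda>s. cpos (\<gamma> s)) has_vector_derivative dp ((c \<circ> \<gamma>) s) v) (at s)"
      by (rule has_vector_derivative_transform_within_open[OF _ T]) (use J TJ in auto)
    then show "\<exists>A. ((\<lambda>s. cpos (\<gamma> s)) has_vector_derivative A) (at s)" by blast
  qed
qed

text \<open>Charts and exceptional points are given only near each t; compactness of [0, 1] leaves
  finitely many neighbourhoods and hence one finite exceptional set.\<close>

lemma curve_regular:
  assumes "piecewise_C1_curve M \<gamma>"
  obtains S where "finite S" "continuous_on {0..1} (\<lambda>t. cpos (\<gamma> t))" "\<And>t. t \<in> {0..1} \<Longrightarrow> \<gamma> t \<in> coset ` SL"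
    "\<And>t. t \<in> {0<..<1} - S \<Longrightarrow> \<exists>A. ((\<lambda>s. cpos (\<gamma> s)) has_vector_derivative A) (at t)"
proof -
  define reg where "reg = (\<lambda>s. \<exists>A. ((\<lambda>s. cpos (\<gamma> s)) has_vector_derivative A) (at s))"
  have "\<forall>t\<in>{0..1}. \<exists>x. 0 < fst x \<and> finite (snd x) \<and> (\<forall>s\<in>{0<..<1} \<inter> ball t (fst x) - snd x. reg s)"
  proof
    fix t :: real assume t: "t \<in> {0..1}"
    obtain \<delta> S where "\<delta> > 0" "finite S" "\<And>s. s \<in> {0<..<1} \<inter> ball t \<delta> - S \<Longrightarrow> reg s"
      by (rule curve_regular_local[OF assms t, folded reg_def]) (rule that, assumption, assumption, simp add: reg_def)
    then show "\<exists>x. 0 < fst x \<and> finite (snd x) \<and> (\<forall>s\<in>{0<..<1} \<inter> ball t (fst x) - snd x. reg s)"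
      by (intro exI[of _ "(\<delta>, S)"]) auto
  qed
  from bchoice[OF this] obtain x where x: "\<And>t. t \<in> {0..1} \<Longrightarrow> 0 < fst (x t)"
    "\<And>t. t \<in> {0..1} \<Longrightarrow> finite (snd (x t))"
    "\<And>t s. t \<in> {0..1} \<Longrightarrow> s \<in> {0<..<1} \<inter> ball t (fst (x t)) - snd (x t) \<Longrightarrow> reg s" by blast
  have cover: "{0..1} \<subseteq> (\<Union>t\<in>{0..1}. ball t (fst (x t)))" using x(1) by force
  obtain F where F: "F \<subseteq> {0..1}" "finite F" "{0..1} \<subseteq> (\<Union>t\<in>F. ball t (fst (x t)))"
    by (rule compactE_image[OF compact_Icc _ cover]) auto
  show ?thesis
  proof (rule that)
    show "finite (\<Union>t\<in>F. snd (x t))" using F x(2) by blast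
    show "\<gamma> t \<in> coset ` SL" if "t \<in> {0..1}" for t
      using curve_regular_local[OF assms that] by blast
    show "continuous_on {0..1} (\<lambda>t. cpos (\<gamma> t))"
      unfolding continuous_on_eq_continuous_within using curve_regular_local[OF assms] by blast
    fix t assume t: "t \<in> {0<..<1} - (\<Union>t\<in>F. snd (x t))"
    then have "t \<in> {0..1}" by simp
    then obtain t0 where t0: "t0 \<in> F" "t \<in> ball t0 (fst (x t0))" using F(3) by blast
    then have "reg t" using t F(1) x(3)[of t0 t] by blast
    then show "\<exists>A. ((\<lambda>s. cpos (\<gamma> s)) has_vector_derivative A) (at t)" by (simp add: reg_def)
  qed
qed

lemma curve_length_lower_bound:
  fixes f :: "real^'n^'n \<Rightarrow> 'b::euclidean_space"
  assumes \<gamma>: "piecewise_C1_curve M \<gamma>" and C: "C > 0"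
    and f: "\<And>P. P \<in> Pos1 \<Longrightarrow> (f has_derivative f' P) (at P)"
    and bound: "\<And>P A. P \<in> Pos1 \<Longrightarrow> A \<in> tangent P \<Longrightarrow> norm (f' P A) \<le> C * sqrt (trace_form P A A)"
  shows "ennreal (norm (f (cpos (\<gamma> 1)) - f (cpos (\<gamma> 0))) / C) \<le> curve_length M \<gamma>"
proof -
  obtain S where S: "finite S" "continuous_on {0..1} (\<lambda>t. cpos (\<gamma> t))" "\<And>t. t \<in> {0..1} \<Longrightarrow> \<gamma> t \<in> coset ` SL"
    "\<And>t. t \<in> {0<..<1} - S \<Longrightarrow> \<exists>A. ((\<lambda>s. cpos (\<gamma> s)) has_vector_derivative A) (at t)"
    using curve_regular[OF \<gamma>] by blast
  then obtain A where A: "\<And>t. t \<in> {0<..<1} - S \<Longrightarrow> ((\<lambda>s. cpos (\<gamma> s)) has_vector_derivative A t) (at t)" by metis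
  \<comment> \<open>Projection to the direction of the total displacement reduces the claim to a
    real function; if both endpoints have equal values, \<open>sgn\<close> gives 0 and the bound is
    trivial.\<close>
  define u where "u = sgn (f (cpos (\<gamma> 1)) - f (cpos (\<gamma> 0)))"
  define h where "h = (\<lambda>t. (f (cpos (\<gamma> t)) \<bullet> u) / C)"
  define h' where "h' = (\<lambda>t. (f' (cpos (\<gamma> t)) (A t) \<bullet> u) / C)"
  have nu: "norm u \<le> 1" by (simp add: u_def norm_sgn)
  have fcont: "continuous_on Pos1 f"
    by (intro continuous_at_imp_continuous_on ballI has_derivative_continuous[OF f])
  have "ennreal (h 1 - h 0) \<le> (\<integral>\<^sup>+t\<in>{0..1}. ennreal (speed M \<gamma> t) \<partial>lborel)"
  proof (rule nn_integral_lower_bound[OF S(1)])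
    have "continuous_on {0..1} (\<lambda>t. f (cpos (\<gamma> t)))"
      by (rule continuous_on_compose2[OF fcont S(2)]) (use S(3) cpos_in_Pos1 in blast)
    then show "continuous_on {0..1} h" unfolding h_def using C by (intro continuous_intros) auto
    fix t assume t: "t \<in> {0<..<1} - S"
    have P: "cpos (\<gamma> t) \<in> Pos1" using t S(3)[of t] cpos_in_Pos1[of "\<gamma> t"] by simp
    have "((\<lambda>s. f (cpos (\<gamma> s))) has_vector_derivative f' (cpos (\<gamma> t)) (A t)) (at t)"
      using vector_derivative_diff_chain_within[OF A[OF t] has_derivative_at_withinI[OF f[OF P]]] by (simp add: comp_def)
    then show "(h has_vector_derivative h' t) (at t)"
      unfolding h_def h'_def
      by (rule bounded_linear.has_vector_derivative[OF bounded_linear_compose[OF bounded_linear_divide bounded_linear_inner_left]])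
    note sp = speed_eq[of "{0<..<1}" t \<gamma>, OF open_greaterThanLessThan _ _ A[OF t]]
    have sp1: "speed M \<gamma> t = sqrt (trace_form (cpos (\<gamma> t)) (A t) (A t))" "A t \<in> tangent (cpos (\<gamma> t))"
      using sp t S(3) by auto
    have "\<bar>f' (cpos (\<gamma> t)) (A t) \<bullet> u\<bar> \<le> norm (f' (cpos (\<gamma> t)) (A t)) * norm u"
      by (rule Cauchy_Schwarz_ineq2)
    also have "\<dots> \<le> norm (f' (cpos (\<gamma> t)) (A t))" using nu by (simp add: mult_left_le)
    also have "\<dots> \<le> C * speed M \<gamma> t" using bound[OF P sp1(2)] sp1(1) by simp
    finally show "\<bar>h' t\<bar> \<le> speed M \<gamma> t" using C by (simp add: h'_def pos_divide_le_eq mult.commute)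
  qed
  moreover have "h 1 - h 0 = norm (f (cpos (\<gamma> 1)) - f (cpos (\<gamma> 0))) / C"
  proof -
    define w where "w = f (cpos (\<gamma> 1)) - f (cpos (\<gamma> 0))"
    have "w \<bullet> sgn w = norm w"
      by (cases "w = 0") (simp_all add: sgn_div_norm power2_norm_eq_inner[symmetric] power2_eq_square)
    then show ?thesis by (simp add: h_def diff_divide_distrib[symmetric] inner_diff_left[symmetric] u_def w_def)
  qed
  ultimately show ?thesis by (simp add: curve_length_def)
qed

lemma induced_dist_lower_bound:
  fixes f :: "real^'n^'n \<Rightarrow> 'b::euclidean_space"
  assumes "C > 0" "e > 0" "induced_dist M N q q' < ennreal (e / C)"
    "\<And>P. P \<in> Pos1 \<Longrightarrow> (f has_derivative f' P) (at P)"
    "\<And>P A. P \<in> Pos1 \<Longrightarrow> A \<in> tangent P \<Longrightarrow> norm (f' P A) \<le> C * sqrt (trace_form P A A)"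
  shows "norm (f (cpos q') - f (cpos q)) < e"
proof -
  obtain \<gamma> where \<gamma>: "piecewise_C1_curve M \<gamma>" "\<gamma> 0 = q" "\<gamma> 1 = q'" "curve_length M \<gamma> < ennreal (e / C)"
    using assms(3) unfolding induced_dist_def Inf_less_iff by blast
  have "ennreal (norm (f (cpos q') - f (cpos q)) / C) < ennreal (e / C)"
    using curve_length_lower_bound[OF \<gamma>(1) assms(1,4,5)] \<gamma> by (metis le_less_trans)
  then have "norm (f (cpos q') - f (cpos q)) / C < e / C"
    using assms(1) by (subst (asm) ennreal_less_iff) auto
  then show ?thesis using assms(1) by (simp add: divide_less_cancel)
qed

lemma Cauchy_converges_in_Pos1:
  assumes X: "\<And>i::nat. X i \<in> coset ` SL"
    and cauchy: "\<And>\<epsilon>. \<epsilon> > 0 \<Longrightarrow> \<exists>K. \<forall>i\<ge>K. \<forall>j\<ge>K. induced_dist M N (X i) (X j) < \<epsilon>"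
  obtains P where "P \<in> Pos1" "(\<lambda>i. cpos (X i)) \<longlonglongrightarrow> P"
proof -
  obtain C :: real and f' :: "real^'n^'n \<Rightarrow> real^'n^'n \<Rightarrow> real" and h' :: "real^'n^'n \<Rightarrow> real^'n^'n \<Rightarrow> real^'n^'n"
    where C: "C > 0"
    "\<And>P. P \<in> Pos1 \<Longrightarrow> ((\<lambda>P. ln (trace P)) has_derivative f' P) (at P)"
    "\<And>P. P \<in> Pos1 \<Longrightarrow> ((\<lambda>P. (1 / trace P) *\<^sub>R P) has_derivative h' P) (at P)"
    "\<And>P A. P \<in> Pos1 \<Longrightarrow> A \<in> tangent P \<Longrightarrow> norm (f' P A) \<le> C * sqrt (trace_form P A A)"
    "\<And>P A. P \<in> Pos1 \<Longrightarrow> A \<in> tangent P \<Longrightarrow> norm (h' P A) \<le> C * sqrt (trace_form P A A)"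
    using Lipschitz_coordinates by blast
  have c: "Cauchy (\<lambda>i. F (cpos (X i)))"
    if "\<And>P. P \<in> Pos1 \<Longrightarrow> (F has_derivative F' P) (at P)"
      "\<And>P A. P \<in> Pos1 \<Longrightarrow> A \<in> tangent P \<Longrightarrow> norm (F' P A) \<le> C * sqrt (trace_form P A A)"
    for F :: "real^'n^'n \<Rightarrow> 'b::euclidean_space" and F'
  proof (rule CauchyI)
    fix e :: real assume e: "e > 0"
    then have "ennreal (e / C) > 0" using C(1) by simp
    then obtain K where K: "\<And>i j. i \<ge> K \<Longrightarrow> j \<ge> K \<Longrightarrow> induced_dist M N (X i) (X j) < ennreal (e / C)"
      using cauchy by blast
    show "\<exists>K. \<forall>m\<ge>K. \<forall>n\<ge>K. norm (F (cpos (X m)) - F (cpos (X n))) < e"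
      using induced_dist_lower_bound[OF C(1) e K that] by blast
  qed
  obtain l where l: "(\<lambda>i. ln (trace (cpos (X i)))) \<longlonglongrightarrow> l"
    using c[OF C(2,4)] by (auto simp: Cauchy_convergent_iff convergent_def)
  obtain Q where Q: "(\<lambda>i. (1 / trace (cpos (X i))) *\<^sub>R cpos (X i)) \<longlonglongrightarrow> Q"
    using c[OF C(3,5)] by (auto simp: Cauchy_convergent_iff convergent_def)
  \<comment> \<open>The matrix is recovered from its two convergent coordinates, as the exponential
    of ln (trace P) times P / trace P.\<close>
  have "(\<lambda>i. exp (ln (trace (cpos (X i)))) *\<^sub>R ((1 / trace (cpos (X i))) *\<^sub>R cpos (X i))) \<longlonglongrightarrow> exp l *\<^sub>R Q"
    by (intro tendsto_intros l Q)
  moreover have "exp (ln (trace (cpos (X i)))) *\<^sub>R ((1 / trace (cpos (X i))) *\<^sub>R cpos (X i)) = cpos (X i)" for i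
    using Pos1_trace_pos[OF cpos_in_Pos1[OF X]] by (simp add: exp_ln less_imp_neq[symmetric])
  ultimately have lim: "(\<lambda>i. cpos (X i)) \<longlonglongrightarrow> exp l *\<^sub>R Q" by simp
  then show ?thesis using that Pos1_limit[OF cpos_in_Pos1[OF X] lim] by blast
qed

end

section \<open>Slice charts and completeness\<close>

context chart_param
begin

text \<open>The coefficients of the metric in a fixed basis are continuous, hence bounded near y0.
  This serves upper bounds on lengths, where the Lipschitz coordinates serve lower ones.\<close>

lemma metric_bounded_near:
  assumes "y0 \<in> c ` U"
  obtains B \<epsilon> where "\<epsilon> > 0" "ball y0 \<epsilon> \<subseteq> c ` U" "\<And>y u. y \<in> ball y0 \<epsilon> \<Longrightarrow> g y u u \<le> B * (norm u)\<^sup>2"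
proof -
  define G where "G = (\<lambda>y. \<Sum>b\<in>Basis. \<Sum>b'\<in>Basis. \<bar>g y b b'\<bar>)"
  have "continuous_on (c ` U) G"
    unfolding G_def by (intro continuous_intros smooth_on_continuous_on[OF smooth_metric])
  then have "open (c ` U \<inter> G -` {..<G y0 + 1})"
    using continuous_open_preimage[OF _ open_image open_lessThan] by blast
  moreover have "y0 \<in> c ` U \<inter> G -` {..<G y0 + 1}" using assms by simp
  ultimately obtain \<epsilon> where \<epsilon>: "\<epsilon> > 0" "ball y0 \<epsilon> \<subseteq> c ` U \<inter> G -` {..<G y0 + 1}"
    using open_contains_ball by blast
  show ?thesis
  proof (rule that[OF \<epsilon>(1)])
    show "ball y0 \<epsilon> \<subseteq> c ` U" using \<epsilon>(2) by blast
    fix y u assume "y \<in> ball y0 \<epsilon>"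
    then have y: "y \<in> c ` U" "G y \<le> G y0 + 1" using \<epsilon>(2) by auto
    have "g y u u = g y (\<Sum>b\<in>Basis. (u \<bullet> b) *\<^sub>R b) (\<Sum>b\<in>Basis. (u \<bullet> b) *\<^sub>R b)"
      by (simp add: euclidean_representation)
    also have "\<dots> = (\<Sum>(b, b')\<in>Basis \<times> Basis. (u \<bullet> b) * (u \<bullet> b') * g y b b')"
      using metric_linear[OF y(1)]
      by (simp add: bilinear_sum bilinear_lmul bilinear_rmul mult.assoc)
    also have "\<dots> = (\<Sum>b\<in>Basis. \<Sum>b'\<in>Basis. (u \<bullet> b) * (u \<bullet> b') * g y b b')"
      by (simp add: sum.cartesian_product)
    also have "\<dots> \<le> (\<Sum>b\<in>Basis. \<Sum>b'\<in>Basis. (norm u)\<^sup>2 * \<bar>g y b b'\<bar>)"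
    proof (intro sum_mono)
      fix b b' :: 'e assume b: "b \<in> Basis" "b' \<in> Basis"
      have "(u \<bullet> b) * (u \<bullet> b') * g y b b' \<le> \<bar>u \<bullet> b\<bar> * \<bar>u \<bullet> b'\<bar> * \<bar>g y b b'\<bar>"
        by (metis abs_ge_self abs_mult)
      also have "\<dots> \<le> norm u * norm u * \<bar>g y b b'\<bar>"
        using b by (intro mult_right_mono mult_mono Basis_le_norm) auto
      finally show "(u \<bullet> b) * (u \<bullet> b') * g y b b' \<le> (norm u)\<^sup>2 * \<bar>g y b b'\<bar>"
        by (simp add: power2_eq_square)
    qed
    also have "\<dots> = G y * (norm u)\<^sup>2" by (simp add: G_def sum_distrib_left sum_distrib_right mult.commute)
    also have "\<dots> \<le> (G y0 + 1) * (norm u)\<^sup>2" using y(2) by (intro mult_right_mono) auto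
    finally show "g y u u \<le> (G y0 + 1) * (norm u)\<^sup>2" .
  qed
qed

end

context sym0_iso
begin

text \<open>In a slice chart centred at q0 the segment from c q to the origin stays in L, hence
  inside N, so its length bounds the intrinsic distance of N and not only the ambient one.\<close>

lemma induced_dist_segment:
  assumes chart: "(U, c) \<in> (quotient_charts :: ((real^'n^'n) set, 'e) chart set)" "U = coset ` SL"
    and L: "subspace L" "\<And>q. q \<in> U \<Longrightarrow> q \<in> N \<longleftrightarrow> c q \<in> L"
    and q0: "q0 \<in> U" "c q0 = 0" and q: "q \<in> N" "q \<in> U"
    and ball: "c q \<in> ball 0 \<epsilon>" "ball 0 \<epsilon> \<subseteq> c ` U"
    and B: "\<And>y u. y \<in> ball 0 \<epsilon> \<Longrightarrow> quotient_metric (U, c) y u u \<le> B * (norm u)\<^sup>2"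
  shows "induced_dist M N q q0 \<le> ennreal (sqrt B * norm (c q))"
proof -
  obtain W r where "chart_param U c W r" using chart_paramI[OF chart(1)] by blast
  then interpret chart_param U c W r .
  define l where "l = (\<lambda>t. (1 - t) *\<^sub>R c q)"
  define \<gamma> where "\<gamma> = (\<lambda>t. inv_into U c (l t))"
  have lball: "l t \<in> ball 0 \<epsilon>" if "t \<in> {0..1}" for t
  proof -
    have "norm (l t) \<le> 1 * norm (c q)" unfolding l_def norm_scaleR using that by (intro mult_right_mono) auto
    then show ?thesis using ball(1) by simp
  qed
  then have lU: "l t \<in> c ` U" if "t \<in> {0..1}" for t using that ball(2) by blast
  have \<gamma>U: "\<gamma> t \<in> U" and c\<gamma>: "c (\<gamma> t) = l t" if "t \<in> {0..1}" for t
    using lU[OF that] by (auto simp: \<gamma>_def inv_into_into f_inv_into_f)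
  have l': "(l has_vector_derivative - c q) (at t)" for t
    unfolding l_def by (auto intro!: derivative_eq_intros)
  have "piecewise_C1_curve M \<gamma>"
    unfolding piecewise_C1_curve_def charts_M
  proof
    fix t :: real assume t: "t \<in> {0..1}"
    \<comment> \<open>\<delta> = 1 works at every t, as the window then contains all of
      [0, 1].\<close>
    have eq: "{0..1} \<inter> {t - 1..t + 1} = {0..1}" using t by auto
    have "(c \<circ> \<gamma>) piecewise_C1_differentiable_on {0..1}"
      unfolding piecewise_C1_differentiable_on_def C1_differentiable_on_def
    proof (intro conjI exI ballI)
      have "continuous_on {0..1} l" unfolding l_def by (intro continuous_intros)
      then show "continuous_on {0..1} (c \<circ> \<gamma>)" by (rule continuous_on_eq) (simp add: c\<gamma>)
      \<comment> \<open>Outside [0, 1] the curve is \<open>inv_into\<close> at points that may leave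
        the chart, so two-sided derivatives are claimed only in the interior.\<close>
      show "finite {0, 1 :: real}" by simp
      show "((c \<circ> \<gamma>) has_vector_derivative - c q) (at s)" if "s \<in> {0..1} - {0, 1}" for s
        by (rule has_vector_derivative_transform_within_open[OF l' open_greaterThanLessThan[of 0 1]])
          (use that c\<gamma> in auto)
      show "continuous_on ({0..1} - {0, 1}) (\<lambda>s. - c q)" by simp
    qed
    then have im: "\<gamma> ` ({0..1} \<inter> {t - 1..t + 1}) \<subseteq> U"
        "(c \<circ> \<gamma>) piecewise_C1_differentiable_on ({0..1} \<inter> {t - 1..t + 1})"
      unfolding eq using \<gamma>U by auto
    show "\<exists>(U, c)\<in>(quotient_charts :: ((real^'n^'n) set, 'e) chart set). \<exists>\<delta>>0. \<gamma> ` ({0..1} \<inter> {t - \<delta>..t + \<delta>}) \<subseteq> U \<and>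
        (c \<circ> \<gamma>) piecewise_C1_differentiable_on ({0..1} \<inter> {t - \<delta>..t + \<delta>})"
      by (rule bexI[of _ "(U, c)"]) (use im chart(1) zero_less_one in blast)+
  qed
  moreover have "\<gamma> ` {0..1} \<subseteq> N"
  proof clarify
    fix t :: real assume t: "t \<in> {0..1}"
    have "c q \<in> L" using L(2) q by blast
    then have "l t \<in> L" unfolding l_def by (rule subspace_scale[OF L(1)])
    then show "\<gamma> t \<in> N" using L(2)[OF \<gamma>U[OF t]] c\<gamma>[OF t] by simp
  qed
  moreover have "\<gamma> 0 = q" using inj_c q(2) by (simp add: \<gamma>_def l_def)
  moreover have "\<gamma> 1 = q0" using inj_c q0 by (metis \<gamma>_def l_def diff_self inv_into_f_f scaleR_zero_left)
  ultimately have "induced_dist M N q q0 \<le> curve_length M \<gamma>"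
    unfolding induced_dist_def by (intro Inf_lower) blast
  also have "\<dots> \<le> (\<integral>\<^sup>+t\<in>{0..1::real}. ennreal (sqrt B * norm (c q)) \<partial>lborel)"
    unfolding curve_length_def
  proof (rule nn_integral_mono_AE)
    have sp: "speed M \<gamma> t \<le> sqrt B * norm (c q)" if t: "t \<in> {0<..<1}" for t
    proof -
      have t': "t \<in> {0..1}" using t by simp
      have "((\<lambda>s. p (l s)) has_vector_derivative dp (l t) (- c q)) (at t)"
        using vector_derivative_diff_chain_within[OF l' has_derivative_at_withinI[OF has_derivative_p[OF lU[OF t']]]]
        by (simp add: comp_def)
      then have A: "((\<lambda>s. cpos (\<gamma> s)) has_vector_derivative dp (l t) (- c q)) (at t)"
        by (simp add: p_def \<gamma>_def)
      have "speed M \<gamma> t = sqrt (trace_form (cpos (\<gamma> t)) (dp (l t) (- c q)) (dp (l t) (- c q)))"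
        by (rule speed_eq(1)[OF open_greaterThanLessThan t _ A]) (use \<gamma>U chart(2) in auto)
      also have "\<dots> = sqrt (g (l t) (- c q) (- c q))"
        using quotient_metric_eq[OF lU[OF t']] by (simp add: p_def \<gamma>_def)
      also have "\<dots> \<le> sqrt (B * (norm (c q))\<^sup>2)"
        using B[OF lball[OF t'], of "- c q"] by (intro real_sqrt_le_mono) simp
      also have "\<dots> = sqrt B * norm (c q)" by (simp add: real_sqrt_mult)
      finally show ?thesis .
    qed
    have "AE t in lborel. t \<notin> {0, 1 :: real}"
      by (intro AE_not_in finite_imp_null_set_lborel) auto
    then show "AE t in lborel. ennreal (speed M \<gamma> t) * indicator {0..1} t \<le>
        ennreal (sqrt B * norm (c q)) * indicator {0..1} t"
      by eventually_elim (use sp in \<open>auto simp: indicator_def intro!: ennreal_leI\<close>)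
  qed
  also have "\<dots> = ennreal (sqrt B * norm (c q))" by (simp add: nn_integral_cmult)
  finally show ?thesis .
qed

lemma kappa_rbase: "P \<in> Pos1 \<Longrightarrow> kappa (rbase P) = (1 / trace P) *\<^sub>R P - unit_trace"
  using qbase_rbase[of P] by (simp add: qbase_def eq_diff_eq)

lemma trace_kappa_cbase:
  assumes "q0 \<in> coset ` SL" "q \<in> coset ` SL" "trace (S ** cpos q0) = 0"
  shows "trace (S ** kappa (cbase (rbase (cpos q0)) q)) = trace (S ** cpos q) / trace (cpos q)"
proof -
  have "kappa (cbase (rbase (cpos q0)) q) =
      (1 / trace (cpos q)) *\<^sub>R cpos q - (1 / trace (cpos q0)) *\<^sub>R cpos q0"
    using assms(1,2) by (simp add: cbase_def linear_diff[OF linear_kappa] kappa_rbase[OF cpos_in_Pos1] del: cpos_coset)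
  then show ?thesis
    using assms(3) by (simp add: mm.diff_right mm.scaleR_right trace_sub trace_scaleR)
qed

definition zero_set :: "real^'n \<Rightarrow> real^'n \<Rightarrow> (real^'n^'n) set set" where
  "zero_set a1 a2 = {q \<in> coset ` SL. trace (re_form a1 a2 ** cpos q) = 0 \<and> trace (im_form a1 a2 ** cpos q) = 0}"

text \<open>Dividing \<open>P\<close> by its trace turns the equations of the zero set into linear ones, so that a
  translate of the base chart is a slice chart.\<close>
lemma slice_chart_zero_set:
  fixes a1 a2 :: "real^'n"
  assumes q0: "q0 \<in> zero_set a1 a2" and a2: "a2 \<noteq> 0"
  defines "L \<equiv> {w. trace (re_form a1 a2 ** kappa w) = 0 \<and> trace (im_form a1 a2 ** kappa w) = 0}"
  shows "slice_chart (zero_set a1 a2) 2 (coset ` SL, cbase (rbase (cpos q0))) L"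
proof -
  define R where "R = re_form a1 a2"
  define I where "I = im_form a1 a2"
  define c where "c = cbase (rbase (cpos q0))"
  have q0': "q0 \<in> coset ` SL" and R0: "trace (R ** cpos q0) = 0" and I0: "trace (I ** cpos q0) = 0"
    using q0 by (auto simp: zero_set_def R_def I_def)
  interpret chart_param "coset ` SL" c "{P. 0 < trace P}" "\<lambda>P. rbase P - rbase (cpos q0)"
    unfolding c_def by (rule chart_param_base)
  have linS: "linear (\<lambda>w. trace (S ** kappa w))" for S :: "real^'n^'n"
    using linear_compose[OF linear_kappa linear_compose[OF bounded_linear.linear[OF mm.bounded_linear_right] linear_trace]]
    by (simp add: comp_def)
  have subL: "subspace L"
    unfolding L_def subspace_def
    by (auto simp: linear_0[OF linS] linear_add[OF linS] linear_scale[OF linS])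
  have tk: "trace (S ** kappa (c q)) = trace (S ** cpos q) / trace (cpos q)"
    if "trace (S ** cpos q0) = 0" "q \<in> coset ` SL" for S q
    unfolding c_def by (rule trace_kappa_cbase[OF q0' that(2,1)])
  have iff: "q \<in> zero_set a1 a2 \<longleftrightarrow> c q \<in> L" if "q \<in> coset ` SL" for q
    using tk[OF R0 that] tk[OF I0 that] Pos1_trace_pos[OF cpos_in_Pos1[OF that]] that
    by (auto simp: zero_set_def L_def R_def I_def)
  have y0: "0 \<in> c ` coset ` SL"
    using q0' by (intro image_eqI[of _ _ q0]) (simp_all add: c_def cbase_def)
  have p0: "p 0 = cpos q0" using p_c[OF q0'] by (simp add: c_def cbase_def)
  \<comment> \<open>The product rule for trace (S p) = trace p * trace (S kappa) at the origin,
    where kappa vanishes. It identifies L with the common orthogonal complement of the two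
    gradients, which yields its dimension.\<close>
  have deriv: "trace (S ** dp 0 w) = trace (cpos q0) * trace (S ** kappa w)" if S: "trace (S ** cpos q0) = 0" for S w
  proof -
    have "((\<lambda>z. trace (S ** kappa z)) has_derivative (\<lambda>w. trace (S ** kappa w))) (at 0)"
      using linS linear_conv_bounded_linear bounded_linear_imp_has_derivative by blast
    moreover have "((\<lambda>z. trace (p z)) has_derivative (\<lambda>w. trace (dp 0 w))) (at 0)"
      by (rule bounded_linear.has_derivative[OF bounded_linear_trace has_derivative_p[OF y0]])
    ultimately have "((\<lambda>z. trace (p z) * trace (S ** kappa z)) has_derivative
        (\<lambda>w. trace (p 0) * trace (S ** kappa w) + trace (dp 0 w) * trace (S ** kappa 0))) (at 0)"
      by (intro has_derivative_mult)
    then have 1: "((\<lambda>z. trace (p z) * trace (S ** kappa z)) has_derivative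
        (\<lambda>w. trace (cpos q0) * trace (S ** kappa w))) (at 0)"
      by (simp add: p0 linear_0[OF linear_kappa])
    have "(\<lambda>w. trace (S ** dp 0 w)) = (\<lambda>w. trace (cpos q0) * trace (S ** kappa w))"
    proof (rule frechet_derivative_unique_on_open[OF open_image y0 _ has_derivative_trace_p[OF y0 refl] 1])
      fix z assume "z \<in> c ` coset ` SL"
      then obtain q where q: "q \<in> coset ` SL" "z = c q" by blast
      then show "trace (S ** p z) = trace (p z) * trace (S ** kappa z)"
        using tk[OF S q(1)] Pos1_trace_pos[OF cpos_in_Pos1[OF q(1)]] p_c[OF q(1)] by simp
    qed
    then show ?thesis by meson
  qed
  have LK: "L = {w. g 0 (grad R 0) w = 0 \<and> g 0 (grad I 0) w = 0}"
    using deriv[OF R0] deriv[OF I0] Pos1_trace_pos[OF cpos_in_Pos1[OF q0']]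
    by (simp add: L_def metric_grad[OF y0] R_def I_def transpose_re_form transpose_im_form)
  note zg = zero_set_gradients[OF y0 a2, of a1, unfolded p0, folded R_def I_def, OF R0 I0]
  have "dim L + 2 = DIM('e)"
    unfolding LK by (rule kernel_orthogonal_pair(2)[OF y0 zg(3-6)])
  then show ?thesis
    using subL iff by (simp add: slice_chart_def c_def)
qed

text \<open>Lower bounds on lengths produce a limit in \<open>Pos1\<close>, and the linear equations
  pass to it. Segments in a slice chart around the limit then bound the induced distance to it,
  which turns matrix convergence into intrinsic convergence.\<close>

lemma complete_zero_set:
  fixes a1 a2 :: "real^'n"
  assumes a2: "a2 \<noteq> 0"
  shows "complete_submanifold M (zero_set a1 a2)"
  unfolding complete_submanifold_def
proof (intro allI impI)
  let ?N = "zero_set a1 a2"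
  fix X :: "nat \<Rightarrow> (real^'n^'n) set"
  assume X: "(\<forall>i. X i \<in> ?N) \<and> (\<forall>\<epsilon>>0. \<exists>K. \<forall>i\<ge>K. \<forall>j\<ge>K. induced_dist M ?N (X i) (X j) < \<epsilon>)"
  have XM: "X i \<in> coset ` SL" for i using X by (auto simp: zero_set_def)
  obtain P where P: "P \<in> Pos1" "(\<lambda>i. cpos (X i)) \<longlonglongrightarrow> P"
    using Cauchy_converges_in_Pos1[of X ?N] XM X by blast
  obtain x where x: "x \<in> SL" "P = gram x" using P(1) by (auto simp: Pos1_def)
  define q0 where "q0 = coset x"
  have q0M: "q0 \<in> coset ` SL" and cq0: "cpos q0 = P" using x by (auto simp: q0_def)
  have zero: "trace (S ** P) = 0" if "\<And>i. trace (S ** cpos (X i)) = 0" for S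
  proof -
    have "(\<lambda>i. trace (S ** cpos (X i))) \<longlonglongrightarrow> trace (S ** P)"
      by (intro bounded_linear.tendsto[OF bounded_linear_trace] bounded_linear.tendsto[OF mm.bounded_linear_right] P(2))
    then show ?thesis using that LIMSEQ_unique[OF _ tendsto_const[of "0::real"]] by simp
  qed
  have q0: "q0 \<in> ?N"
    using zero[of "re_form a1 a2"] zero[of "im_form a1 a2"] X q0M by (simp add: zero_set_def cq0)
  define c where "c = cbase (rbase (cpos q0))"
  define L where "L = {w. trace (re_form a1 a2 ** kappa w) = 0 \<and> trace (im_form a1 a2 ** kappa w) = 0}"
  have slice: "slice_chart ?N 2 (coset ` SL, c) L"
    unfolding c_def L_def by (rule slice_chart_zero_set[OF q0 a2])
  have chart: "chart_param (coset ` SL) c {P. 0 < trace P} (\<lambda>P. rbase P - rbase (cpos q0))"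
    unfolding c_def by (rule chart_param_base)
  then interpret chart_param "coset ` SL" c "{P. 0 < trace P}" "\<lambda>P. rbase P - rbase (cpos q0)" .
  have c0: "c q0 = 0" by (simp add: c_def cbase_def)
  have y0: "0 \<in> c ` coset ` SL" using q0M c0 by (metis imageI)
  obtain B \<epsilon> where B: "\<epsilon> > 0" "ball 0 \<epsilon> \<subseteq> c ` coset ` SL" "\<And>y u. y \<in> ball 0 \<epsilon> \<Longrightarrow> g y u u \<le> B * (norm u)\<^sup>2"
    by (rule metric_bounded_near[OF y0]) (rule that, assumption+)
  have "isCont rbase P"
    using smooth_on_continuous_on[OF smooth_on_rbase] open_trace_pos Pos1_trace_pos[OF P(1)]
    by (simp add: continuous_on_eq_continuous_at)
  then have "(\<lambda>i. rbase (cpos (X i))) \<longlonglongrightarrow> rbase P" by (rule isCont_tendsto_compose[OF _ P(2)])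
  then have lim: "(\<lambda>i. c (X i)) \<longlonglongrightarrow> 0"
    using LIM_zero[of "\<lambda>i. rbase (cpos (X i))" "rbase P"] by (simp add: c_def cbase_def cq0)
  have "\<forall>\<^sub>F i in sequentially. c (X i) \<in> ball 0 \<epsilon>"
    by (rule topological_tendstoD[OF lim open_ball]) (use B(1) in simp)
  then have up: "\<forall>\<^sub>F i in sequentially. induced_dist M ?N (X i) q0 \<le> ennreal (sqrt B * norm (c (X i)))"
  proof eventually_elim
    case (elim i)
    show ?case
      by (rule induced_dist_segment[OF in_quotient_charts refl, where L = L and \<epsilon> = \<epsilon>])
        (use slice X XM q0M c0 elim B in \<open>auto simp: slice_chart_def\<close>)
  qed
  have "(\<lambda>i. ennreal (sqrt B * norm (c (X i)))) \<longlonglongrightarrow> ennreal (sqrt B * norm (0 :: 'e))"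
    by (intro tendsto_intros lim)
  then have lim0: "(\<lambda>i. ennreal (sqrt B * norm (c (X i)))) \<longlonglongrightarrow> 0" by simp
  have "(\<lambda>i. induced_dist M ?N (X i) q0) \<longlonglongrightarrow> 0"
    by (rule tendsto_sandwich[OF _ up tendsto_const lim0]) simp
  then show "\<exists>p\<in>?N. (\<lambda>i. induced_dist M ?N (X i) p) \<longlonglongrightarrow> 0" using q0 by blast
qed

lemma minimal_zero_set:
  fixes a1 a2 :: "real^'n"
  assumes a2: "a2 \<noteq> 0"
  shows "minimal_submanifold M (zero_set a1 a2) 2"
proof -
  have "submanifold M (zero_set a1 a2) 2"
    unfolding submanifold_def
  proof (intro conjI ballI riemannian_manifold)
    show "zero_set a1 a2 \<subseteq> points M" by (auto simp: zero_set_def points_M)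
    fix q assume q: "q \<in> zero_set a1 a2"
    then have "q \<in> coset ` SL" by (simp add: zero_set_def)
    then show "\<exists>(U, c)\<in>charts M. q \<in> U \<and> (\<exists>L. slice_chart (zero_set a1 a2) 2 (U, c) L)"
      using slice_chart_zero_set[OF q a2] chart_param.in_quotient_charts[OF chart_param_base]
      unfolding charts_M by (intro bexI[of _ "(coset ` SL, cbase (rbase (cpos q)))"]) auto
  qed
  moreover have "(\<Sum>e\<in>E. second_fundamental_form (quotient_metric (U, c)) L (c q) e e) = 0"
    if chart: "(U, c) \<in> (quotient_charts :: ((real^'n^'n) set, 'e) chart set)" and slice: "slice_chart (zero_set a1 a2) 2 (U, c) L"
      and E: "q \<in> zero_set a1 a2 \<inter> U" "orthonormal_basis (quotient_metric (U, c)) L (c q) E" for U c L q E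
  proof -
    obtain W r where "chart_param U c W r" using chart_paramI[OF chart] by blast
    then interpret chart_param U c W r .
    show ?thesis
      by (rule minimal_local[OF a2 _ slice E, of a1]) (use U_subset in \<open>auto simp: zero_set_def\<close>)
  qed
  ultimately show ?thesis
    unfolding minimal_submanifold_def charts_M metric_M by blast
qed

lemma eigenfunction_quadratic:
  fixes a1 a2 :: "real^'n"
  assumes \<phi>: "\<And>q. q \<in> coset ` SL \<Longrightarrow>
    \<phi> q = Complex (trace (re_form a1 a2 ** cpos q)) (trace (im_form a1 a2 ** cpos q))"
  shows "eigenfunction M \<phi>"
proof -
  have chart: "smooth_on (c ` U) (\<phi> \<circ> inv_into U c) \<and> (\<forall>q\<in>U.
      laplace_beltrami (quotient_metric (U, c)) (\<phi> \<circ> inv_into U c) (c q) =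
        complex_of_real (2 * (real CARD('n) + 1 - 2 / real CARD('n))) * \<phi> q \<and>
      conformality (quotient_metric (U, c)) (\<phi> \<circ> inv_into U c) (\<phi> \<circ> inv_into U c) (c q) =
        complex_of_real (4 * (1 - 1 / real CARD('n))) * (\<phi> q)\<^sup>2)"
    if chart: "(U, c) \<in> (quotient_charts :: ((real^'n^'n) set, 'e) chart set)" for U c
  proof -
    obtain W r where "chart_param U c W r" using chart_paramI[OF chart] by blast
    then interpret chart_param U c W r .
    have f: "(\<phi> \<circ> inv_into U c) z = Complex (trace (re_form a1 a2 ** p z)) (trace (im_form a1 a2 ** p z))"
      if "z \<in> c ` U" for z
    proof -
      have "inv_into U c z \<in> coset ` SL" using inv_into_into[OF that] U_subset by blast
      then show ?thesis by (simp add: \<phi> p_def)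
    qed
    show ?thesis
      using smooth_local[OF f] eigenfunction_local[OF f] inj_c by fastforce
  qed
  show ?thesis
    unfolding eigenfunction_def charts_M metric_M
  proof (intro conjI riemannian_manifold exI)
    show "\<forall>(U, c)\<in>(quotient_charts :: ((real^'n^'n) set, 'e) chart set). smooth_on (c ` U) (\<phi> \<circ> inv_into U c)"
      using chart by blast
    show "\<forall>(U, c)\<in>(quotient_charts :: ((real^'n^'n) set, 'e) chart set). \<forall>q\<in>U.
      laplace_beltrami (quotient_metric (U, c)) (\<phi> \<circ> inv_into U c) (c q) =
        complex_of_real (2 * (real CARD('n) + 1 - 2 / real CARD('n))) * \<phi> q \<and>
      conformality (quotient_metric (U, c)) (\<phi> \<circ> inv_into U c) (\<phi> \<circ> inv_into U c) (c q) =
        complex_of_real (4 * (1 - 1 / real CARD('n))) * (\<phi> q)\<^sup>2"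
      using chart by blast
  qed
qed

end

lemma trace_complex_form:
  fixes a1 a2 :: "real^'n"
  shows "trace ((\<chi> j k. Complex (a1 $ j) (a2 $ j) * Complex (a1 $ k) (a2 $ k)) ** map_matrix complex_of_real P) =
    Complex (trace (re_form a1 a2 ** P)) (trace (im_form a1 a2 ** P))"
  by (simp add: complex_eq_iff trace_def matrix_matrix_mult_def re_form_def im_form_def outer_def)

lemma obtain_sym0_iso:
  assumes "DIM('e::euclidean_space) = CARD('n) * (CARD('n) + 1) div 2 - 1"
  obtains iota :: "real^'n^'n \<Rightarrow> 'e::euclidean_space" and kappa where "sym0_iso iota kappa"
proof -
  have "dim (sym0 :: (real^'n^'n) set) = dim (UNIV :: 'e set)"
    using assms by (simp add: dim_sym0)
  then obtain f :: "real^'n^'n \<Rightarrow> 'e" and g where "linear f" "linear g" "f ` sym0 = UNIV" "g ` UNIV = sym0"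
    "\<And>A. A \<in> sym0 \<Longrightarrow> g (f A) = A" "\<And>v. v \<in> UNIV \<Longrightarrow> f (g v) = v"
    using isometries_subspaces[OF subspace_sym0 subspace_UNIV] by metis
  then have "sym0_iso f g" unfolding sym0_iso_def by blast
  then show ?thesis by (rule that)
qed

theorem theorem2p1:
  fixes a1 a2 :: "real^'n" and a :: "complex^'n"
    and \<phi> :: "(real^'n^'n) set \<Rightarrow> complex"
    and M :: "((real^'n^'n) set, 'e::euclidean_space) riemannian"
  assumes "CARD('n) \<ge> 3"
    and "DIM('e) = CARD('n) * (CARD('n) + 1) div 2 - 1"
    and "M = SL_mod_SO"
    and "a = (\<chi> j. Complex (a1 $ j) (a2 $ j))"
    and "a1 \<noteq> a2" and "independent {a1, a2}"
    and "\<And>x. x \<in> SL \<Longrightarrow>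
           \<phi> (coset x) =
             trace ((\<chi> j k. a $ j * a $ k) ** map_matrix complex_of_real (x ** transpose x))"
  shows "eigenfunction M \<phi> \<and>
         minimal_submanifold M {p \<in> points M. \<phi> p = 0} 2 \<and>
         complete_submanifold M {p \<in> points M. \<phi> p = 0}"
proof -
  obtain iota :: "real^'n^'n \<Rightarrow> 'e" and kappa where "sym0_iso iota kappa"
    using obtain_sym0_iso[OF assms(2)] .
  then interpret sym0_iso iota kappa .
  \<comment> \<open>On the zero set this makes \<open>quad a2 P a2\<close> positive and hence 0 a
    regular value.\<close>
  have a2: "a2 \<noteq> 0" using assms(6) dependent_zero by blast
  have \<phi>: "\<phi> q = Complex (trace (re_form a1 a2 ** cpos q)) (trace (im_form a1 a2 ** cpos q))"
    if "q \<in> coset ` SL" for q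
    using that assms(7) trace_complex_form[of a1 a2] by (auto simp: assms(4) gram_def)
  have "{p \<in> points M. \<phi> p = 0} = zero_set a1 a2"
    by (auto simp: assms(3) points_M zero_set_def \<phi> complex_eq_iff simp del: cpos_coset)
  then show ?thesis
    using eigenfunction_quadratic[OF \<phi>] minimal_zero_set[OF a2] complete_zero_set[OF a2]
    by (simp add: assms(3))
qed

end
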